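(* Let $\varepsilon_1,\varepsilon_2,\dots$ be i.i.d. $N(0,\sigma^2)$ with $\sigma^2\le v$ for a known constant $v$, and, independently of these, let $X^1,X^2,\dots$ be drawn independently and uniformly at random from $\{dE_1,\dots,dE_{d^2}\}$, where $\{E_1,\dots,E_{d^2}\}\subset\mathbb H_d(\mathbb C)$ is a basis of $\mathbb M_d(\mathbb C)$ that is orthonormal for the Frobenius inner product and satisfies $\|E_i\|_{op}\le K/\sqrt d$ for all $i$ and some $K>0$. Suppose one observes, sequentially, $(Y_i,X^i)$ with $$Y_i=\mathrm{tr}(X^i\theta)+\varepsilon_i ,\qquad i=1,2,\dots,$$ where the unknown $\theta$ belongs to $\Theta_+$. Then for every $\epsilon>0$ and $\delta>0$ there exists an $(\epsilon,\delta)$-adaptive sampling procedure. That is, there exists a sequential algorithm (not using knowledge of the rank of $\theta$) which returns a $d\times d$ matrix $\hat\theta$ after a data-driven number $\hat n$ of measurements, such that for every $1\le k\le d$ and every $\theta\in R(k)\cap\Theta_+$, with $\mathbb P_\theta$-probability greater than $1-\delta$, both $$\|\hat\theta-\theta\|_F\le\epsilon\qquad\text{and}\qquad \hat n\le C(\delta)\,\frac{k\,d\,(\log d)^\gamma}{\epsilon^2}$$ hold, for some positive constants $C(\delta)$ and $\gamma$.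
   Context: $\mathbb M_d(\mathbb C)$ is the space of complex $d\times d$ matrices and $\mathbb H_d(\mathbb C)$ the set of Hermitian ones. $\|\cdot\|_F$ is the Frobenius norm and $\|\cdot\|_{op}$ the operator norm. $R(k)$ is the set of Hermitian $d\times d$ matrices of rank at most $k$. $\Theta_+=\{\theta\in\mathbb H_d(\mathbb C):\mathrm{tr}(\theta)=1,\ \theta\succeq0\}$ is the set of density matrices. $\mathbb P_\theta$ is the law of the observations $(Y,X)$ when the true parameter is $\theta$. The number $\hat n$ is a stopping time with respect to the sequence of observations, and $\hat\theta$ is a function of the first $\hat n$ observations. The constant $C(\delta)$ depends on $\delta$ (and may depend on the fixed model constants $K$ and $v$), and $\gamma$ is the exponent of the poly-log factor; they do not depend on $\theta$ or $k$, and the number of measurements required scales with $k$ and $d$ only as displayed. *)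

theory Defs
  imports "HOL-Probability.Probability" "Jordan_Normal_Form.DL_Rank"
    "Jordan_Normal_Form.Schur_Decomposition"
begin

text \<open>The constants of the theorem must be uniform in the dimension \<open>d\<close>, so matrices are
  \<^typ>\<open>complex mat\<close> with \<^term>\<open>carrier_mat d d\<close> rather than type-indexed.\<close>

definition mat_trace :: "complex mat \<Rightarrow> complex" where
  "mat_trace A = (\<Sum>i<dim_row A. A $$ (i, i))"

definition hermitian_mats :: "nat \<Rightarrow> complex mat set" where
  "hermitian_mats d = {A \<in> carrier_mat d d. mat_adjoint A = A}"

definition frob_inner :: "complex mat \<Rightarrow> complex mat \<Rightarrow> complex" where
  "frob_inner A B = mat_trace (mat_adjoint A * B)"

definition frob_norm :: "complex mat \<Rightarrow> real" where
  "frob_norm A = sqrt (\<Sum>i<dim_row A. \<Sum>j<dim_col A. (cmod (A $$ (i, j)))\<^sup>2)"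

definition vec_l2_norm :: "complex Matrix.vec \<Rightarrow> real" where
  "vec_l2_norm x = sqrt (Re (x \<bullet>c x))"

definition op_norm :: "complex mat \<Rightarrow> real" where
  "op_norm A = (SUP x \<in> {x \<in> carrier_vec (dim_col A). vec_l2_norm x \<le> 1}. vec_l2_norm (A *\<^sub>v x))"

definition rank_le_mats :: "nat \<Rightarrow> nat \<Rightarrow> complex mat set" where
  "rank_le_mats d k = {A \<in> hermitian_mats d. vec_space.rank d A \<le> k}"

definition density_mats :: "nat \<Rightarrow> complex mat set" where
  "density_mats d = {A \<in> hermitian_mats d. mat_trace A = 1 \<and>
     (\<forall>x \<in> carrier_vec d. 0 \<le> Re ((A *\<^sub>v x) \<bullet>c x))}"

text \<open>Linear independence over the complex numbers is implied by orthonormality.\<close>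

definition hermitian_onb :: "nat \<Rightarrow> (nat \<Rightarrow> complex mat) \<Rightarrow> bool" where
  "hermitian_onb d E \<longleftrightarrow>
     (\<forall>i<d\<^sup>2. E i \<in> hermitian_mats d) \<and>
     (\<forall>i<d\<^sup>2. \<forall>j<d\<^sup>2. frob_inner (E i) (E j) = (if i = j then 1 else 0)) \<and>
     (\<forall>A \<in> carrier_mat d d. \<exists>c :: nat \<Rightarrow> complex.
        \<forall>r<d. \<forall>s<d. A $$ (r, s) = (\<Sum>i<d\<^sup>2. c i * E i $$ (r, s)))"

definition design_set :: "nat \<Rightarrow> (nat \<Rightarrow> complex mat) \<Rightarrow> complex mat set" where
  "design_set d E = (\<lambda>i. of_nat d \<cdot>\<^sub>m E i) ` {..<d\<^sup>2}"

text \<open>\<^const>\<open>normal_density\<close> is a probability density only for positive standard deviation; the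
  degenerate law is the point mass at zero.\<close>

definition centred_gaussian :: "real \<Rightarrow> real measure" where
  "centred_gaussian \<sigma> = (if \<sigma> = 0 then return borel 0 else density lborel (normal_density 0 \<sigma>))"

definition obs_space :: "complex mat set \<Rightarrow> (real \<times> complex mat) measure" where
  "obs_space S = borel \<Otimes>\<^sub>M count_space S"

definition sample_space :: "complex mat set \<Rightarrow> nat \<Rightarrow> (nat \<Rightarrow> real \<times> complex mat) measure" where
  "sample_space S n = PiM {..<n} (\<lambda>_. obs_space S)"

definition seq_space :: "complex mat set \<Rightarrow> (nat \<Rightarrow> real \<times> complex mat) measure" where
  "seq_space S = PiM UNIV (\<lambda>_. obs_space S)"

text \<open>The law of the whole observation sequence; observations are numbered from 0. For Hermitian
  \<open>X\<close> and \<open>\<theta>\<close> the trace of \<open>X * \<theta>\<close> is real.\<close>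

definition obs_law ::
  "complex mat set \<Rightarrow> real \<Rightarrow> complex mat \<Rightarrow> (nat \<Rightarrow> real \<times> complex mat) measure" where
  "obs_law S \<sigma> \<theta> =
     distr (PiM UNIV (\<lambda>_::nat. centred_gaussian \<sigma>) \<Otimes>\<^sub>M PiM UNIV (\<lambda>_::nat. uniform_count_measure S))
       (seq_space S) (\<lambda>(noise, X) i. (Re (mat_trace (X i * \<theta>)) + noise i, X i))"

lemma prob_space_obs_law:
  assumes S: "finite S" "S \<noteq> {}" and "0 \<le> \<sigma>"
  shows "prob_space (obs_law S \<sigma> \<theta>)"
proof -
  let ?M = "PiM UNIV (\<lambda>_::nat. centred_gaussian \<sigma>) \<Otimes>\<^sub>M PiM UNIV (\<lambda>_::nat. uniform_count_measure S)"
  have [measurable_cong]: "sets (centred_gaussian \<sigma>) = sets borel"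
    "sets (uniform_count_measure S) = sets (count_space S)"
    by (simp_all add: centred_gaussian_def sets_uniform_count_measure)
  have tr: "(\<lambda>x. Re (mat_trace (snd x i * \<theta>))) \<in> borel_measurable ?M" for i
    by (rule measurable_compose[where f = "\<lambda>x. snd x i" and N = "count_space S"]) measurable
  have obs: "(\<lambda>x. (Re (mat_trace (snd x i * \<theta>)) + fst x i, snd x i)) \<in> ?M \<rightarrow>\<^sub>M obs_space S" for i
    unfolding obs_space_def
    by (intro borel_measurable_add measurable_Pair tr) measurable
  have "(\<lambda>(noise, X) i. (Re (mat_trace (X i * \<theta>)) + noise i, X i)) \<in> ?M \<rightarrow>\<^sub>M seq_space S"
    unfolding seq_space_def case_prod_beta
    using obs by (intro measurable_PiM_single') (auto dest: measurable_space)
  moreover have "prob_space (centred_gaussian \<sigma>)"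
    using \<open>0 \<le> \<sigma>\<close>
    by (auto simp: centred_gaussian_def prob_space_normal_density prob_space_return)
  then have "prob_space ?M"
    using S by (intro prob_space_pair prob_space_PiM prob_space_uniform_count_measure)
  ultimately show ?thesis
    unfolding obs_law_def by (intro prob_space.prob_space_distr)
qed

text \<open>\<open>obs_filtration S n\<close> is the information in the first \<open>n\<close> observations, numbers \<open>0, \<dots>, n - 1\<close>.\<close>

definition obs_filtration ::
  "complex mat set \<Rightarrow> nat \<Rightarrow> (nat \<Rightarrow> real \<times> complex mat) measure" where
  "obs_filtration S n =
     vimage_algebra (space (seq_space S)) (\<lambda>\<omega>. restrict \<omega> {..<n}) (sample_space S n)"

lemma filtration_obs_filtration: "filtration (space (seq_space S)) (obs_filtration S)"
proof
  fix i j :: nat assume "i \<le> j"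
  have "(\<lambda>\<omega>. restrict \<omega> {..<j}) \<in> obs_filtration S j \<rightarrow>\<^sub>M sample_space S j"
    unfolding obs_filtration_def
    by (rule measurable_vimage_algebra1)
      (auto simp: sample_space_def seq_space_def space_PiM PiE_iff)
  moreover have "(\<lambda>\<omega>. restrict \<omega> {..<i}) \<in> sample_space S j \<rightarrow>\<^sub>M sample_space S i"
    unfolding sample_space_def using \<open>i \<le> j\<close> by (intro measurable_restrict_subset) auto
  ultimately have "(\<lambda>\<omega>. restrict (restrict \<omega> {..<j}) {..<i}) \<in> obs_filtration S j \<rightarrow>\<^sub>M sample_space S i"
    by (rule measurable_compose)
  then have "(\<lambda>\<omega>. restrict \<omega> {..<i}) \<in> obs_filtration S j \<rightarrow>\<^sub>M sample_space S i"
    using \<open>i \<le> j\<close> by (simp add: restrict_restrict Int_absorb1)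
  then show "sets (obs_filtration S i) \<subseteq> sets (obs_filtration S j)"
    unfolding obs_filtration_def by (intro sets_image_in_sets) simp_all
qed (simp add: obs_filtration_def)

text \<open>A procedure is a stopping time \<open>N\<close> together with, for each \<open>n\<close>, the matrix \<open>est n\<close> returned
  from the first \<open>n\<close> observations when sampling stops after \<open>n\<close> of them. The type of \<open>N\<close> makes
  every procedure stop. There is no topology on \<^typ>\<open>complex mat\<close>, so measurability of \<open>est n\<close> is
  required entrywise.\<close>

definition sequential_procedure ::
  "nat \<Rightarrow> complex mat set \<Rightarrow> ((nat \<Rightarrow> real \<times> complex mat) \<Rightarrow> nat) \<Rightarrow>
     (nat \<Rightarrow> (nat \<Rightarrow> real \<times> complex mat) \<Rightarrow> complex mat) \<Rightarrow> bool" where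
  "sequential_procedure d S N est \<longleftrightarrow>
     stopping_time (obs_filtration S) N \<and>
     (\<forall>n. (\<forall>\<omega> \<in> space (sample_space S n). est n \<omega> \<in> carrier_mat d d) \<and>
          (\<forall>i<d. \<forall>j<d. (\<lambda>\<omega>. est n \<omega> $$ (i, j)) \<in> borel_measurable (sample_space S n)))"

definition returned_matrix ::
  "((nat \<Rightarrow> real \<times> complex mat) \<Rightarrow> nat) \<Rightarrow>
     (nat \<Rightarrow> (nat \<Rightarrow> real \<times> complex mat) \<Rightarrow> complex mat) \<Rightarrow>
     (nat \<Rightarrow> real \<times> complex mat) \<Rightarrow> complex mat" where
  "returned_matrix N est \<omega> = est (N \<omega>) (restrict \<omega> {..<N \<omega>})"

end

theory Submission
  imports Defs "Jordan_Normal_Form.Spectral_Radius"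
begin

text \<open>
  Write \<open>\<theta>\<^sub>n\<close> for the mean of \<open>Y\<^sub>i X\<^sub>i\<close> over the first \<open>n\<close> observations. Since the design is uniform on a
  rescaled orthonormal basis, Parseval's identity makes \<open>\<theta>\<^sub>n\<close> an unbiased estimator of \<open>\<theta>\<close>
  (\<open>hermitian_onb_Parseval\<close>, \<open>design_set_average\<close>). The proof has three ingredients.

  The first is the accuracy of \<open>\<theta>\<^sub>n\<close> in operator norm. For \<open>q \<ge> ln d\<close> the Schatten norm with exponent
  \<open>q\<close> is within a factor \<open>e\<close> of the operator norm, and for \<open>q\<close> a power of two its square is smooth with a
  constant of order \<open>q\<close> (\<open>schatten_norm_smooth\<close>). A smooth norm satisfies a type 2 inequality: the second
  moment of the norm of a sum of independent centred matrices is at most \<open>2 q\<close> times the sum of the second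
  moments (\<open>schatten_norm_type_2\<close>). The observation \<open>Y\<close> has bounded second moment and the design matrices have
  operator norm at most \<open>K \<surd>d\<close>, so the mean square error of \<open>\<theta>\<^sub>n\<close> is of order \<open>d ln d / n\<close>, and
  Markov's inequality gives a deviation bound (\<open>sample_mean_deviation\<close>).

  The second is that positivity acts as regularisation. If \<open>\<theta>\<close> and \<open>\<theta>'\<close> are density matrices and \<open>\<theta>\<close> has
  rank \<open>k\<close>, then \<open>\<theta>' - \<theta>\<close> has trace zero and at most \<open>k\<close> negative eigenvalues, so its Frobenius norm is at
  most \<open>\<surd>(2 k)\<close> times its operator norm (\<open>density_low_rank_frob_norm_le\<close>). Every density matrix close to
  \<open>\<theta>\<^sub>n\<close> in operator norm is therefore close to \<open>\<theta>\<close> in Frobenius norm, whatever its own rank. In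
  particular \<open>n\<close> of order \<open>k d / \<epsilon>\<^sup>2\<close>, up to logarithms, is enough for precision \<open>\<epsilon>\<close>.

  The third is a stopping rule that does not know \<open>k\<close>. The density matrices compatible with the data, called
  candidates, are an observable set that with high probability contains \<open>\<theta>\<close> up to a small error. If they
  are within \<open>\<epsilon> / 2\<close> of one another in Frobenius norm, any of them may be returned
  (\<open>first_candidate_accurate\<close>), and by the second ingredient this happens as soon as \<open>n\<close> is large enough
  for the rank of \<open>\<theta>\<close> (\<open>precise_if_low_rank\<close>). The procedure doubles \<open>n\<close> until the candidates agree
  (\<open>adaptive_procedure\<close>). There are \<open>O(ln d)\<close> sample sizes, so the union bound costs one logarithm; the
  smoothness constant \<open>q\<close> costs the other, whence the exponent 2.
\<close>

section \<open>Adjoints, traces and unitary matrices\<close>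

lemma index_mat_adjoint [simp]:
  "i < dim_col A \<Longrightarrow> j < dim_row A \<Longrightarrow> mat_adjoint A $$ (i, j) = conjugate (A $$ (j, i))"
  by (simp add: mat_adjoint_def mat_of_rows_index)

lemma dim_mat_adjoint [simp]: "dim_row (mat_adjoint A) = dim_col A" "dim_col (mat_adjoint A) = dim_row A"
  by (simp_all add: mat_adjoint_def)

lemma mat_adjoint_carrier [simp]: "A \<in> carrier_mat n m \<Longrightarrow> mat_adjoint A \<in> carrier_mat m n"
  by (intro carrier_matI) (simp_all add: carrier_matD)

lemma mat_adjoint_adjoint [simp]: "mat_adjoint (mat_adjoint A) = (A :: complex mat)"
  by (rule eq_matI) simp_all

lemma mat_adjoint_one [simp]: "mat_adjoint (1\<^sub>m n) = (1\<^sub>m n :: complex mat)"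
  by (rule eq_matI) auto

lemma mat_adjoint_mult:
  "A \<in> carrier_mat n m \<Longrightarrow> B \<in> carrier_mat m k \<Longrightarrow>
    mat_adjoint (A * B) = mat_adjoint B * mat_adjoint (A :: complex mat)"
  by (rule eq_matI) (auto simp: scalar_prod_def mult.commute)

lemma index_mult_mat_sum:
  "A \<in> carrier_mat n m \<Longrightarrow> B \<in> carrier_mat m k \<Longrightarrow> i < n \<Longrightarrow> j < k \<Longrightarrow>
    (A * B) $$ (i, j) = (\<Sum>l<m. A $$ (i, l) * B $$ (l, j))"
  by (auto simp: scalar_prod_def lessThan_atLeast0)

lemma hermitian_matsD:
  assumes "A \<in> hermitian_mats d"
  shows "A \<in> carrier_mat d d" "mat_adjoint A = A"
    "i < d \<Longrightarrow> j < d \<Longrightarrow> A $$ (i, j) = cnj (A $$ (j, i))"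
proof -
  show 1: "A \<in> carrier_mat d d" "mat_adjoint A = A"
    using assms by (auto simp: hermitian_mats_def)
  show "A $$ (i, j) = cnj (A $$ (j, i))" if "i < d" "j < d"
    using index_mat_adjoint[of i A j] that carrier_matD[OF 1(1)] unfolding 1(2) by (simp only: conjugate_complex_def)
qed

lemma hermitian_matsI:
  assumes A: "A \<in> carrier_mat d d"
    and eq: "\<And>i j. i < d \<Longrightarrow> j < d \<Longrightarrow> A $$ (i, j) = cnj (A $$ (j, i))"
  shows "A \<in> hermitian_mats d"
proof -
  have "mat_adjoint A = A"
  proof (rule eq_matI)
    fix i j assume "i < dim_row A" "j < dim_col A"
    then show "mat_adjoint A $$ (i, j) = A $$ (i, j)"
      using A eq[of i j] by simp
  qed (use A in auto)
  with A show ?thesis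
    by (simp add: hermitian_mats_def)
qed

lemma hermitian_mats_add [intro]:
  "A \<in> hermitian_mats d \<Longrightarrow> B \<in> hermitian_mats d \<Longrightarrow> A + B \<in> hermitian_mats d"
  using hermitian_matsD(1)[of A d] hermitian_matsD(1)[of B d]
  by (intro hermitian_matsI) (auto simp: hermitian_matsD(3)[of A d i j for i j, symmetric] hermitian_matsD(3)[of B d i j for i j, symmetric])

lemma hermitian_mats_diff [intro]:
  "A \<in> hermitian_mats d \<Longrightarrow> B \<in> hermitian_mats d \<Longrightarrow> A - B \<in> hermitian_mats d"
  using hermitian_matsD(1)[of A d] hermitian_matsD(1)[of B d]
  by (intro hermitian_matsI) (auto simp: hermitian_matsD(3)[of A d i j for i j, symmetric] hermitian_matsD(3)[of B d i j for i j, symmetric])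

lemma hermitian_mats_smult [intro]:
  "A \<in> hermitian_mats d \<Longrightarrow> complex_of_real c \<cdot>\<^sub>m A \<in> hermitian_mats d"
  using hermitian_matsD(1)[of A d]
  by (intro hermitian_matsI) (auto simp: hermitian_matsD(3)[of A d i j for i j, symmetric])

lemma hermitian_mats_zero [intro, simp]: "0\<^sub>m d d \<in> hermitian_mats d"
  by (rule hermitian_matsI) auto

lemma hermitian_mats_conj:
  assumes A: "A \<in> hermitian_mats d" and U: "U \<in> carrier_mat d m"
  shows "mat_adjoint U * A * U \<in> hermitian_mats m"
proof -
  note A' = hermitian_matsD(1,2)[OF A] and U' = mat_adjoint_carrier[OF U]
  note UA = mult_carrier_mat[OF U' A'(1)]
  have "mat_adjoint (mat_adjoint U * A * U) = mat_adjoint U * mat_adjoint (mat_adjoint U * A)"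
    by (rule mat_adjoint_mult[OF UA U])
  also have "mat_adjoint (mat_adjoint U * A) = A * U"
    using mat_adjoint_mult[OF U' A'(1)] unfolding A'(2) mat_adjoint_adjoint .
  also have "mat_adjoint U * (A * U) = mat_adjoint U * A * U"
    by (rule assoc_mult_mat[OF U' A'(1) U, symmetric])
  finally show ?thesis
    using mult_carrier_mat[OF UA U] by (simp add: hermitian_mats_def)
qed

lemma pow_mat_commute:
  assumes A: "A \<in> carrier_mat d d"
  shows "A * A ^\<^sub>m k = A ^\<^sub>m k * A"
proof (induction k)
  case 0
  show ?case using left_mult_one_mat[OF A] right_mult_one_mat[OF A] carrier_matD[OF A] by simp
next
  case (Suc k)
  have a: "A * (A ^\<^sub>m k * A) = (A * A ^\<^sub>m k) * A"
    by (rule assoc_mult_mat[OF A pow_carrier_mat[OF A] A, symmetric])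
  have b: "\<dots> = (A ^\<^sub>m k * A) * A"
    by (rule arg_cong[OF Suc.IH, of "\<lambda>M. M * A"])
  show ?case
    unfolding pow_mat.simps by (rule trans[OF a b])
qed

lemma hermitian_mats_pow:
  assumes "A \<in> hermitian_mats d"
  shows "A ^\<^sub>m k \<in> hermitian_mats d"
proof (induction k)
  case 0
  then show ?case
    using carrier_matD[OF hermitian_matsD(1)[OF assms]] by (simp add: hermitian_mats_def)
next
  case (Suc k)
  note A = hermitian_matsD(1,2)[OF assms] and Ak = hermitian_matsD(1,2)[OF Suc.IH]
  have "mat_adjoint (A ^\<^sub>m k * A) = mat_adjoint A * mat_adjoint (A ^\<^sub>m k)"
    by (rule mat_adjoint_mult[OF Ak(1) A(1)])
  also have "\<dots> = A ^\<^sub>m k * A"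
    unfolding A(2) Ak(2) by (rule pow_mat_commute[OF A(1)])
  finally show ?case
    using mult_carrier_mat[OF Ak(1) A(1)] by (simp add: hermitian_mats_def)
qed

lemma mat_trace_carrier: "A \<in> carrier_mat n m \<Longrightarrow> mat_trace A = (\<Sum>i<n. A $$ (i, i))"
  by (auto simp: mat_trace_def)

lemma mat_trace_mult:
  "A \<in> carrier_mat n m \<Longrightarrow> B \<in> carrier_mat m n \<Longrightarrow>
    mat_trace (A * B) = (\<Sum>i<n. \<Sum>j<m. A $$ (i, j) * B $$ (j, i))"
  by (subst mat_trace_carrier[of _ n n])
    (simp_all add: index_mult_mat_sum[of A n m B n] del: index_mult_mat)

lemma mat_trace_mult_commute:
  assumes "A \<in> carrier_mat n m" "B \<in> carrier_mat m n"
  shows "mat_trace (A * B) = mat_trace (B * A)"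
  unfolding mat_trace_mult[OF assms] mat_trace_mult[OF assms(2,1)]
  by (subst sum.swap) (simp add: mult.commute)

lemma mat_trace_add:
  "A \<in> carrier_mat n n \<Longrightarrow> B \<in> carrier_mat n n \<Longrightarrow> mat_trace (A + B) = mat_trace A + mat_trace B"
  by (auto simp: mat_trace_def sum.distrib)

lemma mat_trace_diff:
  "A \<in> carrier_mat n n \<Longrightarrow> B \<in> carrier_mat n n \<Longrightarrow> mat_trace (A - B) = mat_trace A - mat_trace B"
  by (auto simp: mat_trace_def sum_subtractf)

lemma mat_trace_smult: "A \<in> carrier_mat n n \<Longrightarrow> mat_trace (c \<cdot>\<^sub>m A) = c * mat_trace A"
  by (auto simp: mat_trace_def sum_distrib_left)

definition unitary_mat :: "nat \<Rightarrow> complex mat \<Rightarrow> bool" where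
  "unitary_mat n U \<longleftrightarrow> U \<in> carrier_mat n n \<and> mat_adjoint U * U = 1\<^sub>m n \<and> U * mat_adjoint U = 1\<^sub>m n"

lemma unitary_matD:
  assumes "unitary_mat n U"
  shows "U \<in> carrier_mat n n" "mat_adjoint U * U = 1\<^sub>m n" "U * mat_adjoint U = 1\<^sub>m n"
  using assms by (auto simp: unitary_mat_def)

lemma unitary_matI:
  assumes "U \<in> carrier_mat n n" "mat_adjoint U * U = 1\<^sub>m n"
  shows "unitary_mat n U"
  using assms mat_mult_left_right_inverse[of "mat_adjoint U" n U] by (auto simp: unitary_mat_def)

lemma unitary_mat_mult:
  assumes "unitary_mat n U" "unitary_mat n V"
  shows "unitary_mat n (U * V)"
proof (rule unitary_matI)
  note U = unitary_matD[OF assms(1)] and V = unitary_matD[OF assms(2)]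
  show "U * V \<in> carrier_mat n n"
    using U V by auto
  have "mat_adjoint (U * V) * (U * V) = mat_adjoint V * (mat_adjoint U * (U * V))"
    using U V by (simp add: mat_adjoint_mult[OF U(1) V(1)] assoc_mult_mat[of _ n n _ n _ n])
  also have "mat_adjoint U * (U * V) = V"
    using assoc_mult_mat[OF mat_adjoint_carrier[OF U(1)] U(1) V(1)] U(2) V(1) by simp
  finally show "mat_adjoint (U * V) * (U * V) = 1\<^sub>m n"
    using V by auto
qed

lemma unitary_mat_col_norm:
  assumes "unitary_mat n U" "j < n"
  shows "(\<Sum>i<n. (cmod (U $$ (i, j)))\<^sup>2) = 1"
proof -
  have "(mat_adjoint U * U) $$ (j, j) = 1"
    using unitary_matD[OF assms(1)] assms(2) by auto
  then have "(\<Sum>i<n. cnj (U $$ (i, j)) * U $$ (i, j)) = 1"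
    using unitary_matD(1)[OF assms(1)] assms(2)
    by (subst (asm) index_mult_mat_sum[of _ n n _ n]) auto
  then have "(\<Sum>i<n. complex_of_real ((cmod (U $$ (i, j)))\<^sup>2)) = 1"
    by (subst complex_norm_square) (simp add: mult.commute)
  then show ?thesis
    by (metis of_real_sum of_real_eq_1_iff)
qed

lemma unitary_mat_adjoint: "unitary_mat n U \<Longrightarrow> unitary_mat n (mat_adjoint U)"
  by (auto simp: unitary_mat_def)

lemma unitary_mat_row_norm:
  assumes "unitary_mat n U" "i < n"
  shows "(\<Sum>j<n. (cmod (U $$ (i, j)))\<^sup>2) = 1"
proof -
  have "(\<Sum>j<n. (cmod (U $$ (i, j)))\<^sup>2) = (\<Sum>j<n. (cmod (mat_adjoint U $$ (j, i)))\<^sup>2)"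
    using unitary_matD[OF assms(1)] assms(2) by (intro sum.cong) auto
  also have "\<dots> = 1"
    using unitary_mat_adjoint[OF assms(1)] assms(2) by (rule unitary_mat_col_norm)
  finally show ?thesis .
qed

section \<open>The spectral theorem for Hermitian matrices\<close>

definition real_diag_mat :: "nat \<Rightarrow> (nat \<Rightarrow> real) \<Rightarrow> complex mat" where
  "real_diag_mat n \<mu> = mat n n (\<lambda>(i, j). if i = j then of_real (\<mu> i) else 0)"

lemma real_diag_mat_carrier [simp]: "real_diag_mat n \<mu> \<in> carrier_mat n n"
  by (simp add: real_diag_mat_def)

text \<open>An eigenvector is completed to an orthogonal basis by Gram--Schmidt; normalising the basis
  vectors gives a unitary matrix whose first column is an eigenvector.\<close>

lemma unitary_with_eigenvector_column:
  fixes A :: "complex mat"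
  assumes A: "A \<in> carrier_mat (Suc n) (Suc n)"
  obtains W e where "unitary_mat (Suc n) W" "A *\<^sub>v col W 0 = e \<cdot>\<^sub>v col W 0"
proof -
  let ?n = "Suc n"
  from spectrum_non_empty[OF A] obtain e where "eigenvalue A e"
    by (auto simp: spectrum_def)
  then obtain v where "eigenvector A v e"
    by (auto simp: eigenvalue_def)
  then have v: "v \<in> carrier_vec ?n" "v \<noteq> 0\<^sub>v ?n" and Av: "A *\<^sub>v v = e \<cdot>\<^sub>v v"
    using A by (auto simp: eigenvector_def)
  define b where "b = basis_completion v"
  define ws where "ws = gram_schmidt ?n b"
  interpret cof_vec_space ?n "TYPE(complex)" .
  from basis_completion[OF v, folded b_def]
  have b: "distinct b" "\<not> lin_dep (set b)" "set b \<subseteq> carrier_vec ?n" "hd b = v" "length b = ?n"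
    by auto
  then obtain vs where bv: "b = v # vs"
    by (cases b) auto
  from gram_schmidt_result[OF b(3,1,2) refl, folded ws_def]
  have ws: "set ws \<subseteq> carrier_vec ?n" "corthogonal ws" "length ws = ?n"
    using b by auto
  have hdws: "ws ! 0 = v"
    using gram_schmidt_hd[OF v(1), of vs, folded bv] ws(3) unfolding ws_def
    by (metis hd_conv_nth length_0_conv nat.distinct(1))
  have wsi: "ws ! i \<in> carrier_vec ?n" if "i < ?n" for i
    using ws that by auto
  define s where "s i = Re ((ws ! i) \<bullet>c (ws ! i))" for i
  have s: "(ws ! i) \<bullet>c (ws ! i) = of_real (s i)" "s i > 0" if i: "i < ?n" for i
  proof -
    have eq: "(ws ! i) \<bullet>c (ws ! i) = of_real (\<Sum>l<?n. (cmod ((ws ! i) $ l))\<^sup>2)"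
      using wsi[OF i] unfolding of_real_sum
      by (subst complex_norm_square) (auto simp: scalar_prod_def lessThan_atLeast0)
    moreover have "(ws ! i) \<bullet>c (ws ! i) \<noteq> 0"
      using corthogonalD[OF ws(2), of i i] ws(3) i by auto
    ultimately show "(ws ! i) \<bullet>c (ws ! i) = of_real (s i)" "s i > 0"
      unfolding s_def by (auto simp: sum_nonneg less_le simp del: of_real_sum sum.lessThan_Suc)
  qed
  define W where "W = mat ?n ?n (\<lambda>(i, j). (ws ! j) $ i / of_real (sqrt (s j)))"
  have W: "W \<in> carrier_mat ?n ?n"
    by (simp add: W_def)
  have "mat_adjoint W * W = 1\<^sub>m ?n"
  proof (rule eq_matI)
    fix i j assume "i < dim_row (1\<^sub>m ?n :: complex mat)" "j < dim_col (1\<^sub>m ?n :: complex mat)"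
    then have ij: "i < ?n" "j < ?n"
      by auto
    have "(mat_adjoint W * W) $$ (i, j) = (\<Sum>l<?n. cnj (W $$ (l, i)) * W $$ (l, j))"
      using W ij by (subst index_mult_mat_sum[of _ ?n ?n _ ?n]) (auto intro!: sum.cong)
    also have "\<dots> = (\<Sum>l<?n. (ws ! j) $ l * cnj ((ws ! i) $ l)) / of_real (sqrt (s i) * sqrt (s j))"
      unfolding sum_divide_distrib using ij by (intro sum.cong) (auto simp: W_def)
    also have "(\<Sum>l<?n. (ws ! j) $ l * cnj ((ws ! i) $ l)) = (ws ! j) \<bullet>c (ws ! i)"
      using wsi[of i] ij by (auto simp: scalar_prod_def lessThan_atLeast0)
    also have "\<dots> / of_real (sqrt (s i) * sqrt (s j)) = (1\<^sub>m ?n) $$ (i, j)"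
    proof (cases "i = j")
      case True
      then show ?thesis
        using s[of i] ij by (simp flip: of_real_mult)
    next
      case False
      then show ?thesis
        using corthogonalD[OF ws(2), of j i] ws(3) ij by auto
    qed
    finally show "(mat_adjoint W * W) $$ (i, j) = 1\<^sub>m ?n $$ (i, j)" .
  qed (use W in auto)
  with W have "unitary_mat ?n W"
    by (rule unitary_matI)
  moreover have "col W 0 = of_real (1 / sqrt (s 0)) \<cdot>\<^sub>v v"
    using v hdws by (intro eq_vecI) (auto simp: W_def)
  then have "A *\<^sub>v col W 0 = e \<cdot>\<^sub>v col W 0"
    using v A Av mult_mat_vec[OF A v(1)] by (simp add: smult_smult_assoc mult.commute)
  ultimately show ?thesis
    by (rule that)
qed

lemma index_unitary_diag:
  assumes "U \<in> carrier_mat n n" "i < n" "j < n"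
  shows "(U * real_diag_mat n \<mu> * mat_adjoint U) $$ (i, j) =
    (\<Sum>l<n. of_real (\<mu> l) * (U $$ (i, l) * cnj (U $$ (j, l))))"
proof -
  have "(U * real_diag_mat n \<mu>) $$ (i, l) = of_real (\<mu> l) * U $$ (i, l)" if "l < n" for l
  proof -
    have "(U * real_diag_mat n \<mu>) $$ (i, l) = (\<Sum>m<n. if m = l then of_real (\<mu> l) * U $$ (i, l) else 0)"
      using assms that unfolding index_mult_mat_sum[OF assms(1) real_diag_mat_carrier assms(2) that]
      by (intro sum.cong) (auto simp: real_diag_mat_def)
    then show ?thesis
      using that by simp
  qed
  then show ?thesis
    using assms index_mult_mat_sum[of "U * real_diag_mat n \<mu>" n n "mat_adjoint U" n i j]
    by (simp add: mult.assoc)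
qed

lemma conj_mat_mult:
  fixes W :: "complex mat"
  assumes "W \<in> carrier_mat n n" "V \<in> carrier_mat n n" "D \<in> carrier_mat n n"
  shows "(W * V) * D * mat_adjoint (W * V) = W * (V * D * mat_adjoint V) * mat_adjoint W"
proof -
  note c = assms mat_adjoint_carrier[OF assms(1)] mat_adjoint_carrier[OF assms(2)]
  have "W * V * D * mat_adjoint (W * V) = (W * V * D) * (mat_adjoint V * mat_adjoint W)"
    by (simp add: mat_adjoint_mult[OF assms(1,2)])
  then show ?thesis
    using c by (simp add: assoc_mult_mat[of _ n n _ n _ n] mult_carrier_mat[of _ n n _ n])
qed

lemma conj_mat_cancel:
  assumes W: "unitary_mat n W" and A: "A \<in> carrier_mat n n"
  shows "W * (mat_adjoint W * A * W) * mat_adjoint W = A"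
proof -
  note c = unitary_matD[OF W] mat_adjoint_carrier[OF unitary_matD(1)[OF W]]
  have "W * (mat_adjoint W * A * W) * mat_adjoint W = (W * mat_adjoint W) * (A * (W * mat_adjoint W))"
    using c(1,4) A by (simp add: assoc_mult_mat[of _ n n _ n _ n] mult_carrier_mat[of _ n n _ n])
  then show ?thesis
    using A by (simp add: c(3))
qed

text \<open>Induction on the dimension: in a unitary basis that starts with an eigenvector, the first column of
  the matrix is a multiple of the first unit vector, hence so is the first row because the matrix is
  Hermitian, and the remaining block is a Hermitian matrix of smaller dimension.\<close>

theorem hermitian_spectral:
  assumes "A \<in> hermitian_mats n"
  shows "\<exists>U \<mu>. unitary_mat n U \<and> A = U * real_diag_mat n \<mu> * mat_adjoint U"
  using assms
proof (induction n arbitrary: A)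
  case 0
  have "A = 1\<^sub>m 0 * real_diag_mat 0 (\<lambda>_. 0) * mat_adjoint (1\<^sub>m 0)"
    using hermitian_matsD(1)[OF 0] by (intro eq_matI) auto
  moreover have "unitary_mat 0 (1\<^sub>m 0)"
    by (intro unitary_matI) auto
  ultimately show ?case
    by blast
next
  case (Suc n)
  let ?n = "Suc n"
  note A = hermitian_matsD(1,2)[OF Suc.prems]
  obtain W e where W: "unitary_mat ?n W" and Ww: "A *\<^sub>v col W 0 = e \<cdot>\<^sub>v col W 0"
    using unitary_with_eigenvector_column[OF A(1)] .
  note W1 = unitary_matD[OF W]
  define B where "B = mat_adjoint W * A * W"
  have B: "B \<in> hermitian_mats ?n"
    unfolding B_def by (rule hermitian_mats_conj[OF Suc.prems W1(1)])
  note BD = hermitian_matsD[OF B]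
  have B0: "B $$ (i, 0) = (if i = 0 then e else 0)" if i: "i < ?n" for i
  proof -
    have "B = mat_adjoint W * (A * W)"
      unfolding B_def by (rule assoc_mult_mat[OF mat_adjoint_carrier[OF W1(1)] A(1) W1(1)])
    then have "B $$ (i, 0) = row (mat_adjoint W) i \<bullet> col (A * W) 0"
      using i A W1(1) by simp
    also have "col (A * W) 0 = e \<cdot>\<^sub>v col W 0"
      using A W1(1) Ww by (subst col_mult2[of _ ?n ?n _ ?n]) auto
    also have "row (mat_adjoint W) i \<bullet> (e \<cdot>\<^sub>v col W 0) = e * (mat_adjoint W * W) $$ (i, 0)"
      using i W1(1) by simp
    finally show ?thesis
      using i unfolding W1(2) by simp
  qed
  have B0': "B $$ (0, j) = (if j = 0 then e else 0)" if j: "j < ?n" for j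
    using BD(3)[of 0 j] B0[OF j] j B0[of 0] by auto
  have "e = cnj e"
    using BD(3)[of 0 0] B0[of 0] by simp
  then have e: "complex_of_real (Re e) = e"
    by (simp add: complex_eq_iff)
  define C where "C = mat n n (\<lambda>(i, j). B $$ (Suc i, Suc j))"
  have "C \<in> hermitian_mats n"
  proof (rule hermitian_matsI)
    show "C $$ (i, j) = cnj (C $$ (j, i))" if "i < n" "j < n" for i j
      using that BD(3)[of "Suc i" "Suc j"] by (simp add: C_def)
  qed (simp add: C_def)
  then obtain V \<nu> where V: "unitary_mat n V" and C: "C = V * real_diag_mat n \<nu> * mat_adjoint V"
    using Suc.IH by blast
  note V1 = unitary_matD[OF V]
  define V' where "V' = mat ?n ?n (\<lambda>(i, j). case i of 0 \<Rightarrow> (case j of 0 \<Rightarrow> 1 | Suc _ \<Rightarrow> 0)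
     | Suc i' \<Rightarrow> (case j of 0 \<Rightarrow> 0 | Suc j' \<Rightarrow> V $$ (i', j')))"
  define \<mu> where "\<mu> = case_nat (Re e) \<nu>"
  have V': "V' \<in> carrier_mat ?n ?n"
    by (simp add: V'_def)
  have V'e: "V' $$ (0, 0) = 1" "j < n \<Longrightarrow> V' $$ (0, Suc j) = 0" "j < n \<Longrightarrow> V' $$ (Suc j, 0) = 0"
    "i < n \<Longrightarrow> j < n \<Longrightarrow> V' $$ (Suc i, Suc j) = V $$ (i, j)" for i j
    by (auto simp: V'_def)
  have V'u: "unitary_mat ?n V'"
  proof (rule unitary_matI[OF V'], rule eq_matI)
    fix i j assume "i < dim_row (1\<^sub>m ?n :: complex mat)" "j < dim_col (1\<^sub>m ?n :: complex mat)"
    then have ij: "i < ?n" "j < ?n"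
      by auto
    have "(mat_adjoint V' * V') $$ (i, j) = (\<Sum>l<?n. cnj (V' $$ (l, i)) * V' $$ (l, j))"
      using V' ij by (subst index_mult_mat_sum[of _ ?n ?n _ ?n]) (auto intro!: sum.cong)
    also have "\<dots> = cnj (V' $$ (0, i)) * V' $$ (0, j) + (\<Sum>l<n. cnj (V' $$ (Suc l, i)) * V' $$ (Suc l, j))"
      by (rule sum.lessThan_Suc_shift)
    also have "\<dots> = 1\<^sub>m ?n $$ (i, j)"
    proof (cases i; cases j)
      fix i' j' assume s: "i = Suc i'" "j = Suc j'"
      then have "(\<Sum>l<n. cnj (V' $$ (Suc l, i)) * V' $$ (Suc l, j)) = (mat_adjoint V * V) $$ (i', j')"
        using ij V1(1) by (subst index_mult_mat_sum[of _ n n _ n]) (auto simp: V'e)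
      then show ?thesis
        using s ij V1(2) by (simp add: V'e)
    qed (use ij in \<open>auto simp: V'e\<close>)
    finally show "(mat_adjoint V' * V') $$ (i, j) = 1\<^sub>m ?n $$ (i, j)" .
  qed (use V' in auto)
  have "B = V' * real_diag_mat ?n \<mu> * mat_adjoint V'"
  proof (rule eq_matI)
    fix i j assume "i < dim_row (V' * real_diag_mat ?n \<mu> * mat_adjoint V')"
      "j < dim_col (V' * real_diag_mat ?n \<mu> * mat_adjoint V')"
    then have ij: "i < ?n" "j < ?n"
      using V' by auto
    have "(V' * real_diag_mat ?n \<mu> * mat_adjoint V') $$ (i, j) =
      of_real (\<mu> 0) * (V' $$ (i, 0) * cnj (V' $$ (j, 0))) +
        (\<Sum>l<n. of_real (\<mu> (Suc l)) * (V' $$ (i, Suc l) * cnj (V' $$ (j, Suc l))))"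
      unfolding index_unitary_diag[OF V' ij] by (rule sum.lessThan_Suc_shift)
    also have "\<dots> = B $$ (i, j)"
    proof (cases i; cases j)
      fix i' j' assume s: "i = Suc i'" "j = Suc j'"
      then have "(\<Sum>l<n. of_real (\<mu> (Suc l)) * (V' $$ (i, Suc l) * cnj (V' $$ (j, Suc l)))) = C $$ (i', j')"
        using ij index_unitary_diag[OF V1(1), of i' j' \<nu>] by (simp add: V'e \<mu>_def flip: C)
      then show ?thesis
        using s ij by (simp add: V'e C_def)
    qed (use ij in \<open>auto simp: V'e B0 B0' \<mu>_def e\<close>)
    finally show "B $$ (i, j) = (V' * real_diag_mat ?n \<mu> * mat_adjoint V') $$ (i, j)" ..
  qed (use V' BD(1) in auto)
  then have "A = W * (V' * real_diag_mat ?n \<mu> * mat_adjoint V') * mat_adjoint W"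
    using conj_mat_cancel[OF W A(1)] by (simp only: B_def)
  also have "\<dots> = (W * V') * real_diag_mat ?n \<mu> * mat_adjoint (W * V')"
    by (rule conj_mat_mult[OF W1(1) V' real_diag_mat_carrier, symmetric])
  finally show ?case
    using unitary_mat_mult[OF W V'u] by blast
qed

section \<open>Schatten norms of even order\<close>

definition eigendecomposition :: "nat \<Rightarrow> complex mat \<Rightarrow> complex mat \<Rightarrow> (nat \<Rightarrow> real) \<Rightarrow> bool" where
  "eigendecomposition n A U \<mu> \<longleftrightarrow> unitary_mat n U \<and> A = U * real_diag_mat n \<mu> * mat_adjoint U"

lemma hermitian_eigendecomposition:
  assumes "A \<in> hermitian_mats n"
  obtains U \<mu> where "eigendecomposition n A U \<mu>"
  using hermitian_spectral[OF assms] that by (auto simp: eigendecomposition_def)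

lemma real_diag_mat_mult:
  "real_diag_mat n \<mu> * real_diag_mat n \<nu> = real_diag_mat n (\<lambda>l. \<mu> l * \<nu> l)"
proof (rule eq_matI)
  fix i j assume "i < dim_row (real_diag_mat n (\<lambda>l. \<mu> l * \<nu> l))" "j < dim_col (real_diag_mat n (\<lambda>l. \<mu> l * \<nu> l))"
  then have ij: "i < n" "j < n"
    by (auto simp: real_diag_mat_def)
  have "(real_diag_mat n \<mu> * real_diag_mat n \<nu>) $$ (i, j) =
      (\<Sum>l<n. if l = i then (if i = j then of_real (\<mu> i * \<nu> i) else 0) else 0)"
    using ij unfolding index_mult_mat_sum[OF real_diag_mat_carrier real_diag_mat_carrier ij]
    by (intro sum.cong) (auto simp: real_diag_mat_def)
  then show "(real_diag_mat n \<mu> * real_diag_mat n \<nu>) $$ (i, j) = real_diag_mat n (\<lambda>l. \<mu> l * \<nu> l) $$ (i, j)"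
    using ij by (simp add: real_diag_mat_def)
qed (auto simp: real_diag_mat_def)

lemma eigendecomposition_pow:
  assumes "eigendecomposition n A U \<mu>"
  shows "eigendecomposition n (A ^\<^sub>m k) U (\<lambda>l. \<mu> l ^ k)"
proof -
  have U: "unitary_mat n U" and A: "A = U * real_diag_mat n \<mu> * mat_adjoint U"
    using assms by (auto simp: eigendecomposition_def)
  note U1 = unitary_matD[OF U] mat_adjoint_carrier[OF unitary_matD(1)[OF U]]
  have dA: "dim_row A = n"
    using U1 by (simp add: A)
  have "A ^\<^sub>m k = U * real_diag_mat n (\<lambda>l. \<mu> l ^ k) * mat_adjoint U"
  proof (induction k)
    case 0
    have "real_diag_mat n (\<lambda>l. 1) = 1\<^sub>m n"
      by (rule eq_matI) (auto simp: real_diag_mat_def)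
    then show ?case
      using U1 dA by simp
  next
    case (Suc k)
    have "A ^\<^sub>m Suc k =
        (U * real_diag_mat n (\<lambda>l. \<mu> l ^ k) * mat_adjoint U) * (U * real_diag_mat n \<mu> * mat_adjoint U)"
      by (simp only: pow_mat.simps Suc.IH) (simp only: A)
    also have "\<dots> = U * real_diag_mat n (\<lambda>l. \<mu> l ^ k) * (mat_adjoint U * U) * real_diag_mat n \<mu> * mat_adjoint U"
      using U1(1,4) by (simp add: assoc_mult_mat[of _ n n _ n _ n] mult_carrier_mat[of _ n n _ n])
    also have "\<dots> = U * (real_diag_mat n (\<lambda>l. \<mu> l ^ k) * real_diag_mat n \<mu>) * mat_adjoint U"
      using U1(1,4) left_mult_one_mat[of "real_diag_mat n \<mu> * mat_adjoint U" n n] unfolding U1(2)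
      by (simp add: assoc_mult_mat[of _ n n _ n _ n] mult_carrier_mat[of _ n n _ n])
    finally show ?case
      by (simp add: real_diag_mat_mult mult.commute)
  qed
  with U show ?thesis
    by (simp add: eigendecomposition_def)
qed

lemma trace_mult_eigendecomposition:
  assumes "eigendecomposition n A U \<mu>" and B: "B \<in> carrier_mat n n"
  shows "mat_trace (A * B) = (\<Sum>l<n. of_real (\<mu> l) * (mat_adjoint U * B * U) $$ (l, l))"
proof -
  have U: "unitary_mat n U" and A: "A = U * real_diag_mat n \<mu> * mat_adjoint U"
    using assms by (auto simp: eigendecomposition_def)
  note U1 = unitary_matD(1)[OF U] mat_adjoint_carrier[OF unitary_matD(1)[OF U]]
  let ?D = "real_diag_mat n \<mu>" and ?C = "mat_adjoint U * B * U"
  have UB: "mat_adjoint U * B \<in> carrier_mat n n"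
    by (rule mult_carrier_mat[OF U1(2) B])
  then have C: "?C \<in> carrier_mat n n"
    by (rule mult_carrier_mat[OF _ U1(1)])
  have "mat_trace (A * B) = mat_trace (U * (?D * (mat_adjoint U * B)))"
    using U1 B unfolding A by (simp add: assoc_mult_mat[of _ n n _ n _ n] mult_carrier_mat[of _ n n _ n])
  also have "\<dots> = mat_trace (?D * (mat_adjoint U * B) * U)"
    by (rule mat_trace_mult_commute[OF U1(1) mult_carrier_mat[OF real_diag_mat_carrier UB]])
  also have "?D * (mat_adjoint U * B) * U = ?D * ?C"
    using U1 B by (simp add: assoc_mult_mat[of _ n n _ n _ n] mult_carrier_mat[of _ n n _ n])
  also have "mat_trace (?D * ?C) = (\<Sum>i<n. \<Sum>j<n. if j = i then of_real (\<mu> i) * ?C $$ (i, i) else 0)"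
    unfolding mat_trace_mult[OF real_diag_mat_carrier C]
    by (intro sum.cong refl) (auto simp: real_diag_mat_def)
  finally show ?thesis
    by simp
qed

lemma trace_eigendecomposition:
  assumes "eigendecomposition n A U \<mu>"
  shows "mat_trace A = of_real (\<Sum>l<n. \<mu> l)"
proof -
  have U: "unitary_mat n U" and A: "A = U * real_diag_mat n \<mu> * mat_adjoint U"
    using assms by (auto simp: eigendecomposition_def)
  have "mat_trace A = mat_trace (A * 1\<^sub>m n)"
    using unitary_matD(1)[OF U] by (simp add: A)
  also have "\<dots> = (\<Sum>l<n. of_real (\<mu> l) * (mat_adjoint U * 1\<^sub>m n * U) $$ (l, l))"
    by (rule trace_mult_eigendecomposition[OF assms one_carrier_mat])
  finally show ?thesis
    using unitary_matD[OF U] by simp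
qed

text \<open>For even \<open>q\<close> and Hermitian \<open>A\<close> this is the sum of the \<open>q\<close>-th powers of the moduli of the eigenvalues.
  The trace formula needs no choice of eigenvalues, and makes measurability immediate.\<close>

definition trace_pow :: "nat \<Rightarrow> complex mat \<Rightarrow> real" where
  "trace_pow q A = Re (mat_trace (A ^\<^sub>m q))"

definition schatten_norm :: "nat \<Rightarrow> complex mat \<Rightarrow> real" where
  "schatten_norm q A = root q (trace_pow q A)"

lemma trace_pow_eigendecomposition:
  "eigendecomposition n A U \<mu> \<Longrightarrow> trace_pow q A = (\<Sum>l<n. \<mu> l ^ q)"
  unfolding trace_pow_def by (subst trace_eigendecomposition[OF eigendecomposition_pow]) auto

lemma trace_pow_nonneg:
  assumes "A \<in> hermitian_mats n" "even q"
  shows "0 \<le> trace_pow q A"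
proof -
  obtain U \<mu> where "eigendecomposition n A U \<mu>"
    using hermitian_eigendecomposition[OF assms(1)] .
  from trace_pow_eigendecomposition[OF this] show ?thesis
    using assms(2) by (auto intro!: sum_nonneg)
qed

lemma schatten_norm_nonneg:
  assumes "A \<in> hermitian_mats n" "even q"
  shows "0 \<le> schatten_norm q A"
  using trace_pow_nonneg[OF assms] by (cases "q = 0") (auto simp: schatten_norm_def)

lemma schatten_norm_pow:
  assumes "A \<in> hermitian_mats n" "even q" "q > 0"
  shows "schatten_norm q A ^ q = trace_pow q A"
  using trace_pow_nonneg[OF assms(1,2)] assms(3) by (simp add: schatten_norm_def)

lemma eigendecomposition_conj:
  assumes "eigendecomposition n A V \<mu>" and U: "unitary_mat n U"
  shows "eigendecomposition n (mat_adjoint U * A * U) (mat_adjoint U * V) \<mu>"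
proof -
  have V: "unitary_mat n V" and A: "A = V * real_diag_mat n \<mu> * mat_adjoint V"
    using assms by (auto simp: eigendecomposition_def)
  have "mat_adjoint U * A * U = (mat_adjoint U * V) * real_diag_mat n \<mu> * mat_adjoint (mat_adjoint U * V)"
    using conj_mat_mult[of "mat_adjoint U" n V "real_diag_mat n \<mu>"] unitary_matD(1)[OF U] unitary_matD(1)[OF V]
    by (simp add: A)
  then show ?thesis
    using unitary_mat_mult[OF unitary_mat_adjoint[OF U] V] by (simp add: eigendecomposition_def)
qed

lemma trace_pow_conj:
  assumes "A \<in> hermitian_mats n" "unitary_mat n U"
  shows "trace_pow q (mat_adjoint U * A * U) = trace_pow q A"
proof -
  obtain V \<mu> where V: "eigendecomposition n A V \<mu>"
    using hermitian_eigendecomposition[OF assms(1)] .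
  show ?thesis
    unfolding trace_pow_eigendecomposition[OF V]
      trace_pow_eigendecomposition[OF eigendecomposition_conj[OF V assms(2)]] ..
qed

lemma Re_diag_eigendecomposition:
  assumes "eigendecomposition n A U \<mu>" "j < n"
  shows "Re (A $$ (j, j)) = (\<Sum>l<n. (cmod (U $$ (j, l)))\<^sup>2 * \<mu> l)"
proof -
  have U: "unitary_mat n U" and A: "A = U * real_diag_mat n \<mu> * mat_adjoint U"
    using assms by (auto simp: eigendecomposition_def)
  have "A $$ (j, j) = of_real (\<Sum>l<n. (cmod (U $$ (j, l)))\<^sup>2 * \<mu> l)"
    using index_unitary_diag[OF unitary_matD(1)[OF U] assms(2,2), of \<mu>]
    by (simp add: A complex_norm_square mult.commute del: of_real_power)
  then show ?thesis
    by simp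
qed

text \<open>The diagonal entries are averages of the eigenvalues with weights that form a doubly
  stochastic matrix, so convexity of \<open>x ^ q\<close> applies.\<close>

lemma sum_diag_pow_le_trace_pow:
  assumes A: "A \<in> hermitian_mats n" and q: "even q"
  shows "(\<Sum>j<n. Re (A $$ (j, j)) ^ q) \<le> trace_pow q A"
proof -
  obtain U \<mu> where E: "eigendecomposition n A U \<mu>"
    using hermitian_eigendecomposition[OF A] .
  then have U: "unitary_mat n U"
    by (simp add: eigendecomposition_def)
  let ?w = "\<lambda>j l. (cmod (U $$ (j, l)))\<^sup>2"
  have "Re (A $$ (j, j)) ^ q \<le> (\<Sum>l<n. ?w j l * \<mu> l ^ q)" if j: "j < n" for j
    unfolding Re_diag_eigendecomposition[OF E j]
    using convex_on_sum[of "{..<n}" UNIV "\<lambda>x::real. x ^ q" "?w j" \<mu>] j q unitary_mat_row_norm[OF U j]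
    by (auto simp: convex_power_even)
  then have "(\<Sum>j<n. Re (A $$ (j, j)) ^ q) \<le> (\<Sum>j<n. \<Sum>l<n. ?w j l * \<mu> l ^ q)"
    by (intro sum_mono) auto
  also have "\<dots> = (\<Sum>l<n. (\<Sum>j<n. ?w j l) * \<mu> l ^ q)"
    by (subst sum.swap) (simp add: sum_distrib_right)
  also have "\<dots> = (\<Sum>l<n. \<mu> l ^ q)"
    using unitary_mat_col_norm[OF U] by simp
  finally show ?thesis
    by (simp add: trace_pow_eigendecomposition[OF E])
qed

text \<open>The graph of the convex function \<open>x ^ q\<close> lies above its tangent at \<open>x\<close>. For even \<open>q\<close> no signs need to
  be considered.\<close>

lemma even_power_Young:
  fixes x y :: real
  assumes q: "even q" "q > 0"
  shows "real q * x ^ (q - 1) * y \<le> (real q - 1) * x ^ q + y ^ q"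
proof -
  have "y ^ q - x ^ q \<ge> (q * x ^ (q - 1)) * (y - x)"
  proof (rule convex_on_imp_above_tangent[where A = UNIV])
    show "((\<lambda>x. x ^ q) has_real_derivative q * x ^ (q - 1)) (at x within UNIV)"
      by (auto intro!: derivative_eq_intros)
  qed (use q in \<open>auto simp: convex_power_even\<close>)
  moreover have "x ^ q = x ^ (q - 1) * x"
    using q by (metis mult.commute power_minus_mult)
  ultimately show ?thesis
    using q by (simp add: algebra_simps of_nat_diff)
qed

lemma even_Hoelder_sum:
  fixes a b :: "'i \<Rightarrow> real"
  assumes q: "even q" "q > 0" and I: "finite I"
  shows "(\<Sum>i\<in>I. a i ^ (q - 1) * b i) \<le> root q (\<Sum>i\<in>I. a i ^ q) ^ (q - 1) * root q (\<Sum>i\<in>I. b i ^ q)"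
proof -
  define s where "s = root q (\<Sum>i\<in>I. a i ^ q)"
  define t where "t = root q (\<Sum>i\<in>I. b i ^ q)"
  have nn: "(\<Sum>i\<in>I. a i ^ q) \<ge> 0" "(\<Sum>i\<in>I. b i ^ q) \<ge> 0"
    using q by (auto intro!: sum_nonneg)
  have st: "s \<ge> 0" "t \<ge> 0" "s ^ q = (\<Sum>i\<in>I. a i ^ q)" "t ^ q = (\<Sum>i\<in>I. b i ^ q)"
    using nn q by (auto simp: s_def t_def)
  have q1: "q - 1 > 0"
    using q by (metis One_nat_def Suc_lessI odd_one zero_less_diff)
  show ?thesis
  proof (cases "s = 0 \<or> t = 0")
    case True
    then have "(\<forall>i\<in>I. a i = 0) \<or> (\<forall>i\<in>I. b i = 0)"
    proof
      assume "s = 0"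
      then have "(\<Sum>i\<in>I. a i ^ q) = 0"
        using q(2) by (simp flip: st(3))
      then show ?thesis
        using I q by (subst (asm) sum_nonneg_eq_0_iff) auto
    next
      assume "t = 0"
      then have "(\<Sum>i\<in>I. b i ^ q) = 0"
        using q(2) by (simp flip: st(4))
      then show ?thesis
        using I q by (subst (asm) sum_nonneg_eq_0_iff) auto
    qed
    then have "(\<Sum>i\<in>I. a i ^ (q - 1) * b i) = 0"
      using q1 by (auto intro!: sum.neutral)
    then show ?thesis
      using st by (simp flip: s_def t_def)
  next
    case False
    with st have pos: "s > 0" "t > 0"
      by auto
    have "q * (a i ^ (q - 1) * b i) \<le> ((real q - 1) * (a i ^ q / s ^ q) + b i ^ q / t ^ q) * (s ^ (q - 1) * t)" for i
    proof -
      have "q * (a i / s) ^ (q - 1) * (b i / t) \<le> (real q - 1) * (a i / s) ^ q + (b i / t) ^ q"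
        using q by (rule even_power_Young)
      then have "q * (a i / s) ^ (q - 1) * (b i / t) * (s ^ (q - 1) * t) \<le>
          ((real q - 1) * (a i / s) ^ q + (b i / t) ^ q) * (s ^ (q - 1) * t)"
        using pos by (intro mult_right_mono) auto
      moreover have "q * (a i / s) ^ (q - 1) * (b i / t) * (s ^ (q - 1) * t) = q * (a i ^ (q - 1) * b i)"
        using pos by (simp add: power_divide)
      ultimately show ?thesis
        by (simp add: power_divide)
    qed
    then have "(\<Sum>i\<in>I. q * (a i ^ (q - 1) * b i)) \<le>
      (\<Sum>i\<in>I. ((real q - 1) * (a i ^ q / s ^ q) + b i ^ q / t ^ q) * (s ^ (q - 1) * t))"
      by (intro sum_mono)
    also have "\<dots> = ((real q - 1) * ((\<Sum>i\<in>I. a i ^ q) / s ^ q) + (\<Sum>i\<in>I. b i ^ q) / t ^ q) * (s ^ (q - 1) * t)"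
      unfolding sum_distrib_right[symmetric] sum.distrib sum_divide_distrib sum_distrib_left ..
    also have "\<dots> = q * (s ^ (q - 1) * t)"
      using pos q by (simp add: of_nat_diff flip: st(3,4))
    finally show ?thesis
      using q by (simp add: s_def t_def flip: sum_distrib_left)
  qed
qed

text \<open>In an eigenbasis of \<open>A\<close> only the diagonal of \<open>B\<close> enters the trace, and the norm of that diagonal is at
  most the Schatten norm of \<open>B\<close>.\<close>

lemma schatten_Hoelder:
  assumes A: "A \<in> hermitian_mats n" and B: "B \<in> hermitian_mats n" and q: "even q" "q > 0"
  shows "Re (mat_trace (A ^\<^sub>m (q - 1) * B)) \<le> schatten_norm q A ^ (q - 1) * schatten_norm q B"
proof -
  obtain U \<mu> where E: "eigendecomposition n A U \<mu>"
    using hermitian_eigendecomposition[OF A] .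
  then have U: "unitary_mat n U"
    by (simp add: eigendecomposition_def)
  let ?C = "mat_adjoint U * B * U"
  have C: "?C \<in> hermitian_mats n"
    by (rule hermitian_mats_conj[OF B unitary_matD(1)[OF U]])
  have "Re (mat_trace (A ^\<^sub>m (q - 1) * B)) = (\<Sum>l<n. \<mu> l ^ (q - 1) * Re (?C $$ (l, l)))"
    using trace_mult_eigendecomposition[OF eigendecomposition_pow[OF E] hermitian_matsD(1)[OF B], of "q - 1"]
    by (simp flip: of_real_power)
  also have "\<dots> \<le> root q (\<Sum>l<n. \<mu> l ^ q) ^ (q - 1) * root q (\<Sum>l<n. Re (?C $$ (l, l)) ^ q)"
    using q by (intro even_Hoelder_sum) auto
  also have "\<dots> \<le> schatten_norm q A ^ (q - 1) * schatten_norm q B"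
  proof (rule mult_mono)
    show "root q (\<Sum>l<n. \<mu> l ^ q) ^ (q - 1) \<le> schatten_norm q A ^ (q - 1)"
      by (simp add: schatten_norm_def trace_pow_eigendecomposition[OF E])
    show "root q (\<Sum>l<n. Re (?C $$ (l, l)) ^ q) \<le> schatten_norm q B"
      using sum_diag_pow_le_trace_pow[OF C q(1)] q trace_pow_conj[OF B U]
      by (simp add: schatten_norm_def)
  qed (use schatten_norm_nonneg[OF A q(1)] q in \<open>auto intro!: sum_nonneg\<close>)
  finally show ?thesis .
qed

lemma trace_pow_Suc:
  "A \<in> carrier_mat n n \<Longrightarrow> q > 0 \<Longrightarrow> trace_pow q A = Re (mat_trace (A ^\<^sub>m (q - 1) * A))"
  by (cases q) (auto simp: trace_pow_def)

text \<open>As for sequence spaces, from Hoelder's inequality for \<open>(A + B) ^ (q - 1)\<close> with \<open>A\<close> and with \<open>B\<close>.\<close>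

lemma schatten_norm_triangle:
  assumes A: "A \<in> hermitian_mats n" and B: "B \<in> hermitian_mats n" and q: "even q" "q > 0"
  shows "schatten_norm q (A + B) \<le> schatten_norm q A + schatten_norm q B"
proof -
  have AB: "A + B \<in> hermitian_mats n"
    using A B by blast
  note c = hermitian_matsD(1)[OF A] hermitian_matsD(1)[OF B] hermitian_matsD(1)[OF AB]
  let ?s = "schatten_norm q (A + B)"
  have "?s ^ (q - 1) * ?s = Re (mat_trace ((A + B) ^\<^sub>m (q - 1) * (A + B)))"
    using schatten_norm_pow[OF AB q] trace_pow_Suc[OF c(3) q(2)] power_minus_mult[OF q(2), of ?s] by simp
  also have "(A + B) ^\<^sub>m (q - 1) * (A + B) = (A + B) ^\<^sub>m (q - 1) * A + (A + B) ^\<^sub>m (q - 1) * B"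
    by (rule mult_add_distrib_mat[OF pow_carrier_mat[OF c(3)] c(1,2)])
  also have "Re (mat_trace \<dots>) = Re (mat_trace ((A + B) ^\<^sub>m (q - 1) * A)) + Re (mat_trace ((A + B) ^\<^sub>m (q - 1) * B))"
    using mat_trace_add[OF mult_carrier_mat[OF pow_carrier_mat[OF c(3)] c(1)]
       mult_carrier_mat[OF pow_carrier_mat[OF c(3)] c(2)]] by simp
  also have "\<dots> \<le> ?s ^ (q - 1) * schatten_norm q A + ?s ^ (q - 1) * schatten_norm q B"
    by (intro add_mono schatten_Hoelder[OF AB A q] schatten_Hoelder[OF AB B q])
  finally have *: "?s ^ (q - 1) * ?s \<le> ?s ^ (q - 1) * (schatten_norm q A + schatten_norm q B)"
    by (simp add: algebra_simps)
  show ?thesis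
  proof (cases "?s = 0")
    case True
    then show ?thesis
      using schatten_norm_nonneg[OF A q(1)] schatten_norm_nonneg[OF B q(1)] by simp
  next
    case False
    then have "?s ^ (q - 1) > 0"
      using schatten_norm_nonneg[OF AB q(1)] by simp
    with * show ?thesis
      by simp
  qed
qed

lemma pow_mat_smult:
  assumes "A \<in> carrier_mat n n"
  shows "(c \<cdot>\<^sub>m A) ^\<^sub>m k = (c ^ k :: complex) \<cdot>\<^sub>m (A ^\<^sub>m k)"
proof (induction k)
  case 0
  then show ?case
    by (intro eq_matI) auto
next
  case (Suc k)
  have "(c \<cdot>\<^sub>m A) ^\<^sub>m Suc k = (c ^ k \<cdot>\<^sub>m (A ^\<^sub>m k)) * (c \<cdot>\<^sub>m A)"
    by (simp add: Suc)
  also have "\<dots> = c \<cdot>\<^sub>m (c ^ k \<cdot>\<^sub>m (A ^\<^sub>m k * A))"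
    using assms pow_carrier_mat[OF assms, of k]
    by (simp add: mult_smult_distrib[of _ n n _ n] mult_smult_assoc_mat[of _ n n _ n])
  finally show ?case
    by (intro eq_matI) auto
qed

lemma trace_pow_smult:
  assumes "A \<in> carrier_mat n n"
  shows "trace_pow q (complex_of_real c \<cdot>\<^sub>m A) = c ^ q * trace_pow q A"
  using mat_trace_smult[OF pow_carrier_mat[OF assms], of "complex_of_real c ^ q" q]
  by (simp add: trace_pow_def pow_mat_smult[OF assms] flip: of_real_power)

lemma schatten_norm_smult:
  assumes "A \<in> carrier_mat n n" "even q" "q > 0"
  shows "schatten_norm q (complex_of_real c \<cdot>\<^sub>m A) = \<bar>c\<bar> * schatten_norm q A"
proof -
  have "root q (c ^ q) = \<bar>c\<bar>"
    using assms(2,3) real_root_power_cancel[of q "\<bar>c\<bar>"] by (simp add: power_even_abs)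
  then show ?thesis
    by (simp add: schatten_norm_def trace_pow_smult[OF assms(1)] real_root_mult)
qed

lemma trace_pow_square:
  assumes "A \<in> hermitian_mats n"
  shows "trace_pow q (A * A) = trace_pow (2 * q) A"
proof -
  obtain U \<mu> where E: "eigendecomposition n A U \<mu>"
    using hermitian_eigendecomposition[OF assms] .
  have "A ^\<^sub>m 2 = A * A"
    using hermitian_matsD(1)[OF assms] by (simp add: numeral_2_eq_2)
  then have "eigendecomposition n (A * A) U (\<lambda>l. \<mu> l ^ 2)"
    using eigendecomposition_pow[OF E, of 2] by simp
  from trace_pow_eigendecomposition[OF this] trace_pow_eigendecomposition[OF E] show ?thesis
    by (simp add: power_mult)
qed

lemma schatten_norm_square:
  assumes "A \<in> hermitian_mats n" "q > 0"
  shows "schatten_norm q (A * A) = (schatten_norm (2 * q) A)\<^sup>2"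
proof -
  have "(root (2 * q) (trace_pow (2 * q) A))\<^sup>2 = root q (trace_pow (2 * q) A)"
    using assms(2) trace_pow_nonneg[OF assms(1), of "2 * q"] real_sqrt_pow2[of "root q (trace_pow (2 * q) A)"]
    by (simp add: real_root_mult_exp sqrt_def del: real_sqrt_pow2)
  then show ?thesis
    by (simp add: schatten_norm_def trace_pow_square[OF assms(1)])
qed

section \<open>Uniform smoothness of the Schatten norms\<close>

lemma diag_eigendecomposition:
  assumes "eigendecomposition n A U \<mu>" "l < n"
  shows "Re ((mat_adjoint U * A * U) $$ (l, l)) = \<mu> l"
proof -
  have U: "unitary_mat n U"
    using assms(1) by (simp add: eigendecomposition_def)
  from eigendecomposition_conj[OF assms(1) U] have "eigendecomposition n (mat_adjoint U * A * U) (1\<^sub>m n) \<mu>"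
    unfolding unitary_matD(2)[OF U] .
  from Re_diag_eigendecomposition[OF this assms(2)]
  have "Re ((mat_adjoint U * A * U) $$ (l, l)) = (\<Sum>m<n. (cmod (1\<^sub>m n $$ (l, m)))\<^sup>2 * \<mu> m)" .
  also have "\<dots> = (\<Sum>m<n. if m = l then \<mu> l else 0)"
    using assms(2) by (intro sum.cong) auto
  finally show ?thesis
    using assms(2) by simp
qed

text \<open>The hypothesis says that \<open>F \<plusminus> D\<close> are positive semidefinite; in an eigenbasis of \<open>D\<close> the
  eigenvalues of \<open>D\<close> are then dominated by the diagonal of \<open>F\<close>.\<close>

lemma schatten_norm_le_of_diag_le:
  assumes D: "D \<in> hermitian_mats n" and F: "F \<in> hermitian_mats n" and q: "even q" "q > 0"
    and le: "\<And>U j. unitary_mat n U \<Longrightarrow> j < n \<Longrightarrow>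
      \<bar>Re ((mat_adjoint U * D * U) $$ (j, j))\<bar> \<le> Re ((mat_adjoint U * F * U) $$ (j, j))"
  shows "schatten_norm q D \<le> schatten_norm q F"
proof -
  obtain U \<delta> where E: "eigendecomposition n D U \<delta>"
    using hermitian_eigendecomposition[OF D] .
  then have U: "unitary_mat n U"
    by (simp add: eigendecomposition_def)
  have "trace_pow q D = (\<Sum>l<n. \<delta> l ^ q)"
    by (rule trace_pow_eigendecomposition[OF E])
  also have "\<dots> \<le> (\<Sum>l<n. Re ((mat_adjoint U * F * U) $$ (l, l)) ^ q)"
  proof (rule sum_mono)
    fix l assume "l \<in> {..<n}"
    then have "\<bar>\<delta> l\<bar> \<le> Re ((mat_adjoint U * F * U) $$ (l, l))"
      using le[OF U, of l] diag_eigendecomposition[OF E, of l] by simp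
    then have "\<bar>\<delta> l\<bar> ^ q \<le> Re ((mat_adjoint U * F * U) $$ (l, l)) ^ q"
      by (rule power_mono) simp
    then show "\<delta> l ^ q \<le> Re ((mat_adjoint U * F * U) $$ (l, l)) ^ q"
      using q by (simp add: power_even_abs)
  qed
  also have "\<dots> \<le> trace_pow q (mat_adjoint U * F * U)"
    by (rule sum_diag_pow_le_trace_pow[OF hermitian_mats_conj[OF F unitary_matD(1)[OF U]] q(1)])
  also have "\<dots> = trace_pow q F"
    by (rule trace_pow_conj[OF F U])
  finally show ?thesis
    using q by (simp add: schatten_norm_def)
qed

lemma conj_mat_prod:
  assumes U: "unitary_mat n U" and X: "X \<in> carrier_mat n n" and Y: "Y \<in> carrier_mat n n"
  shows "mat_adjoint U * (X * Y) * U = (mat_adjoint U * X * U) * (mat_adjoint U * Y * U)"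
proof -
  note c = unitary_matD(1)[OF U] mat_adjoint_carrier[OF unitary_matD(1)[OF U]]
  have "(mat_adjoint U * X * U) * (mat_adjoint U * Y * U) = mat_adjoint U * X * ((U * mat_adjoint U) * (Y * U))"
    using c X Y by (simp add: assoc_mult_mat[of _ n n _ n _ n] mult_carrier_mat[of _ n n _ n])
  also have "\<dots> = mat_adjoint U * (X * Y) * U"
    unfolding unitary_matD(3)[OF U] using c X Y left_mult_one_mat[OF mult_carrier_mat[OF Y c(1)]]
    by (simp add: assoc_mult_mat[of _ n n _ n _ n] mult_carrier_mat[of _ n n _ n])
  finally show ?thesis ..
qed

lemma conj_mat_add:
  assumes U: "U \<in> carrier_mat n n" and X: "X \<in> carrier_mat n n" and Y: "Y \<in> carrier_mat n n"
  shows "mat_adjoint U * (X + Y) * U = mat_adjoint U * X * U + mat_adjoint U * Y * U"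
  by (simp only: mult_add_distrib_mat[OF mat_adjoint_carrier[OF U] X Y]
      add_mult_distrib_mat[OF mult_carrier_mat[OF mat_adjoint_carrier[OF U] X]
        mult_carrier_mat[OF mat_adjoint_carrier[OF U] Y] U])

lemma conj_mat_smult:
  assumes U: "U \<in> carrier_mat n n" and X: "X \<in> carrier_mat n n"
  shows "mat_adjoint U * (c \<cdot>\<^sub>m X) * U = c \<cdot>\<^sub>m (mat_adjoint U * X * U)"
  by (simp only: mult_smult_distrib[OF mat_adjoint_carrier[OF U] X]
      mult_smult_assoc_mat[OF mult_carrier_mat[OF mat_adjoint_carrier[OF U] X] U])

lemma hermitian_mats_square [intro]:
  assumes "A \<in> hermitian_mats n"
  shows "A * A \<in> hermitian_mats n"
  using hermitian_matsD[OF assms] mat_adjoint_mult[of A n n A n] by (simp add: hermitian_mats_def)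

lemma hermitian_mats_anticommutator [intro]:
  assumes A: "A \<in> hermitian_mats n" and Z: "Z \<in> hermitian_mats n"
  shows "A * Z + Z * A \<in> hermitian_mats n"
proof (rule hermitian_matsI)
  note A' = hermitian_matsD[OF A] and Z' = hermitian_matsD[OF Z]
  show "A * Z + Z * A \<in> carrier_mat n n"
    using mult_carrier_mat[OF A'(1) Z'(1)] mult_carrier_mat[OF Z'(1) A'(1)] by simp
  have 1: "(A * Z) $$ (i, j) = cnj ((Z * A) $$ (j, i))" if "i < n" "j < n" for i j
    using mat_adjoint_mult[OF Z'(1) A'(1)] index_mat_adjoint[of i "Z * A" j] that A'(1) Z'(1)
    unfolding A'(2) Z'(2) by simp
  then show "(A * Z + Z * A) $$ (i, j) = cnj ((A * Z + Z * A) $$ (j, i))" if "i < n" "j < n" for i j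
    using that A'(1) Z'(1) 1[of i j] 1[of j i] by (simp del: index_mult_mat(1) add: index_mult_mat(2,3))
qed

lemma diag_hermitian_prod:
  assumes X: "X \<in> carrier_mat n n" and Y: "Y \<in> hermitian_mats n" and j: "j < n"
  shows "(X * Y) $$ (j, j) = (\<Sum>l<n. X $$ (j, l) * cnj (Y $$ (j, l)))"
  unfolding index_mult_mat_sum[OF X hermitian_matsD(1)[OF Y] j j]
proof (rule sum.cong)
  fix l assume "l \<in> {..<n}"
  then show "X $$ (j, l) * Y $$ (l, j) = X $$ (j, l) * cnj (Y $$ (j, l))"
    using hermitian_matsD(3)[OF Y, of l j] j by simp
qed simp

lemma Re_diag_square:
  assumes "X \<in> hermitian_mats n" "j < n"
  shows "Re ((X * X) $$ (j, j)) = (\<Sum>l<n. (cmod (X $$ (j, l)))\<^sup>2)"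
  unfolding diag_hermitian_prod[OF hermitian_matsD(1)[OF assms(1)] assms] Re_sum
  by (intro sum.cong refl) (simp add: cmod_power2, simp add: power2_eq_square)

lemma Re_diag_anticommutator:
  assumes X: "X \<in> hermitian_mats n" and Y: "Y \<in> hermitian_mats n" and j: "j < n"
  shows "Re ((X * Y + Y * X) $$ (j, j)) = (\<Sum>l<n. 2 * Re (X $$ (j, l) * cnj (Y $$ (j, l))))"
proof -
  have "(X * Y + Y * X) $$ (j, j) = (X * Y) $$ (j, j) + (Y * X) $$ (j, j)"
    using mult_carrier_mat[OF hermitian_matsD(1)[OF Y] hermitian_matsD(1)[OF X]] j
    by (intro index_add_mat(1)) auto
  then have "Re ((X * Y + Y * X) $$ (j, j)) =
      (\<Sum>l<n. Re (X $$ (j, l) * cnj (Y $$ (j, l))) + Re (Y $$ (j, l) * cnj (X $$ (j, l))))"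
    unfolding diag_hermitian_prod[OF hermitian_matsD(1)[OF X] Y j]
      diag_hermitian_prod[OF hermitian_matsD(1)[OF Y] X j] by (simp only: plus_complex.sel Re_sum sum.distrib)
  also have "\<dots> = (\<Sum>l<n. 2 * Re (X $$ (j, l) * cnj (Y $$ (j, l))))"
    by (intro sum.cong) auto
  finally show ?thesis .
qed

lemma abs_Re_mult_cnj_le:
  assumes t: "t > 0"
  shows "\<bar>2 * Re (x * cnj y)\<bar> \<le> t * (cmod x)\<^sup>2 + (cmod y)\<^sup>2 / t"
proof -
  have "\<bar>Re (x * cnj y)\<bar> \<le> cmod x * cmod y"
    using abs_Re_le_cmod[of "x * cnj y"] by (simp add: norm_mult)
  moreover have "0 \<le> (sqrt t * cmod x - cmod y / sqrt t)\<^sup>2"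
    by simp
  moreover have "(sqrt t * cmod x - cmod y / sqrt t)\<^sup>2 = t * (cmod x)\<^sup>2 + (cmod y)\<^sup>2 / t - 2 * (cmod x * cmod y)"
    using t by (simp add: power2_diff power_mult_distrib power_divide)
  ultimately show ?thesis
    by linarith
qed

text \<open>For every \<open>t > 0\<close> the matrices \<open>t A\<^sup>2 + Z\<^sup>2 / t \<plusminus> (A Z + Z A)\<close> are squares of Hermitian matrices, hence
  positive semidefinite. The bound follows by comparing norms and optimising over \<open>t\<close>; the best \<open>t\<close> is the quotient of
  the norms of \<open>Z\<close> and \<open>A\<close>.\<close>

lemma schatten_norm_anticommutator_le:
  assumes A: "A \<in> hermitian_mats n" and Z: "Z \<in> hermitian_mats n" and q: "even q" "q > 0"
  shows "schatten_norm q (A * Z + Z * A) \<le> 2 * schatten_norm (2 * q) A * schatten_norm (2 * q) Z"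
proof -
  note A' = hermitian_matsD[OF A] and Z' = hermitian_matsD[OF Z]
  let ?a = "schatten_norm (2 * q) A" and ?z = "schatten_norm (2 * q) Z"
  have nn: "?a \<ge> 0" "?z \<ge> 0"
    using schatten_norm_nonneg[OF A] schatten_norm_nonneg[OF Z] by auto
  have AA: "A * A \<in> hermitian_mats n" and ZZ: "Z * Z \<in> hermitian_mats n"
    using A Z by auto
  have *: "schatten_norm q (A * Z + Z * A) \<le> t * ?a\<^sup>2 + ?z\<^sup>2 / t" if t: "t > 0" for t
  proof -
    let ?F = "complex_of_real t \<cdot>\<^sub>m (A * A) + complex_of_real (1 / t) \<cdot>\<^sub>m (Z * Z)"
    have tA: "complex_of_real t \<cdot>\<^sub>m (A * A) \<in> hermitian_mats n"
      and tZ: "complex_of_real (1 / t) \<cdot>\<^sub>m (Z * Z) \<in> hermitian_mats n"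
      using AA ZZ by blast+
    have "schatten_norm q (A * Z + Z * A) \<le> schatten_norm q ?F"
    proof (rule schatten_norm_le_of_diag_le)
      fix U j assume U: "unitary_mat n U" and j: "j < n"
      \<comment> \<open>The diagonal of a product of Hermitian matrices is a sum over a row, so the comparison is entrywise.\<close>
      define X where "X = mat_adjoint U * A * U"
      define Y where "Y = mat_adjoint U * Z * U"
      have X: "X \<in> hermitian_mats n" and Y: "Y \<in> hermitian_mats n"
        using hermitian_mats_conj A Z unitary_matD(1)[OF U] by (auto simp: X_def Y_def)
      note XX = mult_carrier_mat[OF hermitian_matsD(1)[OF X] hermitian_matsD(1)[OF X]]
      note YY = mult_carrier_mat[OF hermitian_matsD(1)[OF Y] hermitian_matsD(1)[OF Y]]
      note c = mult_carrier_mat[OF A'(1) Z'(1)] mult_carrier_mat[OF Z'(1) A'(1)]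
        mult_carrier_mat[OF A'(1) A'(1)] mult_carrier_mat[OF Z'(1) Z'(1)]
      have 1: "mat_adjoint U * (A * Z + Z * A) * U = X * Y + Y * X"
        unfolding conj_mat_add[OF unitary_matD(1)[OF U] c(1,2)]
          conj_mat_prod[OF U A'(1) Z'(1)] conj_mat_prod[OF U Z'(1) A'(1)] X_def Y_def ..
      have 2: "mat_adjoint U * ?F * U = complex_of_real t \<cdot>\<^sub>m (X * X) + complex_of_real (1 / t) \<cdot>\<^sub>m (Y * Y)"
        unfolding conj_mat_add[OF unitary_matD(1)[OF U] hermitian_matsD(1)[OF tA] hermitian_matsD(1)[OF tZ]]
          conj_mat_smult[OF unitary_matD(1)[OF U] c(3)] conj_mat_smult[OF unitary_matD(1)[OF U] c(4)]
          conj_mat_prod[OF U A'(1) A'(1)] conj_mat_prod[OF U Z'(1) Z'(1)] X_def Y_def ..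
      have "(complex_of_real t \<cdot>\<^sub>m (X * X) + complex_of_real (1 / t) \<cdot>\<^sub>m (Y * Y)) $$ (j, j) =
        t * (X * X) $$ (j, j) + (1 / t) * (Y * Y) $$ (j, j)"
        using carrier_matD[OF XX] carrier_matD[OF YY] j by (simp del: index_mult_mat)
      then have 3: "Re ((mat_adjoint U * ?F * U) $$ (j, j)) =
          (\<Sum>l<n. t * (cmod (X $$ (j, l)))\<^sup>2 + (cmod (Y $$ (j, l)))\<^sup>2 / t)"
        unfolding 2 using Re_diag_square[OF X j] Re_diag_square[OF Y j]
        by (simp add: sum.distrib sum_distrib_left sum_divide_distrib del: index_mult_mat)
      show "\<bar>Re ((mat_adjoint U * (A * Z + Z * A) * U) $$ (j, j))\<bar> \<le> Re ((mat_adjoint U * ?F * U) $$ (j, j))"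
        unfolding 3 unfolding 1 Re_diag_anticommutator[OF X Y j]
        using abs_Re_mult_cnj_le[OF t] by (intro order.trans[OF sum_abs] sum_mono)
    qed (use A Z tA tZ q in auto)
    also have "\<dots> \<le> schatten_norm q (complex_of_real t \<cdot>\<^sub>m (A * A)) + schatten_norm q (complex_of_real (1 / t) \<cdot>\<^sub>m (Z * Z))"
      by (rule schatten_norm_triangle[OF tA tZ q])
    also have "\<dots> = t * ?a\<^sup>2 + ?z\<^sup>2 / t"
      unfolding schatten_norm_smult[OF hermitian_matsD(1)[OF AA] q] schatten_norm_smult[OF hermitian_matsD(1)[OF ZZ] q]
        schatten_norm_square[OF A q(2)] schatten_norm_square[OF Z q(2)]
      using t by simp
    finally show ?thesis .
  qed
  show ?thesis
  proof (rule field_le_epsilon)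
    fix e :: real assume e: "e > 0"
    \<comment> \<open>Adding \<open>h\<close> to both norms keeps the choice of \<open>t\<close> meaningful when one of them is zero.\<close>
    define h where "h = e / (?a + ?z + 1)"
    have h: "h > 0" "h * (?a + ?z) \<le> e"
      using e nn by (auto simp: h_def field_simps)
    have "schatten_norm q (A * Z + Z * A) \<le> ((?z + h) / (?a + h)) * ?a\<^sup>2 + ?z\<^sup>2 / ((?z + h) / (?a + h))"
      using nn h by (intro *) auto
    also have "\<dots> \<le> (?z + h) * ?a + (?a + h) * ?z"
    proof (rule add_mono)
      have "?a\<^sup>2 / (?a + h) \<le> ?a" "?z\<^sup>2 / (?z + h) \<le> ?z"
        using nn h by (auto simp: divide_le_eq power2_eq_square algebra_simps)
      then have "(?z + h) * (?a\<^sup>2 / (?a + h)) \<le> (?z + h) * ?a" "(?a + h) * (?z\<^sup>2 / (?z + h)) \<le> (?a + h) * ?z"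
        using nn h by (simp_all only: mult_left_mono add_nonneg_nonneg less_imp_le)
      then show "((?z + h) / (?a + h)) * ?a\<^sup>2 \<le> (?z + h) * ?a" "?z\<^sup>2 / ((?z + h) / (?a + h)) \<le> (?a + h) * ?z"
        by (simp_all only: times_divide_eq_left times_divide_eq_right divide_divide_eq_right mult.commute)
    qed
    also have "\<dots> \<le> 2 * ?a * ?z + e"
      using h(2) by (simp add: algebra_simps)
    finally show "schatten_norm q (A * Z + Z * A) \<le> 2 * ?a * ?z + e" .
  qed
qed

lemma mat_add_rearrange:
  fixes P :: "complex mat"
  assumes "P \<in> carrier_mat n n" "Q \<in> carrier_mat n n" "R \<in> carrier_mat n n" "S \<in> carrier_mat n n"
  shows "(P + Q) + (R + S) = (P + S) + (Q + R)" "(P - Q) - (R - S) = (P + S) - (Q + R)"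
  using assms by (auto intro!: eq_matI simp: algebra_simps)

lemma square_add_mat:
  fixes A :: "complex mat"
  assumes A: "A \<in> carrier_mat n n" and Z: "Z \<in> carrier_mat n n"
  shows "(A + Z) * (A + Z) = (A * A + Z * Z) + (A * Z + Z * A)"
  by (simp only: add_mult_distrib_mat[OF A Z add_carrier_mat[OF Z]]
      mult_add_distrib_mat[OF A A Z] mult_add_distrib_mat[OF Z A Z]
      mat_add_rearrange[OF mult_carrier_mat[OF A A] mult_carrier_mat[OF A Z]
        mult_carrier_mat[OF Z A] mult_carrier_mat[OF Z Z]])

lemma square_diff_mat:
  fixes A :: "complex mat"
  assumes A: "A \<in> carrier_mat n n" and Z: "Z \<in> carrier_mat n n"
  shows "(A - Z) * (A - Z) = (A * A + Z * Z) - (A * Z + Z * A)"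
  by (simp only: minus_mult_distrib_mat[OF A Z minus_carrier_mat[OF Z]]
      mult_minus_distrib_mat[OF A A Z] mult_minus_distrib_mat[OF Z A Z]
      mat_add_rearrange[OF mult_carrier_mat[OF A A] mult_carrier_mat[OF A Z]
        mult_carrier_mat[OF Z A] mult_carrier_mat[OF Z Z]])

lemma trace_pow_2: "X \<in> carrier_mat n n \<Longrightarrow> trace_pow 2 X = Re (mat_trace (X * X))"
  by (simp add: trace_pow_def numeral_2_eq_2)

lemma trace_pow_2_parallelogram:
  assumes A: "A \<in> carrier_mat n n" and Z: "Z \<in> carrier_mat n n"
  shows "trace_pow 2 (A + Z) + trace_pow 2 (A - Z) = 2 * trace_pow 2 A + 2 * trace_pow 2 Z"
proof -
  have c: "A * A \<in> carrier_mat n n" "Z * Z \<in> carrier_mat n n" "A * Z + Z * A \<in> carrier_mat n n"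
    "A * A + Z * Z \<in> carrier_mat n n" "A + Z \<in> carrier_mat n n" "A - Z \<in> carrier_mat n n"
    using A Z by auto
  show ?thesis
    by (simp only: trace_pow_2[OF A] trace_pow_2[OF Z] trace_pow_2[OF c(5)] trace_pow_2[OF c(6)]
        square_add_mat[OF A Z] square_diff_mat[OF A Z] mat_trace_add[OF c(4,3)] mat_trace_diff[OF c(4,3)]
        mat_trace_add[OF c(1,2)] plus_complex.sel minus_complex.sel)
qed

lemma two_point_arith:
  fixes a z q x y :: real
  assumes q: "q \<ge> 1" and le: "(x\<^sup>2)\<^sup>2 + (y\<^sup>2)\<^sup>2 \<le> 2 * (a\<^sup>2 + z\<^sup>2)\<^sup>2 + 2 * (q - 1) * (2 * a * z)\<^sup>2"
  shows "x\<^sup>2 + y\<^sup>2 \<le> 2 * a\<^sup>2 + 2 * (2 * q - 1) * z\<^sup>2"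
proof -
  \<comment> \<open>Half the right-hand side; its square exceeds half the bound of the hypothesis by \<open>4 q (q - 1) z\<^sup>4\<close>.\<close>
  define w where "w = a\<^sup>2 + (2 * q - 1) * z\<^sup>2"
  have "w \<ge> 0"
    using q by (simp add: w_def)
  have 1: "2 * w\<^sup>2 = (2 * (a\<^sup>2 + z\<^sup>2)\<^sup>2 + 2 * (q - 1) * (2 * a * z)\<^sup>2) + 8 * q * (q - 1) * (z\<^sup>2)\<^sup>2"
    unfolding w_def by (simp add: algebra_simps power2_eq_square)
  have 2: "8 * q * (q - 1) * (z\<^sup>2)\<^sup>2 \<ge> 0"
    using q by (intro mult_nonneg_nonneg zero_le_power2) auto
  have 3: "(x\<^sup>2 + y\<^sup>2)\<^sup>2 \<le> 2 * ((x\<^sup>2)\<^sup>2 + (y\<^sup>2)\<^sup>2)"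
    using sum_squares_bound[of "x\<^sup>2" "y\<^sup>2"] by (simp add: power2_sum)
  have "P \<le> 4 * W" if "2 * W = C + D" "D \<ge> 0" "P \<le> 2 * B" "B \<le> C" for P W B C D :: real
    using that by linarith
  from this[OF 1 2 3 le] have "(x\<^sup>2 + y\<^sup>2)\<^sup>2 \<le> 4 * w\<^sup>2" .
  also have "\<dots> = (2 * w)\<^sup>2"
    by (simp add: power_mult_distrib)
  finally have "x\<^sup>2 + y\<^sup>2 \<le> 2 * w"
    by (rule power2_le_imp_le) (use \<open>w \<ge> 0\<close> in simp)
  then show ?thesis
    by (simp add: w_def algebra_simps)
qed

text \<open>The two-point inequality behind the type 2 property, by doubling \<open>q\<close>: the squares
  \<open>(A \<plusminus> Z)\<^sup>2\<close> are \<open>C \<plusminus> D\<close> with \<open>C = A\<^sup>2 + Z\<^sup>2\<close> and \<open>D = A Z + Z A\<close>, so the inequality for \<open>q\<close>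
  applied to \<open>C\<close> and \<open>D\<close> gives the one for \<open>2 q\<close>. For \<open>q = 2\<close> it is the parallelogram identity.\<close>

lemma schatten_two_point:
  assumes "A \<in> hermitian_mats n" "Z \<in> hermitian_mats n"
  shows "(schatten_norm (2 ^ Suc m) (A + Z))\<^sup>2 + (schatten_norm (2 ^ Suc m) (A - Z))\<^sup>2 \<le>
    2 * (schatten_norm (2 ^ Suc m) A)\<^sup>2 + 2 * (2 ^ Suc m - 1) * (schatten_norm (2 ^ Suc m) Z)\<^sup>2"
  using assms
proof (induction m arbitrary: A Z)
  case 0
  have 2: "(schatten_norm (2 ^ Suc 0) X)\<^sup>2 = trace_pow 2 X" if "X \<in> hermitian_mats n" for X
    using schatten_norm_pow[OF that, of 2] by simp
  show ?case
    unfolding 2[OF 0(1)] 2[OF 0(2)] 2[OF hermitian_mats_add[OF 0]] 2[OF hermitian_mats_diff[OF 0]]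
    using trace_pow_2_parallelogram[OF hermitian_matsD(1)[OF 0(1)] hermitian_matsD(1)[OF 0(2)]] by simp
next
  case (Suc m)
  note A = \<open>A \<in> hermitian_mats n\<close> and Z = \<open>Z \<in> hermitian_mats n\<close>
  note A' = hermitian_matsD(1)[OF A] and Z' = hermitian_matsD(1)[OF Z]
  note ApZ = hermitian_mats_add[OF A Z] and AmZ = hermitian_mats_diff[OF A Z]
  note AA = hermitian_mats_square[OF A] and ZZ = hermitian_mats_square[OF Z]
  note C = hermitian_mats_add[OF AA ZZ] and D = hermitian_mats_anticommutator[OF A Z]
  let ?C = "A * A + Z * Z" and ?D = "A * Z + Z * A"
  have q: "even ((2::nat) ^ Suc m)" "(2::nat) ^ Suc m > 0"
    by auto
  let ?N = "schatten_norm (2 ^ Suc (Suc m))" and ?M = "schatten_norm (2 ^ Suc m)"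
  have sqN: "?M (X * X) = (?N X)\<^sup>2" if "X \<in> hermitian_mats n" for X
    using schatten_norm_square[OF that q(2)] by simp
  have "?M ?C \<le> (?N A)\<^sup>2 + (?N Z)\<^sup>2"
    using schatten_norm_triangle[OF AA ZZ q] unfolding sqN[OF A] sqN[OF Z] .
  then have C2: "(?M ?C)\<^sup>2 \<le> ((?N A)\<^sup>2 + (?N Z)\<^sup>2)\<^sup>2"
    using schatten_norm_nonneg[OF C q(1)] by (rule power_mono)
  have "?M ?D \<le> 2 * ?N A * ?N Z"
    using schatten_norm_anticommutator_le[OF A Z q] by simp
  then have D2: "(?M ?D)\<^sup>2 \<le> (2 * ?N A * ?N Z)\<^sup>2"
    using schatten_norm_nonneg[OF D q(1)] by (rule power_mono)
  have q1: "(2::real) ^ Suc m \<ge> 1"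
    by (rule one_le_power) simp
  have "((?N (A + Z))\<^sup>2)\<^sup>2 + ((?N (A - Z))\<^sup>2)\<^sup>2 = (?M (?C + ?D))\<^sup>2 + (?M (?C - ?D))\<^sup>2"
    by (simp only: sqN[OF ApZ, symmetric] sqN[OF AmZ, symmetric] square_add_mat[OF A' Z'] square_diff_mat[OF A' Z'])
  also have "\<dots> \<le> 2 * (?M ?C)\<^sup>2 + 2 * (2 ^ Suc m - 1) * (?M ?D)\<^sup>2"
    by (rule Suc.IH[OF C D])
  also have "\<dots> \<le> 2 * ((?N A)\<^sup>2 + (?N Z)\<^sup>2)\<^sup>2 + 2 * (2 ^ Suc m - 1) * (2 * ?N A * ?N Z)\<^sup>2"
    using C2 D2 q1 by (intro add_mono mult_left_mono) auto
  finally show ?case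
    using two_point_arith[OF q1, of "?N (A + Z)" "?N (A - Z)" "?N A" "?N Z"]
    by (simp only: power_Suc[of "2::real" "Suc m"])
qed

text \<open>A subgradient inequality for the squared norm at \<open>A\<close>, from Hoelder's inequality. For \<open>A = 0\<close> the
  coefficient of the linear term is zero by the convention for division by zero, so no case distinction
  enters the statement.\<close>

lemma schatten_norm_sq_diff_ge:
  assumes A: "A \<in> hermitian_mats n" and Z: "Z \<in> hermitian_mats n" and q: "even q" "q > 0"
  shows "(schatten_norm q (A - Z))\<^sup>2 \<ge> (schatten_norm q A)\<^sup>2 -
    2 * (schatten_norm q A)\<^sup>2 / schatten_norm q A ^ q * Re (mat_trace (A ^\<^sub>m (q - 1) * Z))"
proof -
  have AZ: "A - Z \<in> hermitian_mats n"
    using A Z by auto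
  note A' = hermitian_matsD(1)[OF A] and Z' = hermitian_matsD(1)[OF Z]
  let ?a = "schatten_norm q A" and ?b = "schatten_norm q (A - Z)" and ?T = "Re (mat_trace (A ^\<^sub>m (q - 1) * Z))"
  show ?thesis
  proof (cases "?a = 0")
    case False
    then have a: "?a > 0"
      using schatten_norm_nonneg[OF A q(1)] by simp
    have "A ^\<^sub>m (q - 1) * (A - Z) = A ^\<^sub>m (q - 1) * A - A ^\<^sub>m (q - 1) * Z"
      by (rule mult_minus_distrib_mat[OF pow_carrier_mat[OF A'] A' Z'])
    then have "Re (mat_trace (A ^\<^sub>m (q - 1) * (A - Z))) = ?a ^ q - ?T"
      using mat_trace_diff[OF mult_carrier_mat[OF pow_carrier_mat[OF A'] A']
          mult_carrier_mat[OF pow_carrier_mat[OF A'] Z'], of "q - 1" "q - 1"]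
        trace_pow_Suc[OF A' q(2)] schatten_norm_pow[OF A q] by simp
    then have "?a ^ q - ?T \<le> ?a ^ (q - 1) * ?b"
      using schatten_Hoelder[OF A AZ q] by simp
    moreover define P where "P = ?a ^ (q - 1)"
    moreover have P: "P > 0" "?a ^ q = P * ?a"
      using a power_minus_mult[OF q(2), of ?a] by (auto simp: P_def)
    ultimately have "P * ?a - ?T \<le> P * ?b"
      by simp
    then have "(2 * ?a / P) * (P * ?a - ?T) \<le> (2 * ?a / P) * (P * ?b)"
      using a P(1) by (intro mult_left_mono) auto
    then have "2 * ?a\<^sup>2 - 2 * ?a / P * ?T \<le> 2 * ?a * ?b"
      using P(1) by (simp add: right_diff_distrib power2_eq_square)
    also have "\<dots> \<le> ?a\<^sup>2 + ?b\<^sup>2"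
      by (rule sum_squares_bound)
    moreover have "2 * ?a\<^sup>2 / ?a ^ q = 2 * ?a / P"
      using a P by (simp add: power2_eq_square)
    ultimately show ?thesis
      by simp
  qed (use q in simp)
qed

text \<open>The two-point inequality bounds the sum of the squared norms of \<open>A + Z\<close> and \<open>A - Z\<close>, and the
  subgradient inequality bounds that of \<open>A - Z\<close> from below. The linear term has coefficients depending
  on \<open>A\<close> alone, so it averages out over a centred \<open>Z\<close>; this takes the place of a symmetrisation.\<close>

lemma schatten_norm_smooth:
  assumes A: "A \<in> hermitian_mats n" and Z: "Z \<in> hermitian_mats n" and q: "q = 2 ^ Suc m"
  shows "(schatten_norm q (A + Z))\<^sup>2 \<le> (schatten_norm q A)\<^sup>2 +
    2 * (schatten_norm q A)\<^sup>2 / schatten_norm q A ^ q * Re (mat_trace (A ^\<^sub>m (q - 1) * Z)) +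
    2 * (real q - 1) * (schatten_norm q Z)\<^sup>2"
proof -
  have q': "even q" "q > 0"
    using q by auto
  show ?thesis
    using schatten_two_point[OF A Z, of m, folded q] schatten_norm_sq_diff_ge[OF A Z q'] q by simp
qed

section \<open>Eigenvalues, the Frobenius norm and the operator norm\<close>

lemma abs_eigenvalue_le_schatten_norm:
  assumes E: "eigendecomposition n A U \<mu>" and l: "l < n" and q: "even q" "q > 0"
  shows "\<bar>\<mu> l\<bar> \<le> schatten_norm q A"
proof -
  have "\<mu> l ^ q \<le> (\<Sum>l<n. \<mu> l ^ q)"
    using l q by (intro member_le_sum) auto
  then have "\<bar>\<mu> l\<bar> ^ q \<le> trace_pow q A"
    using q by (simp add: trace_pow_eigendecomposition[OF E] power_even_abs)
  then have "root q (\<bar>\<mu> l\<bar> ^ q) \<le> schatten_norm q A"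
    using q by (simp add: schatten_norm_def)
  then show ?thesis
    using q by (simp add: real_root_power_cancel)
qed

lemma schatten_norm_le_of_eigenvalues:
  assumes E: "eigendecomposition n A U \<mu>" and M: "\<And>l. l < n \<Longrightarrow> \<bar>\<mu> l\<bar> \<le> M" "0 \<le> M" and q: "even q" "q > 0"
  shows "schatten_norm q A \<le> root q n * M"
proof -
  have "trace_pow q A \<le> (\<Sum>l<n. M ^ q)"
    unfolding trace_pow_eigendecomposition[OF E]
  proof (rule sum_mono)
    fix l assume "l \<in> {..<n}"
    then have "\<bar>\<mu> l\<bar> ^ q \<le> M ^ q"
      using M by (intro power_mono) auto
    then show "\<mu> l ^ q \<le> M ^ q"
      using q by (simp add: power_even_abs)
  qed
  then have "schatten_norm q A \<le> root q (n * M ^ q)"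
    using q by (simp add: schatten_norm_def)
  also have "\<dots> = root q n * M"
    using q M by (simp add: real_root_mult real_root_power_cancel)
  finally show ?thesis .
qed

lemma frob_norm_eq_schatten_norm:
  assumes A: "A \<in> hermitian_mats n"
  shows "frob_norm A = schatten_norm 2 A"
proof -
  have "trace_pow 2 A = (\<Sum>i<n. Re ((A * A) $$ (i, i)))"
    using mat_trace_carrier[OF mult_carrier_mat[OF hermitian_matsD(1)[OF A] hermitian_matsD(1)[OF A]]]
    by (simp add: trace_pow_2[OF hermitian_matsD(1)[OF A]] del: index_mult_mat)
  also have "\<dots> = (\<Sum>i<n. \<Sum>j<n. (cmod (A $$ (i, j)))\<^sup>2)"
    using Re_diag_square[OF A] by (intro sum.cong) auto
  finally show ?thesis
    using carrier_matD[OF hermitian_matsD(1)[OF A]] by (simp add: frob_norm_def schatten_norm_def sqrt_def)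
qed

lemma frob_norm_eigendecomposition:
  assumes A: "A \<in> hermitian_mats n" and E: "eigendecomposition n A U \<mu>"
  shows "(frob_norm A)\<^sup>2 = (\<Sum>l<n. (\<mu> l)\<^sup>2)"
  using schatten_norm_pow[OF A, of 2] by (simp add: frob_norm_eq_schatten_norm[OF A] trace_pow_eigendecomposition[OF E])

text \<open>The Frobenius norm bounds every eigenvalue in modulus, so all but two of the factors of \<open>\<mu> ^ q\<close> may be
  replaced by it.\<close>

lemma schatten_norm_le_frob_norm:
  assumes A: "A \<in> hermitian_mats n" and q: "even q" "q > 0"
  shows "schatten_norm q A \<le> frob_norm A"
proof -
  obtain U \<mu> where E: "eigendecomposition n A U \<mu>"
    using hermitian_eigendecomposition[OF A] .
  have s: "0 \<le> frob_norm A"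
    using schatten_norm_nonneg[OF A, of 2] by (simp add: frob_norm_eq_schatten_norm[OF A])
  obtain p where p: "q = 2 + p" "even p"
    using q by (metis add_2_eq_Suc' dvd_add_right_iff dvd_refl even_Suc gr0_implies_Suc odd_Suc_minus_one add.commute)
  have "trace_pow q A = (\<Sum>l<n. (\<mu> l)\<^sup>2 * \<mu> l ^ p)"
    unfolding trace_pow_eigendecomposition[OF E] p(1) power_add ..
  also have "\<dots> \<le> (\<Sum>l<n. (\<mu> l)\<^sup>2 * frob_norm A ^ p)"
  proof (intro sum_mono mult_left_mono)
    fix l assume "l \<in> {..<n}"
    then have "\<bar>\<mu> l\<bar> ^ p \<le> frob_norm A ^ p"
      using abs_eigenvalue_le_schatten_norm[OF E, of l 2] by (intro power_mono) (auto simp: frob_norm_eq_schatten_norm[OF A])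
    then show "\<mu> l ^ p \<le> frob_norm A ^ p"
      using p by (simp add: power_even_abs)
  qed simp
  also have "\<dots> = frob_norm A ^ q"
    unfolding p(1) power_add frob_norm_eigendecomposition[OF A E] sum_distrib_right ..
  finally have "schatten_norm q A \<le> root q (frob_norm A ^ q)"
    using q by (simp add: schatten_norm_def)
  then show ?thesis
    using q s by (simp add: real_root_power_cancel)
qed

lemma frob_norm_triangle:
  assumes "A \<in> hermitian_mats n" "B \<in> hermitian_mats n"
  shows "frob_norm (A + B) \<le> frob_norm A + frob_norm B"
  using schatten_norm_triangle[OF assms, of 2] frob_norm_eq_schatten_norm hermitian_mats_add[OF assms] assms by simp

lemma vec_l2_norm_eq:
  assumes "x \<in> carrier_vec n"
  shows "vec_l2_norm x = sqrt (\<Sum>i<n. (cmod (x $ i))\<^sup>2)"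
proof -
  have "x \<bullet>c x = of_real (\<Sum>i<n. (cmod (x $ i))\<^sup>2)"
    using assms unfolding of_real_sum
    by (subst complex_norm_square) (auto simp: scalar_prod_def lessThan_atLeast0)
  then show ?thesis
    by (simp only: vec_l2_norm_def Re_complex_of_real)
qed

lemma quadratic_form_eigendecomposition:
  assumes E: "eigendecomposition n A U \<mu>" and x: "x \<in> carrier_vec n"
  shows "Re ((A *\<^sub>v x) \<bullet>c x) = (\<Sum>l<n. \<mu> l * (cmod ((mat_adjoint U *\<^sub>v x) $ l))\<^sup>2)"
proof -
  have U: "U \<in> carrier_mat n n" and A: "A = U * real_diag_mat n \<mu> * mat_adjoint U"
    using E unitary_matD(1) by (auto simp: eigendecomposition_def)
  have Ac: "A \<in> carrier_mat n n"
    using U by (simp add: A mult_carrier_mat[of _ n n _ n])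
  define t where "t l i j = of_real (\<mu> l) * (U $$ (i, l) * cnj (U $$ (j, l))) * x $ j * cnj (x $ i)" for l i j
  have "(A *\<^sub>v x) \<bullet>c x = (\<Sum>i<n. (\<Sum>j<n. A $$ (i, j) * x $ j) * cnj (x $ i))"
    using Ac x by (auto simp: scalar_prod_def lessThan_atLeast0)
  also have "\<dots> = (\<Sum>i<n. \<Sum>j<n. \<Sum>l<n. t l i j)"
    unfolding sum_distrib_right
  proof (intro sum.cong refl)
    fix i j assume "i \<in> {..<n}" "j \<in> {..<n}"
    then have "A $$ (i, j) = (\<Sum>l<n. of_real (\<mu> l) * (U $$ (i, l) * cnj (U $$ (j, l))))"
      unfolding A by (intro index_unitary_diag[OF U]) auto
    then show "A $$ (i, j) * x $ j * cnj (x $ i) = (\<Sum>l<n. t l i j)"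
      by (simp add: t_def sum_distrib_right)
  qed
  also have "\<dots> = (\<Sum>i<n. \<Sum>l<n. \<Sum>j<n. t l i j)"
    by (intro sum.cong refl sum.swap)
  also have "\<dots> = (\<Sum>l<n. \<Sum>i<n. \<Sum>j<n. t l i j)"
    by (rule sum.swap)
  also have "\<dots> = (\<Sum>l<n. of_real (\<mu> l * (cmod ((mat_adjoint U *\<^sub>v x) $ l))\<^sup>2))"
  proof (intro sum.cong refl)
    fix l assume l: "l \<in> {..<n}"
    define y where "y = (\<Sum>j<n. cnj (U $$ (j, l)) * x $ j)"
    have "(mat_adjoint U *\<^sub>v x) $ l = y"
      using U x l by (auto simp: y_def scalar_prod_def lessThan_atLeast0)
    moreover have "(\<Sum>i<n. \<Sum>j<n. t l i j) = of_real (\<mu> l) * (y * cnj y)"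
    proof -
      have "of_real (\<mu> l) * (y * cnj y) = (\<Sum>j<n. \<Sum>i<n. t l i j)"
        unfolding y_def cnj_sum sum_product unfolding sum_distrib_left
        by (intro sum.cong refl) (simp add: t_def)
      also have "\<dots> = (\<Sum>i<n. \<Sum>j<n. t l i j)"
        by (rule sum.swap)
      finally show ?thesis ..
    qed
    ultimately show "(\<Sum>i<n. \<Sum>j<n. t l i j) = of_real (\<mu> l * (cmod ((mat_adjoint U *\<^sub>v x) $ l))\<^sup>2)"
      by (simp add: complex_norm_square del: of_real_power)
  qed
  finally have "(A *\<^sub>v x) \<bullet>c x = of_real (\<Sum>l<n. \<mu> l * (cmod ((mat_adjoint U *\<^sub>v x) $ l))\<^sup>2)"
    by (simp only: of_real_sum)
  then show ?thesis
    by (simp only: Re_complex_of_real)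
qed

lemma index_adjoint_mult_col:
  assumes U: "unitary_mat n U" and "l < n" "m < n"
  shows "(mat_adjoint U *\<^sub>v col U l) $ m = (if m = l then 1 else 0)"
proof -
  have "(mat_adjoint U *\<^sub>v col U l) $ m = (mat_adjoint U * U) $$ (m, l)"
    using unitary_matD(1)[OF U] assms(2,3) by simp
  then show ?thesis
    using assms by (simp add: unitary_matD(2)[OF U])
qed

lemma eigenvalue_nonneg:
  assumes E: "eigendecomposition n A U \<mu>" and psd: "\<And>x. x \<in> carrier_vec n \<Longrightarrow> 0 \<le> Re ((A *\<^sub>v x) \<bullet>c x)" and l: "l < n"
  shows "0 \<le> \<mu> l"
proof -
  have U: "unitary_mat n U"
    using E by (simp add: eigendecomposition_def)
  have c: "col U l \<in> carrier_vec n"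
    by (rule col_carrier_vec[OF l unitary_matD(1)[OF U]])
  have "0 \<le> (\<Sum>m<n. \<mu> m * (cmod ((mat_adjoint U *\<^sub>v col U l) $ m))\<^sup>2)"
    using psd[OF c] quadratic_form_eigendecomposition[OF E c] by simp
  also have "\<dots> = (\<Sum>m<n. if m = l then \<mu> l else 0)"
    using index_adjoint_mult_col[OF U l] by (intro sum.cong) auto
  finally show ?thesis
    using l by simp
qed

lemma density_matsD:
  assumes "A \<in> density_mats d"
  shows "A \<in> hermitian_mats d" "mat_trace A = 1" "x \<in> carrier_vec d \<Longrightarrow> 0 \<le> Re ((A *\<^sub>v x) \<bullet>c x)"
  using assms by (auto simp: density_mats_def)

lemma frob_norm_density_le_1:
  assumes A: "A \<in> density_mats d"
  shows "frob_norm A \<le> 1"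
proof -
  note AD = density_matsD[OF A]
  obtain U \<mu> where E: "eigendecomposition d A U \<mu>"
    using hermitian_eigendecomposition[OF AD(1)] .
  have nn: "0 \<le> \<mu> l" if "l < d" for l
    using eigenvalue_nonneg[OF E AD(3)] that by auto
  have tr: "(\<Sum>l<d. \<mu> l) = 1"
    using trace_eigendecomposition[OF E] AD(2) by (metis of_real_eq_1_iff)
  have "(frob_norm A)\<^sup>2 = (\<Sum>l<d. (\<mu> l)\<^sup>2)"
    by (rule frob_norm_eigendecomposition[OF AD(1) E])
  also have "\<dots> \<le> (\<Sum>l<d. \<mu> l)"
  proof (rule sum_mono)
    fix l assume l: "l \<in> {..<d}"
    then have "\<mu> l \<le> (\<Sum>l<d. \<mu> l)"
      using nn by (intro member_le_sum) auto
    then show "(\<mu> l)\<^sup>2 \<le> \<mu> l"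
      using nn[of l] l by (simp add: tr power2_eq_square mult_left_le)
  qed
  finally have "(frob_norm A)\<^sup>2 \<le> 1\<^sup>2"
    by (simp add: tr)
  then show ?thesis
    by (rule power2_le_imp_le) simp
qed

text \<open>The supremum of an unbounded set of reals is unspecified, so boundedness is needed before a lower
  bound for the operator norm can be read off from a single vector.\<close>

lemma bdd_above_op_norm:
  assumes A: "A \<in> carrier_mat n m"
  shows "bdd_above ((\<lambda>x. vec_l2_norm (A *\<^sub>v x)) ` {x \<in> carrier_vec m. vec_l2_norm x \<le> 1})"
proof (rule bdd_aboveI2)
  fix x assume "x \<in> {x \<in> carrier_vec m. vec_l2_norm x \<le> 1}"
  then have x: "x \<in> carrier_vec m" and "sqrt (\<Sum>i<m. (cmod (x $ i))\<^sup>2) \<le> 1"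
    using vec_l2_norm_eq by auto
  then have x1: "(\<Sum>i<m. (cmod (x $ i))\<^sup>2) \<le> 1"
    by simp
  have xi: "cmod (x $ j) \<le> 1" if "j < m" for j
  proof -
    have "(cmod (x $ j))\<^sup>2 \<le> (\<Sum>i<m. (cmod (x $ i))\<^sup>2)"
      using that by (intro member_le_sum) auto
    with x1 have "(cmod (x $ j))\<^sup>2 \<le> 1\<^sup>2"
      by simp
    then show ?thesis
      by (rule power2_le_imp_le) simp
  qed
  have "(\<Sum>i<n. (cmod ((A *\<^sub>v x) $ i))\<^sup>2) \<le> (\<Sum>i<n. (\<Sum>j<m. cmod (A $$ (i, j)))\<^sup>2)"
  proof (intro sum_mono power_mono)
    fix i assume i: "i \<in> {..<n}"
    have "cmod ((A *\<^sub>v x) $ i) = cmod (\<Sum>j<m. A $$ (i, j) * x $ j)"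
      using A x i by (auto simp: scalar_prod_def lessThan_atLeast0)
    also have "\<dots> \<le> (\<Sum>j<m. cmod (A $$ (i, j)))"
      using xi by (intro sum_norm_le) (auto simp: norm_mult intro: mult_left_le)
    finally show "cmod ((A *\<^sub>v x) $ i) \<le> (\<Sum>j<m. cmod (A $$ (i, j)))" .
  qed simp
  then show "vec_l2_norm (A *\<^sub>v x) \<le> sqrt (\<Sum>i<n. (\<Sum>j<m. cmod (A $$ (i, j)))\<^sup>2)"
    using vec_l2_norm_eq[OF mult_mat_vec_carrier[OF A x]] by simp
qed

lemma abs_eigenvalue_le_op_norm:
  assumes E: "eigendecomposition n A U \<mu>" and l: "l < n"
  shows "\<bar>\<mu> l\<bar> \<le> op_norm A"
proof -
  have U: "unitary_mat n U" and A: "A = U * real_diag_mat n \<mu> * mat_adjoint U"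
    using E by (auto simp: eigendecomposition_def)
  note U1 = unitary_matD(1)[OF U]
  have Ac: "A \<in> carrier_mat n n"
    using U1 by (simp add: A mult_carrier_mat[of _ n n _ n])
  have c: "col U l \<in> carrier_vec n"
    by (rule col_carrier_vec[OF l U1])
  have UD: "U * real_diag_mat n \<mu> \<in> carrier_mat n n"
    by (rule mult_carrier_mat[OF U1 real_diag_mat_carrier])
  have "A * U = U * real_diag_mat n \<mu> * (mat_adjoint U * U)"
    unfolding A by (rule assoc_mult_mat[OF UD mat_adjoint_carrier[OF U1] U1])
  then have AU: "A * U = U * real_diag_mat n \<mu>"
    using UD by (simp only: unitary_matD(2)[OF U] right_mult_one_mat[OF UD])
  have "A *\<^sub>v col U l = of_real (\<mu> l) \<cdot>\<^sub>v col U l"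
  proof (rule eq_vecI)
    fix i assume "i < dim_vec (of_real (\<mu> l) \<cdot>\<^sub>v col U l)"
    then have i: "i < n"
      using carrier_vecD[OF c] by (simp only: index_smult_vec)
    have "(A *\<^sub>v col U l) $ i = (A * U) $$ (i, l)"
      using Ac U1 i l by simp
    also have "\<dots> = (\<Sum>m<n. if m = l then of_real (\<mu> l) * U $$ (i, l) else 0)"
      unfolding AU index_mult_mat_sum[OF U1 real_diag_mat_carrier i l]
      using l by (intro sum.cong) (auto simp: real_diag_mat_def)
    also have "\<dots> = (of_real (\<mu> l) \<cdot>\<^sub>v col U l) $ i"
      using i l U1 by simp
    finally show "(A *\<^sub>v col U l) $ i = (of_real (\<mu> l) \<cdot>\<^sub>v col U l) $ i" .
  qed (use Ac U1 in auto)
  moreover have n1: "(\<Sum>i<n. (cmod (col U l $ i))\<^sup>2) = 1"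
    using unitary_mat_col_norm[OF U l] U1 l by simp
  have "vec_l2_norm (of_real (\<mu> l) \<cdot>\<^sub>v col U l) = sqrt ((\<mu> l)\<^sup>2 * (\<Sum>i<n. (cmod (col U l $ i))\<^sup>2))"
    unfolding vec_l2_norm_eq[OF iffD2[OF smult_carrier_vec c], of "of_real (\<mu> l)"] sum_distrib_left
    using carrier_vecD[OF c] by (intro arg_cong[where f = sqrt] sum.cong) (auto simp: norm_mult power_mult_distrib simp del: index_col)
  then have "vec_l2_norm (of_real (\<mu> l) \<cdot>\<^sub>v col U l) = \<bar>\<mu> l\<bar>"
    by (simp only: n1 mult_1_right real_sqrt_abs)
  moreover have "vec_l2_norm (A *\<^sub>v col U l) \<le> op_norm A"
    unfolding op_norm_def
  proof (rule cSUP_upper)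
    show "col U l \<in> {x \<in> carrier_vec (dim_col A). vec_l2_norm x \<le> 1}"
      using c Ac n1 by (simp add: vec_l2_norm_eq[OF c])
    show "bdd_above ((\<lambda>x. vec_l2_norm (A *\<^sub>v x)) ` {x \<in> carrier_vec (dim_col A). vec_l2_norm x \<le> 1})"
      using bdd_above_op_norm[OF Ac] Ac by simp
  qed
  ultimately show ?thesis
    by simp
qed

text \<open>The comparison that brings in the operator norm of the design; the factor is bounded by \<open>e\<close> as soon as
  \<open>q \<ge> ln n\<close>, see \<open>root_le_exp_1\<close>.\<close>

lemma schatten_norm_le_op_norm:
  assumes A: "A \<in> hermitian_mats n" and "n > 0" and q: "even q" "q > 0"
  shows "schatten_norm q A \<le> root q n * op_norm A"
proof -
  obtain U \<mu> where E: "eigendecomposition n A U \<mu>"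
    using hermitian_eigendecomposition[OF A] .
  have "0 \<le> op_norm A"
    using abs_eigenvalue_le_op_norm[OF E \<open>n > 0\<close>] by linarith
  then show ?thesis
    using schatten_norm_le_of_eigenvalues[OF E abs_eigenvalue_le_op_norm[OF E] _ q] by simp
qed

section \<open>Density matrices close to one of low rank\<close>

lemma mult_vec_in_col_span:
  fixes A :: "complex mat"
  assumes A: "A \<in> carrier_mat n m" and v: "v \<in> carrier_vec m"
  shows "A *\<^sub>v v \<in> LinearCombinations.module.span class_ring (module_vec TYPE(complex) n) (set (cols A))"
proof -
  interpret vec_space "TYPE(complex)" n .
  have c: "set (cols A) \<subseteq> carrier_vec n"
    using A cols_dim by blast
  have "A *\<^sub>v v = mat_of_cols n (cols A) *\<^sub>v vec (length (cols A)) (\<lambda>i. v $ i)"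
  proof -
    have "mat_of_cols n (cols A) = A"
      using mat_of_cols_cols[of A] carrier_matD[OF A] by simp
    moreover have "Matrix.vec (length (cols A)) (\<lambda>i. v $ i) = v"
      using A v by (intro eq_vecI) auto
    ultimately show ?thesis
      by simp
  qed
  also have "\<dots> = lincomb_list (\<lambda>i. v $ i) (cols A)"
    using c by (intro lincomb_list_as_mat_mult[symmetric]) auto
  also have "\<dots> \<in> span_list (cols A)"
    by (auto simp: span_list_def)
  finally show ?thesis
    by (simp only: span_list_as_span[OF c])
qed

text \<open>Together with the next lemma this bounds the dimension of a subspace on which \<open>A\<close> is injective, namely
  the range of \<open>G\<close>, by the rank of \<open>A\<close>.\<close>

lemma rank_mult_le:
  fixes A :: "complex mat"
  assumes A: "A \<in> carrier_mat n m" and G: "G \<in> carrier_mat m r"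
  shows "vec_space.rank n (A * G) \<le> vec_space.rank n A"
proof -
  interpret vec_space "TYPE(complex)" n .
  have AG: "A * G \<in> carrier_mat n r"
    by (rule mult_carrier_mat[OF A G])
  have cA: "set (cols A) \<subseteq> carrier_vec n" and cAG: "set (cols (A * G)) \<subseteq> carrier_vec n"
    using A AG cols_dim by blast+
  have "set (cols (A * G)) \<subseteq> span (set (cols A))"
  proof
    fix x assume "x \<in> set (cols (A * G))"
    then obtain j where j: "j < r" "x = col (A * G) j"
      using AG by (auto simp: cols_def)
    then have "x = A *\<^sub>v col G j"
      using col_mult2[OF A G, of j] by simp
    then show "x \<in> span (set (cols A))"
      using mult_vec_in_col_span[OF A col_carrier_vec[OF j(1) G]] by simp
  qed
  then have "span (set (cols (A * G))) \<subseteq> span (set (cols A))"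
    by (rule span_subsetI[OF cA])
  moreover have s: "subspace class_ring (span (set (cols A))) V" "subspace class_ring (span (set (cols (A * G)))) V"
    using cA cAG by (auto intro!: span_is_subspace)
  ultimately have "subspace class_ring (span (set (cols (A * G)))) (vs (span (set (cols A))))"
    by (intro nested_subspaces)
  then show ?thesis
    unfolding rank_def
    using vectorspace.subspace_dim[OF subspace_is_vs[OF s(1)]] fin_dim_span_cols[OF A] fin_dim_span_cols[OF AG]
    by simp
qed

lemma rank_eq_of_trivial_kernel:
  fixes H :: "complex mat"
  assumes H: "H \<in> carrier_mat n m" and ker: "\<And>v. v \<in> carrier_vec m \<Longrightarrow> H *\<^sub>v v = 0\<^sub>v n \<Longrightarrow> v = 0\<^sub>v m"
  shows "vec_space.rank n H = m"
proof -
  interpret vec_space "TYPE(complex)" n .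
  have dist: "distinct (cols H)"
  proof (rule ccontr)
    assume "\<not> distinct (cols H)"
    then obtain i j where ij: "i < m" "j < m" "i \<noteq> j" "col H i = col H j"
      using H by (auto simp: distinct_conv_nth)
    define v where "v = unit_vec m i - (unit_vec m j :: complex Matrix.vec)"
    have "H *\<^sub>v v = H *\<^sub>v unit_vec m i - H *\<^sub>v unit_vec m j"
      unfolding v_def by (rule mult_minus_distrib_mat_vec[OF H]) auto
    also have "\<dots> = 0\<^sub>v n"
    proof -
      have "H *\<^sub>v unit_vec m l = col H l" if "l < m" for l
        using H that by (intro eq_vecI) auto
      then show ?thesis
        using ij col_carrier_vec[OF ij(2) H] by simp
    qed
    finally have "v = 0\<^sub>v m"
      by (intro ker) (simp_all add: v_def)
    then have "v $ i = 0"
      using ij by simp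
    then show False
      using ij by (simp add: v_def)
  qed
  have "\<not> lin_dep (set (cols H))"
  proof
    assume "lin_dep (set (cols H))"
    then obtain v where "v \<in> carrier_vec m" "v \<noteq> 0\<^sub>v m" "H *\<^sub>v v = 0\<^sub>v n"
      using lin_depE[OF H _ dist] by blast
    with ker show False
      by blast
  qed
  then show ?thesis
    by (rule lin_indpt_full_rank[OF H dist])
qed

text \<open>On the span of the eigenvectors of \<open>\<theta>' - \<theta>\<close> with negative eigenvalue, \<open>\<theta>\<close> has trivial kernel:
  if \<open>\<theta> x = 0\<close> then the quadratic form of \<open>\<theta>' - \<theta>\<close> at \<open>x\<close> is that of \<open>\<theta>'\<close>, hence nonnegative.\<close>

lemma card_negative_eigenvalues_le_rank:
  assumes \<theta>: "\<theta> \<in> carrier_mat d d" and \<theta>': "\<theta>' \<in> carrier_mat d d"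
    and psd: "\<And>x. x \<in> carrier_vec d \<Longrightarrow> 0 \<le> Re ((\<theta>' *\<^sub>v x) \<bullet>c x)"
    and E: "eigendecomposition d (\<theta>' - \<theta>) U \<mu>"
  shows "card {l. l < d \<and> \<mu> l < 0} \<le> vec_space.rank d \<theta>"
proof -
  define N where "N = {l. l < d \<and> \<mu> l < 0}"
  define m where "m = card N"
  have fin: "finite N"
    by (simp add: N_def)
  obtain h where h: "bij_betw h {0..<m} N"
    using ex_bij_betw_nat_finite[OF fin] unfolding m_def by blast
  have hN: "h j \<in> N" "h j < d" "\<mu> (h j) < 0" if "j < m" for j
    using bij_betwE[OF h] that by (auto simp: N_def)
  have inj: "inj_on h {0..<m}" and im: "h ` {0..<m} = N"
    using h by (auto simp: bij_betw_def)
  have U: "unitary_mat d U"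
    using E by (simp add: eigendecomposition_def)
  note U1 = unitary_matD(1)[OF U]
  \<comment> \<open>The columns of \<open>G\<close> are the eigenvectors with negative eigenvalue.\<close>
  define G where "G = mat d m (\<lambda>(i, j). U $$ (i, h j))"
  have G: "G \<in> carrier_mat d m"
    by (simp add: G_def)
  have "vec_space.rank d (\<theta> * G) = m"
  proof (rule rank_eq_of_trivial_kernel[OF mult_carrier_mat[OF \<theta> G]])
    fix v assume v: "v \<in> carrier_vec m" and 0: "(\<theta> * G) *\<^sub>v v = 0\<^sub>v d"
    define x where "x = G *\<^sub>v v"
    have x: "x \<in> carrier_vec d"
      unfolding x_def by (rule mult_mat_vec_carrier[OF G v])
    have "\<theta> *\<^sub>v x = 0\<^sub>v d"
      using 0 assoc_mult_mat_vec[OF \<theta> G v] by (simp add: x_def)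
    then have "(\<theta>' - \<theta>) *\<^sub>v x = \<theta>' *\<^sub>v x"
      using minus_mult_distrib_mat_vec[OF \<theta>' \<theta> x] mult_mat_vec_carrier[OF \<theta>' x] by simp
    then have pos: "0 \<le> (\<Sum>l<d. \<mu> l * (cmod ((mat_adjoint U *\<^sub>v x) $ l))\<^sup>2)"
      using psd[OF x] quadratic_form_eigendecomposition[OF E x] by simp
    have UG: "(mat_adjoint U * G) $$ (l, j) = (if l = h j then 1 else 0)" if "l < d" "j < m" for l j
    proof -
      have "col G j = col U (h j)"
        using that hN(2) U1 by (intro eq_vecI) (auto simp: G_def)
      then have "(mat_adjoint U * G) $$ (l, j) = (mat_adjoint U *\<^sub>v col U (h j)) $ l"
        using that U1 G by simp
      then show ?thesis
        using index_adjoint_mult_col[OF U hN(2)[OF that(2)] that(1)] by simp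
    qed
    have y: "(mat_adjoint U *\<^sub>v x) $ l = (\<Sum>j<m. if l = h j then v $ j else 0)" if l: "l < d" for l
    proof -
      have "mat_adjoint U *\<^sub>v x = (mat_adjoint U * G) *\<^sub>v v"
        unfolding x_def by (rule assoc_mult_mat_vec[OF mat_adjoint_carrier[OF U1] G v, symmetric])
      then have "(mat_adjoint U *\<^sub>v x) $ l = (\<Sum>j<m. (mat_adjoint U * G) $$ (l, j) * v $ j)"
        using l v U1 G by (simp add: scalar_prod_def lessThan_atLeast0 del: index_mult_mat(1))
      also have "\<dots> = (\<Sum>j<m. if l = h j then v $ j else 0)"
        using UG[OF l] by (intro sum.cong) auto
      finally show ?thesis .
    qed
    have yh: "(mat_adjoint U *\<^sub>v x) $ h j = v $ j" if j: "j < m" for j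
    proof -
      have "(\<Sum>i<m. if h j = h i then v $ i else 0) = (\<Sum>i<m. if i = j then v $ j else 0)"
        using inj j by (intro sum.cong) (auto dest: inj_onD)
      then show ?thesis
        using y[OF hN(2)[OF j]] j by simp
    qed
    have y0: "(mat_adjoint U *\<^sub>v x) $ l = 0" if "l < d" "l \<notin> N" for l
      using y[OF that(1)] that(2) hN(1) by (auto intro!: sum.neutral)
    have nonpos: "\<mu> l * (cmod ((mat_adjoint U *\<^sub>v x) $ l))\<^sup>2 \<le> 0" if "l < d" for l
      using y0[OF that] that by (cases "l \<in> N") (auto simp: N_def mult_nonpos_nonneg)
    then have "(\<Sum>l<d. - (\<mu> l * (cmod ((mat_adjoint U *\<^sub>v x) $ l))\<^sup>2)) = 0"
      using pos by (intro antisym sum_nonneg) (auto simp: sum_negf)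
    then have zero: "\<mu> l * (cmod ((mat_adjoint U *\<^sub>v x) $ l))\<^sup>2 = 0" if "l < d" for l
      using sum_nonneg_eq_0_iff[of "{..<d}" "\<lambda>l. - (\<mu> l * (cmod ((mat_adjoint U *\<^sub>v x) $ l))\<^sup>2)"] nonpos that
      by auto
    show "v = 0\<^sub>v m"
    proof (rule eq_vecI)
      fix j assume "j < dim_vec (0\<^sub>v m :: complex Matrix.vec)"
      then have j: "j < m"
        by simp
      then show "v $ j = 0\<^sub>v m $ j"
        using zero[OF hN(2)[OF j]] hN(3)[OF j] yh[OF j] by auto
    qed (use v in simp)
  qed
  then show ?thesis
    using rank_mult_le[OF \<theta> G] by (simp add: m_def N_def)
qed

text \<open>The difference of two density matrices has trace zero, so its positive eigenvalues have the
  same sum as the moduli of its negative ones, of which there are at most as many as the rank of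
  \<open>\<theta>\<close>. A bound \<open>u\<close> on the eigenvalues thus bounds the trace norm by \<open>2 k u\<close>.\<close>

theorem density_low_rank_frob_norm_le:
  assumes \<theta>: "\<theta> \<in> rank_le_mats d k \<inter> density_mats d" and \<theta>': "\<theta>' \<in> density_mats d"
    and q: "even q" "q > 0" and u: "schatten_norm q (\<theta>' - \<theta>) \<le> u"
  shows "(frob_norm (\<theta>' - \<theta>))\<^sup>2 \<le> 2 * k * u\<^sup>2"
proof -
  have \<theta>d: "\<theta> \<in> density_mats d" and rank: "vec_space.rank d \<theta> \<le> k"
    using \<theta> by (auto simp: rank_le_mats_def)
  note D = density_matsD[OF \<theta>d] and D' = density_matsD[OF \<theta>']
  note H = hermitian_mats_diff[OF D'(1) D(1)]
  obtain U \<mu> where E: "eigendecomposition d (\<theta>' - \<theta>) U \<mu>"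
    using hermitian_eigendecomposition[OF H] .
  have u0: "0 \<le> u"
    using schatten_norm_nonneg[OF H q(1)] u by simp
  have le_u: "\<bar>\<mu> l\<bar> \<le> u" if "l < d" for l
    using abs_eigenvalue_le_schatten_norm[OF E that q] u by simp
  have "complex_of_real (\<Sum>l<d. \<mu> l) = 0"
    using trace_eigendecomposition[OF E] D(2) D'(2)
      mat_trace_diff[OF hermitian_matsD(1)[OF D'(1)] hermitian_matsD(1)[OF D(1)]] by simp
  then have tr: "(\<Sum>l<d. \<mu> l) = 0"
    by (simp only: of_real_eq_0_iff)
  let ?N = "{l. l < d \<and> \<mu> l < 0}"
  have "(frob_norm (\<theta>' - \<theta>))\<^sup>2 = (\<Sum>l<d. (\<mu> l)\<^sup>2)"
    by (rule frob_norm_eigendecomposition[OF H E])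
  also have "\<dots> \<le> (\<Sum>l<d. u * \<bar>\<mu> l\<bar>)"
  proof (rule sum_mono)
    fix l assume "l \<in> {..<d}"
    then have "\<bar>\<mu> l\<bar> * \<bar>\<mu> l\<bar> \<le> u * \<bar>\<mu> l\<bar>"
      using le_u by (intro mult_right_mono) auto
    then show "(\<mu> l)\<^sup>2 \<le> u * \<bar>\<mu> l\<bar>"
      by (simp add: power2_eq_square)
  qed
  \<comment> \<open>Subtracting the trace, which is zero, leaves only the negative eigenvalues.\<close>
  also have "\<dots> = u * (\<Sum>l<d. \<bar>\<mu> l\<bar> - \<mu> l)"
    by (simp add: sum_distrib_left[symmetric] sum_subtractf tr)
  also have "\<dots> \<le> u * (k * (2 * u))"
  proof (rule mult_left_mono[OF _ u0])
    have "(\<Sum>l<d. \<bar>\<mu> l\<bar> - \<mu> l) = (\<Sum>l\<in>?N. \<bar>\<mu> l\<bar> - \<mu> l)"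
      by (rule sum.mono_neutral_right) auto
    also have "\<dots> \<le> (\<Sum>l\<in>?N. 2 * u)"
    proof (rule sum_mono)
      fix l assume "l \<in> ?N"
      then show "\<bar>\<mu> l\<bar> - \<mu> l \<le> 2 * u"
        using le_u[of l] by auto
    qed
    also have "\<dots> = card ?N * (2 * u)"
      by simp
    also have "\<dots> \<le> k * (2 * u)"
      using card_negative_eigenvalues_le_rank[OF hermitian_matsD(1)[OF D(1)] hermitian_matsD(1)[OF D'(1)] D'(3) E] rank u0
      by (intro mult_right_mono) auto
    finally show "(\<Sum>l<d. \<bar>\<mu> l\<bar> - \<mu> l) \<le> k * (2 * u)" .
  qed
  finally show ?thesis
    by (simp add: power2_eq_square mult_ac)
qed

section \<open>Sums of independent centred Hermitian matrices\<close>

text \<open>Matrices of all dimensions share one type without a topology, so measurability refers to the entries.\<close>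

definition measurable_mat :: "'a measure \<Rightarrow> nat \<Rightarrow> ('a \<Rightarrow> complex mat) \<Rightarrow> bool" where
  "measurable_mat M d A \<longleftrightarrow> (\<forall>x\<in>space M. A x \<in> carrier_mat d d) \<and>
     (\<forall>i<d. \<forall>j<d. (\<lambda>x. A x $$ (i, j)) \<in> borel_measurable M)"

lemma measurable_matD:
  assumes "measurable_mat M d A"
  shows "x \<in> space M \<Longrightarrow> A x \<in> carrier_mat d d"
    "i < d \<Longrightarrow> j < d \<Longrightarrow> (\<lambda>x. A x $$ (i, j)) \<in> borel_measurable M"
  using assms by (auto simp: measurable_mat_def)

lemma measurable_mat_mult:
  assumes A: "measurable_mat M d A" and B: "measurable_mat M d B"
  shows "measurable_mat M d (\<lambda>x. A x * B x)"
  unfolding measurable_mat_def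
proof (intro conjI ballI allI impI)
  show "A x * B x \<in> carrier_mat d d" if "x \<in> space M" for x
    using measurable_matD(1)[OF A that] measurable_matD(1)[OF B that] by simp
  fix i j assume ij: "i < d" "j < d"
  have "(\<lambda>x. \<Sum>l<d. A x $$ (i, l) * B x $$ (l, j)) \<in> borel_measurable M"
    using measurable_matD(2)[OF A] measurable_matD(2)[OF B] ij
    by (intro borel_measurable_sum borel_measurable_times) auto
  then show "(\<lambda>x. (A x * B x) $$ (i, j)) \<in> borel_measurable M"
    using index_mult_mat_sum[OF measurable_matD(1)[OF A] measurable_matD(1)[OF B] ij]
    by (subst measurable_cong) auto
qed

lemma measurable_mat_pow:
  assumes A: "measurable_mat M d A"
  shows "measurable_mat M d (\<lambda>x. A x ^\<^sub>m k)"
proof (induction k)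
  case 0
  have "(\<lambda>x. (A x ^\<^sub>m 0) $$ (i, j)) \<in> borel_measurable M" if ij: "i < d" "j < d" for i j
  proof -
    have "(A x ^\<^sub>m 0) $$ (i, j) = (if i = j then 1 else 0)" if "x \<in> space M" for x
      using carrier_matD[OF measurable_matD(1)[OF A that]] ij by simp
    then show ?thesis
      by (subst measurable_cong) auto
  qed
  then show ?case
    using measurable_matD(1)[OF A] by (auto simp: measurable_mat_def intro!: one_carrier_mat)
next
  case (Suc k)
  show ?case
    using measurable_mat_mult[OF Suc.IH A] by simp
qed

lemma borel_measurable_schatten_norm:
  assumes A: "measurable_mat M d A"
  shows "(\<lambda>x. schatten_norm q (A x)) \<in> borel_measurable M"
proof -
  note P = measurable_mat_pow[OF A, of q]
  have "(\<lambda>x. \<Sum>i<d. (A x ^\<^sub>m q) $$ (i, i)) \<in> borel_measurable M"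
    using measurable_matD(2)[OF P] by (intro borel_measurable_sum) auto
  then have "(\<lambda>x. Re (\<Sum>i<d. (A x ^\<^sub>m q) $$ (i, i))) \<in> borel_measurable M"
    by (rule measurable_compose) (intro borel_measurable_continuous_onI continuous_intros)
  then have "(\<lambda>x. trace_pow q (A x)) \<in> borel_measurable M"
    unfolding trace_pow_def using mat_trace_carrier[OF measurable_matD(1)[OF P]]
    by (subst measurable_cong) auto
  then show ?thesis
    unfolding schatten_norm_def by measurable
qed

lemma measurable_mat_diff_const:
  assumes A: "measurable_mat M d A" and B: "B \<in> carrier_mat d d"
  shows "measurable_mat M d (\<lambda>x. A x - B)"
  unfolding measurable_mat_def
proof (intro conjI ballI allI impI)
  show "A x - B \<in> carrier_mat d d" for x
    using B by (rule minus_carrier_mat)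
  fix i j assume ij: "i < d" "j < d"
  have "(\<lambda>x. A x $$ (i, j) - B $$ (i, j)) \<in> borel_measurable M"
    using measurable_matD(2)[OF A ij] by simp
  then show "(\<lambda>x. (A x - B) $$ (i, j)) \<in> borel_measurable M"
    using B ij by simp
qed

text \<open>There is no zero matrix common to all dimensions, so the sum is formed entrywise and carries the dimension.\<close>

definition mat_sum :: "nat \<Rightarrow> (nat \<Rightarrow> complex mat) \<Rightarrow> nat \<Rightarrow> complex mat" where
  "mat_sum d A n = Matrix.mat d d (\<lambda>(i, j). \<Sum>l<n. A l $$ (i, j))"

lemma mat_sum_carrier [simp]: "mat_sum d A n \<in> carrier_mat d d"
  by (simp add: mat_sum_def)

lemma mat_sum_0: "mat_sum d A 0 = 0\<^sub>m d d"
  by (auto simp: mat_sum_def)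

lemma mat_sum_Suc: "A n \<in> carrier_mat d d \<Longrightarrow> mat_sum d A (Suc n) = mat_sum d A n + A n"
  by (intro eq_matI) (auto simp: mat_sum_def)

lemma mat_sum_cong: "(\<And>l. l < n \<Longrightarrow> A l = B l) \<Longrightarrow> mat_sum d A n = mat_sum d B n"
  by (auto simp: mat_sum_def intro!: eq_matI sum.cong)

lemma hermitian_mat_sum:
  assumes "\<And>l. l < n \<Longrightarrow> A l \<in> hermitian_mats d"
  shows "mat_sum d A n \<in> hermitian_mats d"
  using assms
proof (induction n)
  case (Suc n)
  have "mat_sum d A n \<in> hermitian_mats d"
    by (rule Suc.IH) (rule Suc.prems, simp)
  moreover have "A n \<in> hermitian_mats d"
    using Suc.prems by simp
  ultimately show ?case
    using mat_sum_Suc[OF hermitian_matsD(1), of A n d] hermitian_mats_add[of "mat_sum d A n" d "A n"] by simp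
qed (simp add: mat_sum_0)

lemma schatten_norm_zero:
  assumes "q > 0"
  shows "schatten_norm q (0\<^sub>m d d) = 0"
proof -
  have "complex_of_real 0 \<cdot>\<^sub>m 0\<^sub>m d d = 0\<^sub>m d d"
    by (intro eq_matI) auto
  then have "trace_pow q (0\<^sub>m d d) = 0"
    using trace_pow_smult[of "0\<^sub>m d d" d q 0] assms by (simp only: zero_carrier_mat simp_thms power_0_left) simp
  then show ?thesis
    by (simp add: schatten_norm_def)
qed

text \<open>Only used for integrability; it loses a factor \<open>n\<close> compared with the type 2 inequality.\<close>

lemma schatten_norm_mat_sum_le:
  assumes A: "\<And>l. l < n \<Longrightarrow> A l \<in> hermitian_mats d" and q: "even q" "q > 0"
  shows "schatten_norm q (mat_sum d A n) \<le> (\<Sum>l<n. schatten_norm q (A l))"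
  using A
proof (induction n)
  case 0
  then show ?case
    using q by (simp add: mat_sum_0 schatten_norm_zero)
next
  case (Suc n)
  have "schatten_norm q (mat_sum d A n + A n) \<le> schatten_norm q (mat_sum d A n) + schatten_norm q (A n)"
    by (rule schatten_norm_triangle[OF hermitian_mat_sum _ q]) (use Suc.prems in auto)
  then show ?case
    using Suc mat_sum_Suc[OF hermitian_matsD(1), of A n d] by simp
qed

text \<open>The type 2 inequality. In \<open>schatten_norm_smooth\<close> the linear term at the partial sum of the
  first \<open>n\<close> matrices has mean zero given these, because the next matrix is independent and centred;
  so each further matrix adds at most \<open>2 q\<close> times its expected squared norm.\<close>

theorem schatten_norm_type_2:
  fixes M :: "'a measure" and W :: "'a \<Rightarrow> complex mat"
  assumes M: "prob_space M" and Wm: "measurable_mat M d W"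
    and W: "\<And>x. x \<in> space M \<Longrightarrow> W x \<in> hermitian_mats d" and q: "q = 2 ^ Suc m"
    and int: "integrable M (\<lambda>x. (schatten_norm q (W x))\<^sup>2)"
    and intl: "\<And>G. G \<in> hermitian_mats d \<Longrightarrow> integrable M (\<lambda>x. Re (mat_trace (G * W x)))"
    and centred: "\<And>G. G \<in> hermitian_mats d \<Longrightarrow> (\<integral>x. Re (mat_trace (G * W x)) \<partial>M) = 0"
  shows "integrable (PiM {..<n} (\<lambda>_. M)) (\<lambda>\<omega>. (schatten_norm q (mat_sum d (\<lambda>l. W (\<omega> l)) n))\<^sup>2)"
    and "(\<integral>\<omega>. (schatten_norm q (mat_sum d (\<lambda>l. W (\<omega> l)) n))\<^sup>2 \<partial>PiM {..<n} (\<lambda>_. M)) \<le>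
      2 * real q * real n * (\<integral>x. (schatten_norm q (W x))\<^sup>2 \<partial>M)"
proof -
  have q': "even q" "q > 0"
    using q by auto
  interpret product_prob_space "\<lambda>_. M" "UNIV :: nat set"
    by (rule product_prob_spaceI) (rule M)
  let ?P = "\<lambda>n. PiM {..<n} (\<lambda>_. M)" and ?N = "schatten_norm q"
  let ?S = "\<lambda>n \<omega>. mat_sum d (\<lambda>l. W (\<omega> l)) n"
  have comp: "\<omega> l \<in> space M" if "\<omega> \<in> space (?P n)" "l < n" for \<omega> l n
    using that by (auto simp: space_PiM)
  have Wl: "W (\<omega> l) \<in> hermitian_mats d" if "\<omega> \<in> space (?P n)" "l < n" for \<omega> l n
    using W[OF comp[OF that]] .
  have S: "?S n \<omega> \<in> hermitian_mats d" if "\<omega> \<in> space (?P n)" for \<omega> n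
    using Wl[OF that] by (rule hermitian_mat_sum)
  have Sm: "measurable_mat (?P n) d (?S n)" for n
    unfolding measurable_mat_def
  proof (intro conjI ballI allI impI)
    fix i j assume ij: "i < d" "j < d"
    have "(\<lambda>\<omega>. \<Sum>l<n. W (\<omega> l) $$ (i, j)) \<in> borel_measurable (?P n)"
      by (intro borel_measurable_sum measurable_compose[OF _ measurable_matD(2)[OF Wm ij]]
          measurable_component_singleton) auto
    then show "(\<lambda>\<omega>. ?S n \<omega> $$ (i, j)) \<in> borel_measurable (?P n)"
      using ij by (simp add: mat_sum_def)
  qed simp
  have meas: "(\<lambda>\<omega>. (?N (?S n \<omega>))\<^sup>2) \<in> borel_measurable (?P n)" for n
    by (intro borel_measurable_power borel_measurable_schatten_norm[OF Sm])
  have intS: "integrable (?P n) (\<lambda>\<omega>. (?N (?S n \<omega>))\<^sup>2)" for n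
  proof (rule Bochner_Integration.integrable_bound)
    show "integrable (?P n) (\<lambda>\<omega>. real n * (\<Sum>l<n. (?N (W (\<omega> l)))\<^sup>2))"
    proof (intro integrable_mult_right Bochner_Integration.integrable_sum)
      fix l assume l: "l \<in> {..<n}"
      have "integrable (distr (?P n) M (\<lambda>\<omega>. \<omega> l)) (\<lambda>x. (?N (W x))\<^sup>2)"
        using int distr_PiM_component[OF M l] by simp
      then show "integrable (?P n) (\<lambda>\<omega>. (?N (W (\<omega> l)))\<^sup>2)"
        using l by (subst (asm) integrable_distr_eq)
          (auto intro!: borel_measurable_power borel_measurable_schatten_norm[OF Wm] measurable_component_singleton)
    qed
    have "(?N (?S n \<omega>))\<^sup>2 \<le> real n * (\<Sum>l<n. (?N (W (\<omega> l)))\<^sup>2)" if \<omega>: "\<omega> \<in> space (?P n)" for \<omega>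
    proof -
      have "(?N (?S n \<omega>))\<^sup>2 \<le> (\<Sum>l<n. ?N (W (\<omega> l)))\<^sup>2"
        by (intro power_mono schatten_norm_mat_sum_le q' Wl[OF \<omega>] schatten_norm_nonneg[OF S[OF \<omega>]])
      also have "\<dots> \<le> (\<Sum>l<n. (?N (W (\<omega> l)))\<^sup>2) * real n"
        using Cauchy_Schwarz_ineq_sum[of "\<lambda>l. ?N (W (\<omega> l))" "\<lambda>_. 1" "{..<n}"] by simp
      finally show ?thesis
        by (simp add: mult.commute)
    qed
    then show "AE \<omega> in ?P n. norm ((?N (?S n \<omega>))\<^sup>2) \<le> norm (real n * (\<Sum>l<n. (?N (W (\<omega> l)))\<^sup>2))"
      by (intro AE_I2) (simp add: sum_nonneg)
  qed (rule meas)
  show "integrable (?P n) (\<lambda>\<omega>. (?N (?S n \<omega>))\<^sup>2)"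
    by (rule intS)
  define B where "B = (\<integral>x. (?N (W x))\<^sup>2 \<partial>M)"
  have B0: "B \<ge> 0"
    unfolding B_def by (rule Bochner_Integration.integral_nonneg) simp
  have "(\<integral>\<omega>. (?N (?S n \<omega>))\<^sup>2 \<partial>?P n) \<le> 2 * real q * real n * B"
  proof (induction n)
    case 0
    then show ?case
      using q' by (simp add: mat_sum_0 schatten_norm_zero)
  next
    case (Suc n)
    have upd: "?S (Suc n) (fun_upd \<omega> n y) = ?S n \<omega> + W y" if "y \<in> space M" for \<omega> y
      using mat_sum_Suc[of "\<lambda>l. W ((fun_upd \<omega> n y) l)" n d] hermitian_matsD(1)[OF W[OF that]]
        mat_sum_cong[of n "\<lambda>l. W ((fun_upd \<omega> n y) l)" "\<lambda>l. W (\<omega> l)" d] by simp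
    have "(\<integral>\<omega>. (?N (?S (Suc n) \<omega>))\<^sup>2 \<partial>?P (Suc n)) =
        (\<integral>\<omega>. (\<integral>y. (?N (?S (Suc n) (fun_upd \<omega> n y)))\<^sup>2 \<partial>M) \<partial>?P n)"
      unfolding lessThan_Suc
      by (rule product_integral_insert) (use intS[of "Suc n"] in \<open>auto simp: lessThan_Suc\<close>)
    also have "\<dots> \<le> (\<integral>\<omega>. (?N (?S n \<omega>))\<^sup>2 + 2 * real q * B \<partial>?P n)"
    proof (rule integral_mono')
      show "integrable (?P n) (\<lambda>\<omega>. (?N (?S n \<omega>))\<^sup>2 + 2 * real q * B)"
        using finite_measure.integrable_const[OF prob_space.finite_measure[OF prob_space_PiM[OF M]]]
        by (intro Bochner_Integration.integrable_add intS) auto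
      fix \<omega> assume \<omega>: "\<omega> \<in> space (?P n)"
      let ?A = "?S n \<omega>"
      note A = S[OF \<omega>]
      define c where "c = 2 * (?N ?A)\<^sup>2 / ?N ?A ^ q"
      have "(\<integral>y. (?N (?S (Suc n) (fun_upd \<omega> n y)))\<^sup>2 \<partial>M) \<le>
          (\<integral>y. (?N ?A)\<^sup>2 + c * Re (mat_trace (?A ^\<^sub>m (q - 1) * W y)) + 2 * real q * (?N (W y))\<^sup>2 \<partial>M)"
      proof (rule integral_mono_AE')
        show "integrable M (\<lambda>y. (?N ?A)\<^sup>2 + c * Re (mat_trace (?A ^\<^sub>m (q - 1) * W y)) + 2 * real q * (?N (W y))\<^sup>2)"
          using finite_measure.integrable_const[OF prob_space.finite_measure[OF M]]
          by (intro Bochner_Integration.integrable_add integrable_mult_right int intl hermitian_mats_pow A) auto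
        \<comment> \<open>Smoothness at the partial sum \<open>?A\<close>, which does not depend on the new coordinate \<open>y\<close>.\<close>
        have le: "(?N (?S (Suc n) (fun_upd \<omega> n y)))\<^sup>2 \<le>
            (?N ?A)\<^sup>2 + c * Re (mat_trace (?A ^\<^sub>m (q - 1) * W y)) + 2 * real q * (?N (W y))\<^sup>2"
          if y: "y \<in> space M" for y
        proof -
          have "2 * (real q - 1) * (?N (W y))\<^sup>2 \<le> 2 * real q * (?N (W y))\<^sup>2"
            by (intro mult_right_mono) auto
          then show ?thesis
            using schatten_norm_smooth[OF A W[OF y] q] unfolding upd[OF y] c_def by linarith
        qed
        then show "AE y in M. (?N (?S (Suc n) (fun_upd \<omega> n y)))\<^sup>2 \<le>
            (?N ?A)\<^sup>2 + c * Re (mat_trace (?A ^\<^sub>m (q - 1) * W y)) + 2 * real q * (?N (W y))\<^sup>2"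
          by (rule AE_I2)
        show "AE y in M. 0 \<le> (?N ?A)\<^sup>2 + c * Re (mat_trace (?A ^\<^sub>m (q - 1) * W y)) + 2 * real q * (?N (W y))\<^sup>2"
          using le by (intro AE_I2) (meson order_trans zero_le_power2)
      qed
      also have "\<dots> = (?N ?A)\<^sup>2 + c * 0 + 2 * real q * B"
        using finite_measure.integrable_const[OF prob_space.finite_measure[OF M]]
          intl[OF hermitian_mats_pow[OF A]] int centred[OF hermitian_mats_pow[OF A]] prob_space.prob_space[OF M]
        by (simp add: B_def Bochner_Integration.integral_add)
      finally show "(\<integral>y. (?N (?S (Suc n) (fun_upd \<omega> n y)))\<^sup>2 \<partial>M) \<le> (?N ?A)\<^sup>2 + 2 * real q * B"
        by simp
    qed (use B0 in simp)
    also have "\<dots> = (\<integral>\<omega>. (?N (?S n \<omega>))\<^sup>2 \<partial>?P n) + 2 * real q * B"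
    proof -
      have "integrable (?P n) (\<lambda>\<omega>. 2 * real q * B)"
        by (rule finite_measure.integrable_const[OF prob_space.finite_measure[OF prob_space_PiM[OF M]]])
      from Bochner_Integration.integral_add[OF intS[of n] this] show ?thesis
        using prob_space.prob_space[OF prob_space_PiM[OF M], of "{..<n}"] by simp
    qed
    also have "\<dots> \<le> 2 * real q * real n * B + 2 * real q * B"
      using Suc.IH by simp
    finally show ?case
      by (simp add: algebra_simps)
  qed
  then show "(\<integral>\<omega>. (?N (?S n \<omega>))\<^sup>2 \<partial>?P n) \<le> 2 * real q * real n * (\<integral>x. (?N (W x))\<^sup>2 \<partial>M)"
    by (simp add: B_def)
qed

section \<open>The observations are independent and identically distributed\<close>

definition obs_dist :: "complex mat set \<Rightarrow> real \<Rightarrow> complex mat \<Rightarrow> (real \<times> complex mat) measure" where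
  "obs_dist S \<sigma> \<theta> = distr (centred_gaussian \<sigma> \<Otimes>\<^sub>M uniform_count_measure S) (obs_space S)
     (\<lambda>z. (Re (mat_trace (snd z * \<theta>)) + fst z, snd z))"

lemma sets_centred_gaussian [measurable_cong, simp]: "sets (centred_gaussian \<sigma>) = sets borel"
  by (simp add: centred_gaussian_def)

lemma space_centred_gaussian [simp]: "space (centred_gaussian \<sigma>) = UNIV"
  by (simp add: centred_gaussian_def)

lemma prob_space_centred_gaussian: "0 \<le> \<sigma> \<Longrightarrow> prob_space (centred_gaussian \<sigma>)"
  by (auto simp: centred_gaussian_def prob_space_normal_density prob_space_return)

lemma space_obs_space: "space (obs_space S) = UNIV \<times> S"
  by (simp add: obs_space_def space_pair_measure)

lemma measurable_snd_obs:
  "(\<lambda>z. f (snd z)) \<in> borel_measurable (borel \<Otimes>\<^sub>M count_space S)"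
  by (rule measurable_compose[OF measurable_snd]) simp

lemma measurable_snd_base:
  "(\<lambda>z. f (snd z)) \<in> borel_measurable (centred_gaussian \<sigma> \<Otimes>\<^sub>M uniform_count_measure S)"
  by (rule measurable_compose[OF measurable_snd]) simp

lemma measurable_obs_map:
  "(\<lambda>z. (Re (mat_trace (snd z * \<theta>)) + fst z, snd z)) \<in>
    centred_gaussian \<sigma> \<Otimes>\<^sub>M uniform_count_measure S \<rightarrow>\<^sub>M obs_space S"
proof -
  have "snd \<in> centred_gaussian \<sigma> \<Otimes>\<^sub>M uniform_count_measure S \<rightarrow>\<^sub>M count_space S"
    using measurable_snd[of "centred_gaussian \<sigma>" "uniform_count_measure S"]
    by (simp cong: measurable_cong_sets)
  then show ?thesis
    unfolding obs_space_def
    by (intro measurable_Pair borel_measurable_add measurable_snd_base) auto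
qed

lemma sets_obs_dist [measurable_cong, simp]: "sets (obs_dist S \<sigma> \<theta>) = sets (obs_space S)"
  by (simp add: obs_dist_def)

lemma space_obs_dist [simp]: "space (obs_dist S \<sigma> \<theta>) = UNIV \<times> S"
  by (simp add: obs_dist_def space_obs_space)

lemma prob_space_obs_dist:
  assumes "finite S" "S \<noteq> {}" "0 \<le> \<sigma>"
  shows "prob_space (obs_dist S \<sigma> \<theta>)"
  unfolding obs_dist_def
  by (intro prob_space.prob_space_distr prob_space_pair prob_space_uniform_count_measure
      prob_space_centred_gaussian measurable_obs_map assms)

lemma nn_integral_PiM_prod:
  assumes M: "prob_space M" and J: "finite (J :: 'i set)" and g: "\<And>j. j \<in> J \<Longrightarrow> g j \<in> borel_measurable M"
  shows "(\<integral>\<^sup>+x. (\<Prod>j\<in>J. g j (x j)) \<partial>PiM UNIV (\<lambda>_. M)) = (\<Prod>j\<in>J. \<integral>\<^sup>+x. g j x \<partial>M)"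
proof -
  interpret product_prob_space "\<lambda>_. M" "UNIV :: 'i set"
    by (rule product_prob_spaceI) (rule M)
  have m: "(\<lambda>x. \<Prod>j\<in>J. g j (x j)) \<in> borel_measurable (PiM J (\<lambda>_. M))"
  proof (intro borel_measurable_prod_ennreal)
    fix j assume j: "j \<in> J"
    have "(\<lambda>x. x j) \<in> PiM J (\<lambda>_. M) \<rightarrow>\<^sub>M M"
      using j by (rule measurable_component_singleton)
    from measurable_compose[OF this g[OF j]] show "(\<lambda>x. g j (x j)) \<in> borel_measurable (PiM J (\<lambda>_. M))" .
  qed
  have "(\<Prod>j\<in>J. \<integral>\<^sup>+x. g j x \<partial>M) = (\<integral>\<^sup>+x. (\<Prod>j\<in>J. g j (x j)) \<partial>PiM J (\<lambda>_. M))"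
    by (rule product_nn_integral_prod[symmetric]) (use J g in auto)
  also have "PiM J (\<lambda>_. M) = distr (PiM UNIV (\<lambda>_. M)) (PiM J (\<lambda>_. M)) (\<lambda>x. restrict x J)"
    by (rule distr_PiM_restrict_finite[symmetric]) (use J in auto)
  also have "(\<integral>\<^sup>+x. (\<Prod>j\<in>J. g j (x j)) \<partial>\<dots>) = (\<integral>\<^sup>+x. (\<Prod>j\<in>J. g j (restrict x J j)) \<partial>PiM UNIV (\<lambda>_. M))"
    by (rule nn_integral_distr) (use m in \<open>auto intro!: measurable_restrict_subset\<close>)
  finally show ?thesis
    by simp
qed

text \<open>The noise and the design were drawn as two separate sequences. To see that the pairs are independent,
  it is enough to look at cylinder sets, where integrating first over the design and then over the noise
  factorises.\<close>

theorem obs_law_eq_PiM: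
  assumes S: "finite S" "S \<noteq> {}" and \<sigma>: "0 \<le> \<sigma>"
  shows "obs_law S \<sigma> \<theta> = PiM UNIV (\<lambda>_. obs_dist S \<sigma> \<theta>)"
proof -
  let ?g = "centred_gaussian \<sigma>" and ?u = "uniform_count_measure S" and ?\<nu> = "obs_dist S \<sigma> \<theta>"
  let ?h = "\<lambda>z. (Re (mat_trace (snd z * \<theta>)) + fst z, snd z)"
  let ?H = "\<lambda>(noise, X) i. (Re (mat_trace (X i * \<theta>)) + noise i, X i)"
  let ?G = "PiM UNIV (\<lambda>_::nat. ?g)" and ?U = "PiM UNIV (\<lambda>_::nat. ?u)"
  have g: "prob_space ?g" and u: "prob_space ?u" and \<nu>: "prob_space ?\<nu>"
    using S \<sigma> by (auto intro: prob_space_centred_gaussian prob_space_uniform_count_measure prob_space_obs_dist)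
  interpret G: prob_space ?G by (rule prob_space_PiM) (rule g)
  interpret U: prob_space ?U by (rule prob_space_PiM) (rule u)
  interpret GU: pair_sigma_finite ?G ?U ..
  interpret u: prob_space ?u by (rule u)
  interpret \<nu>: product_prob_space "\<lambda>_. ?\<nu>" "UNIV :: nat set"
    by (rule product_prob_spaceI) (rule \<nu>)
  have ij: "(\<lambda>z. (fst z j, snd z j)) \<in> ?G \<Otimes>\<^sub>M ?U \<rightarrow>\<^sub>M ?g \<Otimes>\<^sub>M ?u" for j :: nat
    by (intro measurable_Pair measurable_compose[OF measurable_fst] measurable_compose[OF measurable_snd]
        measurable_component_singleton) auto
  have H: "?H \<in> ?G \<Otimes>\<^sub>M ?U \<rightarrow>\<^sub>M PiM UNIV (\<lambda>_. obs_space S)"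
    unfolding case_prod_beta
  proof (rule measurable_PiM_single')
    fix j :: nat
    show "(\<lambda>z. (Re (mat_trace (snd z j * \<theta>)) + fst z j, snd z j)) \<in> ?G \<Otimes>\<^sub>M ?U \<rightarrow>\<^sub>M obs_space S"
      using measurable_compose[OF ij[of j] measurable_obs_map[of \<theta>]] by simp
  qed (auto simp: space_pair_measure space_PiM space_obs_space space_uniform_count_measure)
  show ?thesis
  proof (rule \<nu>.PiM_eq)
    show "sets (obs_law S \<sigma> \<theta>) = sets (PiM UNIV (\<lambda>_. ?\<nu>))"
      by (simp add: obs_law_def seq_space_def cong: sets_PiM_cong)
    fix J :: "nat set" and F assume J: "finite J" "J \<subseteq> UNIV" and F: "\<And>j. j \<in> J \<Longrightarrow> F j \<in> sets ?\<nu>"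
    have F': "F j \<in> sets (obs_space S)" if "j \<in> J" for j
      using F[OF that] by simp
    define A where "A j = ?h -` F j \<inter> space (?g \<Otimes>\<^sub>M ?u)" for j
    have A: "A j \<in> sets (?g \<Otimes>\<^sub>M ?u)" if "j \<in> J" for j
      unfolding A_def by (rule measurable_sets[OF measurable_obs_map F'[OF that]])
    let ?E = "prod_emb UNIV (\<lambda>_. ?\<nu>) J (\<Pi>\<^sub>E j\<in>J. F j)"
    have E: "?E \<in> sets (PiM UNIV (\<lambda>_. obs_space S))"
      using sets_PiM_I[of J UNIV F "\<lambda>_. ?\<nu>"] J F by (simp cong: sets_PiM_cong)
    have "emeasure (obs_law S \<sigma> \<theta>) ?E = emeasure (?G \<Otimes>\<^sub>M ?U) (?H -` ?E \<inter> space (?G \<Otimes>\<^sub>M ?U))"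
      unfolding obs_law_def seq_space_def by (rule emeasure_distr[OF H E])
    also have "\<dots> = (\<integral>\<^sup>+z. indicator (?H -` ?E \<inter> space (?G \<Otimes>\<^sub>M ?U)) z \<partial>(?G \<Otimes>\<^sub>M ?U))"
      by (rule nn_integral_indicator[symmetric]) (rule measurable_sets[OF H E])
    also have "\<dots> = (\<integral>\<^sup>+z. (\<Prod>j\<in>J. indicator (A j) (fst z j, snd z j)) \<partial>(?G \<Otimes>\<^sub>M ?U))"
    proof (rule nn_integral_cong)
      fix z assume z: "z \<in> space (?G \<Otimes>\<^sub>M ?U)"
      then have zj: "(fst z j, snd z j) \<in> space (?g \<Otimes>\<^sub>M ?u)" for j
        by (auto simp: space_pair_measure space_PiM)
      with z have "?H z \<in> ?E \<longleftrightarrow> (\<forall>j\<in>J. (fst z j, snd z j) \<in> A j)"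
        using z by (auto simp: prod_emb_def A_def case_prod_beta space_pair_measure PiE_iff space_PiM
            space_uniform_count_measure)
      then show "indicator (?H -` ?E \<inter> space (?G \<Otimes>\<^sub>M ?U)) z = (\<Prod>j\<in>J. indicator (A j) (fst z j, snd z j) :: ennreal)"
        using z J by (cases "\<forall>j\<in>J. (fst z j, snd z j) \<in> A j") (auto simp: indicator_def prod_zero_iff intro!: prod.neutral[symmetric])
    qed
    also have "\<dots> = (\<integral>\<^sup>+e. (\<integral>\<^sup>+x. (\<Prod>j\<in>J. indicator (A j) (e j, x j)) \<partial>?U) \<partial>?G)"
      using U.nn_integral_fst[of "\<lambda>z. \<Prod>j\<in>J. indicator (A j) (fst z j, snd z j)" ?G] A
      by (simp add: borel_measurable_prod_ennreal measurable_compose[OF ij])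
    also have "\<dots> = (\<integral>\<^sup>+e. (\<Prod>j\<in>J. (\<integral>\<^sup>+x. indicator (A j) (e j, x) \<partial>?u)) \<partial>?G)"
      by (intro nn_integral_cong nn_integral_PiM_prod[OF u J(1)]) (use A in \<open>auto intro!: measurable_compose[OF measurable_Pair1']\<close>)
    also have "\<dots> = (\<Prod>j\<in>J. \<integral>\<^sup>+e. (\<integral>\<^sup>+x. indicator (A j) (e, x) \<partial>?u) \<partial>?g)"
      by (rule nn_integral_PiM_prod[OF g J(1)]) (use A in \<open>auto intro!: u.borel_measurable_nn_integral_fst\<close>)
    also have "\<dots> = (\<Prod>j\<in>J. emeasure ?\<nu> (F j))"
    proof (rule prod.cong)
      fix j assume j: "j \<in> J"
      have "(\<integral>\<^sup>+e. (\<integral>\<^sup>+x. indicator (A j) (e, x) \<partial>?u) \<partial>?g) = emeasure (?g \<Otimes>\<^sub>M ?u) (A j)"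
        by (rule u.emeasure_pair_measure[OF A[OF j], symmetric])
      also have "\<dots> = emeasure ?\<nu> (F j)"
        unfolding obs_dist_def A_def by (rule emeasure_distr[OF measurable_obs_map F'[OF j], symmetric])
      finally show "(\<integral>\<^sup>+e. (\<integral>\<^sup>+x. indicator (A j) (e, x) \<partial>?u) \<partial>?g) = emeasure ?\<nu> (F j)" .
    qed simp
    finally show "emeasure (obs_law S \<sigma> \<theta>) ?E = (\<Prod>j\<in>J. emeasure ?\<nu> (F j))" .
  qed
qed

section \<open>Moments of a single measurement\<close>

lemma centred_gaussian_moments:
  assumes "0 \<le> \<sigma>"
  shows "integrable (centred_gaussian \<sigma>) (\<lambda>e. e)" "(\<integral>e. e \<partial>centred_gaussian \<sigma>) = 0"
    "integrable (centred_gaussian \<sigma>) (\<lambda>e. e\<^sup>2)" "(\<integral>e. e\<^sup>2 \<partial>centred_gaussian \<sigma>) = \<sigma>\<^sup>2"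
proof -
  have "integrable (centred_gaussian \<sigma>) (\<lambda>e. e) \<and> (\<integral>e. e \<partial>centred_gaussian \<sigma>) = 0 \<and>
    integrable (centred_gaussian \<sigma>) (\<lambda>e. e\<^sup>2) \<and> (\<integral>e. e\<^sup>2 \<partial>centred_gaussian \<sigma>) = \<sigma>\<^sup>2"
  proof (cases "\<sigma> = 0")
    case True
    interpret prob_space "return borel (0::real)"
      by (rule prob_space_return) simp
    have int: "integrable (return borel (0::real)) f" if f: "f \<in> borel_measurable borel" for f :: "real \<Rightarrow> real"
    proof (rule integrableI_bounded)
      show "f \<in> borel_measurable (return borel 0)"
        using f by simp
      show "(\<integral>\<^sup>+x. ennreal (norm (f x)) \<partial>return borel 0) < \<infinity>"
        using f by (subst nn_integral_return) auto
    qed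
    have val: "(\<integral>e. f e \<partial>return borel (0::real)) = f 0" if "f \<in> borel_measurable borel" for f :: "real \<Rightarrow> real"
      using that by (intro integral_return) auto
    have g: "centred_gaussian \<sigma> = return borel 0"
      using True by (simp add: centred_gaussian_def)
    have m: "(\<lambda>e::real. e) \<in> borel_measurable borel" "(\<lambda>e::real. e\<^sup>2) \<in> borel_measurable borel"
      by auto
    have "(\<integral>e. e \<partial>return borel (0::real)) = 0" "(\<integral>e. e\<^sup>2 \<partial>return borel (0::real)) = \<sigma>\<^sup>2"
      using val[OF m(1)] val[OF m(2)] True by auto
    then show ?thesis
      unfolding g by (intro conjI int m)
  next
    case False
    then have s: "\<sigma> > 0"
      using assms by simp
    have 1: "has_bochner_integral lborel (\<lambda>x. normal_density 0 \<sigma> x * x) 0"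
      by (rule normal_moment_nz_1[OF s])
    have 2: "has_bochner_integral lborel (\<lambda>x. normal_density 0 \<sigma> x * x\<^sup>2) (\<sigma>\<^sup>2)"
    proof -
      have "fact (2 * 1) / ((2 / \<sigma>\<^sup>2) ^ 1 * fact 1) = \<sigma>\<^sup>2"
        using s by (simp add: fact_numeral)
      then show ?thesis
        using normal_moment_even[OF s, of 0 1] by (simp only: mult_1_right diff_zero)
    qed
    have g: "centred_gaussian \<sigma> = density lborel (normal_density 0 \<sigma>)"
      using s by (simp add: centred_gaussian_def)
    have "integrable (centred_gaussian \<sigma>) f \<and> (\<integral>e. f e \<partial>centred_gaussian \<sigma>) = c"
      if "has_bochner_integral lborel (\<lambda>x. normal_density 0 \<sigma> x * f x) c" "f \<in> borel_measurable borel" for f c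
    proof -
      have nn: "AE x in lborel. 0 \<le> normal_density 0 \<sigma> x"
        by (intro AE_I2 normal_density_nonneg)
      have fm: "f \<in> borel_measurable lborel" and dm: "normal_density 0 \<sigma> \<in> borel_measurable lborel"
        using that(2) by auto
      show ?thesis
        unfolding g integrable_density[OF fm dm nn] integral_density[OF fm dm nn]
        using that(1) unfolding has_bochner_integral_iff real_scaleR_def .
    qed
    from this[of "\<lambda>e. e" 0] this[of "\<lambda>e. e\<^sup>2" "\<sigma>\<^sup>2"] 1 2 show ?thesis
      by auto
  qed
  then show "integrable (centred_gaussian \<sigma>) (\<lambda>e. e)" "(\<integral>e. e \<partial>centred_gaussian \<sigma>) = 0"
    "integrable (centred_gaussian \<sigma>) (\<lambda>e. e\<^sup>2)" "(\<integral>e. e\<^sup>2 \<partial>centred_gaussian \<sigma>) = \<sigma>\<^sup>2"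
    by auto
qed

text \<open>The design part \<open>\<phi>\<close> is bounded because \<open>S\<close> is finite, so Fubini's theorem applies to every integrable \<open>f\<close>.\<close>

lemma integral_noise_design:
  assumes S: "finite S" "S \<noteq> {}" and \<sigma>: "0 \<le> \<sigma>" and f: "integrable (centred_gaussian \<sigma>) f"
  shows "integrable (centred_gaussian \<sigma> \<Otimes>\<^sub>M uniform_count_measure S) (\<lambda>z. \<phi> (snd z) * f (fst z))"
    and "(\<integral>z. \<phi> (snd z) * f (fst z) \<partial>(centred_gaussian \<sigma> \<Otimes>\<^sub>M uniform_count_measure S)) =
      (\<Sum>x\<in>S. \<phi> x) / card S * (\<integral>e. f e \<partial>centred_gaussian \<sigma>)"
proof -
  let ?g = "centred_gaussian \<sigma>" and ?u = "uniform_count_measure S"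
  interpret g: prob_space ?g
    using \<sigma> by (rule prob_space_centred_gaussian)
  interpret u: prob_space ?u
    using S by (rule prob_space_uniform_count_measure)
  interpret gu: pair_sigma_finite ?g ?u ..
  have fm: "f \<in> borel_measurable ?g"
    using f by auto
  define B where "B = (\<Sum>x\<in>S. \<bar>\<phi> x\<bar>)"
  have B: "\<bar>\<phi> x\<bar> \<le> B" if "x \<in> S" for x
    unfolding B_def using S that by (intro member_le_sum) auto
  have "integrable (distr (?g \<Otimes>\<^sub>M ?u) ?g fst) f"
    using f by (simp add: u.distr_pair_fst)
  then have f1: "integrable (?g \<Otimes>\<^sub>M ?u) (\<lambda>z. f (fst z))"
    using fm by (subst (asm) integrable_distr_eq) auto
  show int: "integrable (?g \<Otimes>\<^sub>M ?u) (\<lambda>z. \<phi> (snd z) * f (fst z))"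
  proof (rule Bochner_Integration.integrable_bound)
    show "integrable (?g \<Otimes>\<^sub>M ?u) (\<lambda>z. B * f (fst z))"
      using f1 by simp
    show "(\<lambda>z. \<phi> (snd z) * f (fst z)) \<in> borel_measurable (?g \<Otimes>\<^sub>M ?u)"
      using fm by (intro borel_measurable_times measurable_snd_base measurable_compose[OF measurable_fst])
    show "AE z in ?g \<Otimes>\<^sub>M ?u. norm (\<phi> (snd z) * f (fst z)) \<le> norm (B * f (fst z))"
    proof (rule AE_I2)
      fix z assume "z \<in> space (?g \<Otimes>\<^sub>M ?u)"
      then have "snd z \<in> S"
        by (auto simp: space_pair_measure space_uniform_count_measure)
      from B[OF this] show "norm (\<phi> (snd z) * f (fst z)) \<le> norm (B * f (fst z))"
        by (simp add: abs_mult mult_right_mono)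
    qed
  qed
  have "(\<integral>z. \<phi> (snd z) * f (fst z) \<partial>(?g \<Otimes>\<^sub>M ?u)) = (\<integral>e. (\<integral>x. \<phi> x * f e \<partial>?u) \<partial>?g)"
    using gu.integral_fst'[OF int] by simp
  also have "\<dots> = (\<integral>e. (\<Sum>x\<in>S. \<phi> x) / card S * f e \<partial>?g)"
    using S by (simp add: integral_uniform_count_measure sum_distrib_right)
  finally show "(\<integral>z. \<phi> (snd z) * f (fst z) \<partial>(?g \<Otimes>\<^sub>M ?u)) = (\<Sum>x\<in>S. \<phi> x) / card S * (\<integral>e. f e \<partial>?g)"
    by simp
qed

lemma integral_obs_dist:
  fixes \<theta> :: "complex mat"
  assumes S: "finite S" "S \<noteq> {}" and \<sigma>: "0 \<le> \<sigma>"
  defines "\<tau> x \<equiv> Re (mat_trace (x * \<theta>))"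
  shows "integrable (obs_dist S \<sigma> \<theta>) (\<lambda>z. fst z * \<kappa> (snd z))" (is ?i1)
    and "(\<integral>z. fst z * \<kappa> (snd z) \<partial>obs_dist S \<sigma> \<theta>) = (\<Sum>x\<in>S. \<tau> x * \<kappa> x) / card S" (is ?e1)
    and "integrable (obs_dist S \<sigma> \<theta>) (\<lambda>z. (fst z)\<^sup>2)" (is ?i2)
    and "(\<integral>z. (fst z)\<^sup>2 \<partial>obs_dist S \<sigma> \<theta>) = (\<Sum>x\<in>S. (\<tau> x)\<^sup>2) / card S + \<sigma>\<^sup>2" (is ?e2)
proof -
  let ?Q = "centred_gaussian \<sigma> \<Otimes>\<^sub>M uniform_count_measure S"
  interpret g: prob_space "centred_gaussian \<sigma>"
    using \<sigma> by (rule prob_space_centred_gaussian)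
  note mom = centred_gaussian_moments[OF \<sigma>]
  have c1: "integrable (centred_gaussian \<sigma>) (\<lambda>_. 1::real)"
    by simp
  note I0 = integral_noise_design[OF S \<sigma> c1] and I1 = integral_noise_design[OF S \<sigma> mom(1)]
    and I2 = integral_noise_design[OF S \<sigma> mom(3)]
  have m1: "(\<lambda>z. fst z * \<kappa> (snd z)) \<in> borel_measurable (obs_space S)"
    unfolding obs_space_def by (intro borel_measurable_times measurable_fst measurable_snd_obs)
  have m2: "(\<lambda>z. (fst z)\<^sup>2) \<in> borel_measurable (obs_space S)"
    unfolding obs_space_def by measurable
  have e1: "(\<tau> (snd z) + fst z) * \<kappa> (snd z) = (\<tau> (snd z) * \<kappa> (snd z)) * 1 + \<kappa> (snd z) * fst z" for z
    by (simp add: algebra_simps)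
  have e2: "(\<tau> (snd z) + fst z)\<^sup>2 = (\<tau> (snd z))\<^sup>2 * 1 + 2 * \<tau> (snd z) * fst z + 1 * (fst z)\<^sup>2" for z
    by (simp add: power2_eq_square algebra_simps)
  have i1: "integrable ?Q (\<lambda>z. (\<tau> (snd z) + fst z) * \<kappa> (snd z))"
    unfolding e1 by (intro Bochner_Integration.integrable_add I0(1)[of "\<lambda>x. \<tau> x * \<kappa> x"] I1(1))
  have i2: "integrable ?Q (\<lambda>z. (\<tau> (snd z) + fst z)\<^sup>2)"
    unfolding e2 by (intro Bochner_Integration.integrable_add I0(1)[of "\<lambda>x. (\<tau> x)\<^sup>2"]
        I1(1)[of "\<lambda>x. 2 * \<tau> x"] I2(1)[of "\<lambda>_. 1"])
  show ?i1
    unfolding obs_dist_def using i1 by (subst integrable_distr_eq[OF measurable_obs_map m1]) (simp add: \<tau>_def)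
  show ?i2
    unfolding obs_dist_def using i2 by (subst integrable_distr_eq[OF measurable_obs_map m2]) (simp add: \<tau>_def)
  have "(\<integral>z. fst z * \<kappa> (snd z) \<partial>obs_dist S \<sigma> \<theta>) = (\<integral>z. (\<tau> (snd z) + fst z) * \<kappa> (snd z) \<partial>?Q)"
    unfolding obs_dist_def by (subst integral_distr[OF measurable_obs_map m1]) (simp add: \<tau>_def)
  also have "\<dots> = (\<Sum>x\<in>S. \<tau> x * \<kappa> x) / card S * 1 + (\<Sum>x\<in>S. \<kappa> x) / card S * 0"
    unfolding e1 Bochner_Integration.integral_add[OF I0(1)[of "\<lambda>x. \<tau> x * \<kappa> x"] I1(1)[of \<kappa>]]
    unfolding I0(2)[of "\<lambda>x. \<tau> x * \<kappa> x"] I1(2) mom(2) by (simp add: g.prob_space[unfolded space_centred_gaussian])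
  finally show ?e1
    by simp
  have "(\<integral>z. (fst z)\<^sup>2 \<partial>obs_dist S \<sigma> \<theta>) = (\<integral>z. (\<tau> (snd z) + fst z)\<^sup>2 \<partial>?Q)"
    unfolding obs_dist_def by (subst integral_distr[OF measurable_obs_map m2]) (simp add: \<tau>_def)
  also have "\<dots> = (\<Sum>x\<in>S. (\<tau> x)\<^sup>2) / card S * 1 + (\<Sum>x\<in>S. 2 * \<tau> x) / card S * 0 + (\<Sum>x\<in>S. 1) / card S * \<sigma>\<^sup>2"
    unfolding e2 Bochner_Integration.integral_add[OF Bochner_Integration.integrable_add[OF I0(1)[of "\<lambda>x. (\<tau> x)\<^sup>2"]
        I1(1)[of "\<lambda>x. 2 * \<tau> x"]] I2(1)[of "\<lambda>_. 1"]]
      Bochner_Integration.integral_add[OF I0(1)[of "\<lambda>x. (\<tau> x)\<^sup>2"] I1(1)[of "\<lambda>x. 2 * \<tau> x"]]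
    unfolding I0(2)[of "\<lambda>x. (\<tau> x)\<^sup>2"] I1(2)[of "\<lambda>x. 2 * \<tau> x"] I2(2)[of "\<lambda>_. 1"] mom(2,4)
    by (simp add: g.prob_space[unfolded space_centred_gaussian])
  finally show ?e2
    using S by simp
qed

section \<open>Deviation of the sample mean\<close>

lemma Im_trace_hermitian_mult:
  assumes A: "A \<in> hermitian_mats d" and B: "B \<in> hermitian_mats d"
  shows "Im (mat_trace (A * B)) = 0"
proof -
  have t: "mat_trace (A * B) = (\<Sum>i<d. \<Sum>j<d. A $$ (i, j) * B $$ (j, i))"
    by (rule mat_trace_mult[OF hermitian_matsD(1)[OF A] hermitian_matsD(1)[OF B]])
  have "cnj (mat_trace (A * B)) = (\<Sum>i<d. \<Sum>j<d. A $$ (j, i) * B $$ (i, j))"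
    unfolding t cnj_sum
  proof (intro sum.cong refl)
    fix i j assume "i \<in> {..<d}" "j \<in> {..<d}"
    then show "cnj (A $$ (i, j) * B $$ (j, i)) = A $$ (j, i) * B $$ (i, j)"
      using hermitian_matsD(3)[OF A, of j i] hermitian_matsD(3)[OF B, of i j] by simp
  qed
  also have "\<dots> = mat_trace (A * B)"
    unfolding t by (rule sum.swap)
  finally show ?thesis
    by (simp add: complex_eq_iff)
qed

lemma schatten_norm_triangle_diff:
  assumes A: "A \<in> hermitian_mats n" and B: "B \<in> hermitian_mats n" and q: "even q" "q > 0"
  shows "schatten_norm q (A - B) \<le> schatten_norm q A + schatten_norm q B"
proof -
  let ?B = "complex_of_real (- 1) \<cdot>\<^sub>m B"
  have B': "?B \<in> hermitian_mats n"
    using B by (rule hermitian_mats_smult)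
  have "A - B = A + ?B"
    using hermitian_matsD(1)[OF A] hermitian_matsD(1)[OF B] by (intro eq_matI) auto
  then show ?thesis
    using schatten_norm_triangle[OF A B' q] schatten_norm_smult[OF hermitian_matsD(1)[OF B] q, of "- 1"] by simp
qed

lemma hermitian_onbD:
  assumes "hermitian_onb d E"
  shows "i < d\<^sup>2 \<Longrightarrow> E i \<in> hermitian_mats d"
    "i < d\<^sup>2 \<Longrightarrow> j < d\<^sup>2 \<Longrightarrow> mat_trace (E i * E j) = (if i = j then 1 else 0)"
proof -
  show 1: "E i \<in> hermitian_mats d" if "i < d\<^sup>2" for i
    using assms that by (simp add: hermitian_onb_def)
  have "frob_inner (E i) (E j) = (if i = j then 1 else 0)" if "i < d\<^sup>2" "j < d\<^sup>2" for i j
    using assms that by (simp add: hermitian_onb_def)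
  note frob = this[unfolded frob_inner_def]
  show "mat_trace (E i * E j) = (if i = j then 1 else 0)" if "i < d\<^sup>2" "j < d\<^sup>2"
    using frob[OF that] unfolding hermitian_matsD(2)[OF 1[OF that(1)]] .
qed

text \<open>The spanning condition provides some coefficients; orthonormality identifies them as the traces.\<close>

lemma hermitian_onb_expansion:
  assumes onb: "hermitian_onb d E" and A: "A \<in> carrier_mat d d" and rs: "r < d" "s < d"
  shows "A $$ (r, s) = (\<Sum>i<d\<^sup>2. mat_trace (E i * A) * E i $$ (r, s))"
proof -
  note H = hermitian_onbD(1)[OF onb] and O = hermitian_onbD(2)[OF onb]
  have "\<forall>A \<in> carrier_mat d d. \<exists>c :: nat \<Rightarrow> complex. \<forall>r<d. \<forall>s<d. A $$ (r, s) = (\<Sum>i<d\<^sup>2. c i * E i $$ (r, s))"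
    using onb unfolding hermitian_onb_def by (elim conjE)
  from bspec[OF this A] obtain c where c': "\<forall>r<d. \<forall>s<d. A $$ (r, s) = (\<Sum>i<d\<^sup>2. c i * E i $$ (r, s))"
    by (elim exE)
  have c: "A $$ (r, s) = (\<Sum>i<d\<^sup>2. c i * E i $$ (r, s))" if "r < d" "s < d" for r s
    using c' that by (simp only:)
  have "mat_trace (E j * A) = c j" if j: "j < d\<^sup>2" for j
  proof -
    have "mat_trace (E j * A) = (\<Sum>r<d. \<Sum>s<d. \<Sum>i<d\<^sup>2. c i * (E j $$ (r, s) * E i $$ (s, r)))"
      unfolding mat_trace_mult[OF hermitian_matsD(1)[OF H[OF j]] A]
    proof (intro sum.cong refl)
      fix r s assume "r \<in> {..<d}" "s \<in> {..<d}"
      then have "A $$ (s, r) = (\<Sum>i<d\<^sup>2. c i * E i $$ (s, r))"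
        by (intro c) auto
      then show "E j $$ (r, s) * A $$ (s, r) = (\<Sum>i<d\<^sup>2. c i * (E j $$ (r, s) * E i $$ (s, r)))"
        by (simp only: sum_distrib_left mult.left_commute)
    qed
    also have "\<dots> = (\<Sum>r<d. \<Sum>i<d\<^sup>2. \<Sum>s<d. c i * (E j $$ (r, s) * E i $$ (s, r)))"
      by (intro sum.cong refl sum.swap)
    also have "\<dots> = (\<Sum>i<d\<^sup>2. \<Sum>r<d. \<Sum>s<d. c i * (E j $$ (r, s) * E i $$ (s, r)))"
      by (rule sum.swap)
    also have "\<dots> = (\<Sum>i<d\<^sup>2. c i * mat_trace (E j * E i))"
    proof (intro sum.cong refl)
      fix i assume "i \<in> {..<d\<^sup>2}"
      then have i: "i < d\<^sup>2"
        by simp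
      show "(\<Sum>r<d. \<Sum>s<d. c i * (E j $$ (r, s) * E i $$ (s, r))) = c i * mat_trace (E j * E i)"
        unfolding mat_trace_mult[OF hermitian_matsD(1)[OF H[OF j]] hermitian_matsD(1)[OF H[OF i]]] sum_distrib_left ..
    qed
    also have "\<dots> = (\<Sum>i<d\<^sup>2. if i = j then c j else 0)"
    proof (intro sum.cong refl)
      fix i assume "i \<in> {..<d\<^sup>2}"
      then show "c i * mat_trace (E j * E i) = (if i = j then c j else 0)"
        using O[OF j, of i] by (cases "i = j") (simp_all del: assoc_mult_mat)
    qed
    finally show ?thesis
      using j by simp
  qed
  then show ?thesis
    unfolding c[OF rs] by (intro sum.cong refl) (simp only: lessThan_iff)
qed

lemma hermitian_onb_Parseval:
  assumes onb: "hermitian_onb d E" and A: "A \<in> carrier_mat d d" and B: "B \<in> carrier_mat d d"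
  shows "mat_trace (A * B) = (\<Sum>i<d\<^sup>2. mat_trace (E i * A) * mat_trace (E i * B))"
proof -
  note H = hermitian_onbD(1)[OF onb]
  let ?a = "\<lambda>i. mat_trace (E i * A)"
  have "mat_trace (A * B) = (\<Sum>r<d. \<Sum>s<d. \<Sum>i<d\<^sup>2. ?a i * (E i $$ (r, s) * B $$ (s, r)))"
    unfolding mat_trace_mult[OF A B]
  proof (intro sum.cong refl)
    fix r s assume "r \<in> {..<d}" "s \<in> {..<d}"
    then have "A $$ (r, s) = (\<Sum>i<d\<^sup>2. ?a i * E i $$ (r, s))"
      by (intro hermitian_onb_expansion[OF onb A]) auto
    then show "A $$ (r, s) * B $$ (s, r) = (\<Sum>i<d\<^sup>2. ?a i * (E i $$ (r, s) * B $$ (s, r)))"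
      by (simp only: sum_distrib_right mult.assoc)
  qed
  also have "\<dots> = (\<Sum>r<d. \<Sum>i<d\<^sup>2. \<Sum>s<d. ?a i * (E i $$ (r, s) * B $$ (s, r)))"
    by (intro sum.cong refl sum.swap)
  also have "\<dots> = (\<Sum>i<d\<^sup>2. \<Sum>r<d. \<Sum>s<d. ?a i * (E i $$ (r, s) * B $$ (s, r)))"
    by (rule sum.swap)
  also have "\<dots> = (\<Sum>i<d\<^sup>2. ?a i * mat_trace (E i * B))"
  proof (intro sum.cong refl)
    fix i assume "i \<in> {..<d\<^sup>2}"
    then have i: "i < d\<^sup>2"
      by simp
    show "(\<Sum>r<d. \<Sum>s<d. ?a i * (E i $$ (r, s) * B $$ (s, r))) = ?a i * mat_trace (E i * B)"
      unfolding mat_trace_mult[OF hermitian_matsD(1)[OF H[OF i]] B] sum_distrib_left ..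
  qed
  finally show ?thesis .
qed

lemma design_set_sum:
  assumes onb: "hermitian_onb d E" and d: "d > 0"
  shows "sum f (design_set d E) = (\<Sum>i<d\<^sup>2. f (of_nat d \<cdot>\<^sub>m E i))" "card (design_set d E) = d\<^sup>2"
proof -
  note H = hermitian_onbD(1)[OF onb] and O = hermitian_onbD(2)[OF onb]
  have inj: "inj_on (\<lambda>i. of_nat d \<cdot>\<^sub>m E i) {..<d\<^sup>2}"
  proof (rule inj_onI)
    fix i j assume ij: "i \<in> {..<d\<^sup>2}" "j \<in> {..<d\<^sup>2}" and eq: "of_nat d \<cdot>\<^sub>m E i = of_nat d \<cdot>\<^sub>m E j"
    then have c: "E i \<in> carrier_mat d d" "E j \<in> carrier_mat d d"
      using hermitian_matsD(1)[OF H] by auto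
    have "E i = E j"
    proof (rule eq_matI)
      fix r s assume rs: "r < dim_row (E j)" "s < dim_col (E j)"
      then have "(of_nat d \<cdot>\<^sub>m E i) $$ (r, s) = of_nat d * E i $$ (r, s)"
        "(of_nat d \<cdot>\<^sub>m E j) $$ (r, s) = of_nat d * E j $$ (r, s)"
        using c by auto
      then show "E i $$ (r, s) = E j $$ (r, s)"
        using eq d by simp
    qed (use c in auto)
    then show "i = j"
      using O[of i j] O[of i i] ij by (auto split: if_splits)
  qed
  then show "sum f (design_set d E) = (\<Sum>i<d\<^sup>2. f (of_nat d \<cdot>\<^sub>m E i))" "card (design_set d E) = d\<^sup>2"
    by (auto simp: design_set_def sum.reindex card_image)
qed

text \<open>The sample mean is unbiased. The design matrices carry a factor \<open>d\<close> each, and averaging over \<open>d\<^sup>2\<close> of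
  them turns Parseval's identity into the value of the linear functional \<open>G\<close> at \<open>\<theta>\<close>.\<close>

lemma design_set_average:
  assumes onb: "hermitian_onb d E" and d: "d > 0" and \<theta>: "\<theta> \<in> hermitian_mats d" and G: "G \<in> hermitian_mats d"
  shows "(\<Sum>x\<in>design_set d E. Re (mat_trace (x * \<theta>)) * Re (mat_trace (G * x))) / card (design_set d E) =
    Re (mat_trace (G * \<theta>))"
proof -
  note H = hermitian_onbD(1)[OF onb]
  have summand: "Re (mat_trace ((of_nat d \<cdot>\<^sub>m E i) * \<theta>)) * Re (mat_trace (G * (of_nat d \<cdot>\<^sub>m E i))) =
      (real d)\<^sup>2 * Re (mat_trace (E i * G) * mat_trace (E i * \<theta>))" if i: "i < d\<^sup>2" for i
  proof -
    note Ei = H[OF i]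
    note c = hermitian_matsD(1)[OF Ei] hermitian_matsD(1)[OF \<theta>] hermitian_matsD(1)[OF G]
    have "mat_trace ((of_nat d \<cdot>\<^sub>m E i) * \<theta>) = of_nat d * mat_trace (E i * \<theta>)"
      unfolding mult_smult_assoc_mat[OF c(1,2)] by (rule mat_trace_smult[OF mult_carrier_mat[OF c(1,2)]])
    moreover have "mat_trace (G * (of_nat d \<cdot>\<^sub>m E i)) = of_nat d * mat_trace (E i * G)"
      unfolding mult_smult_distrib[OF c(3,1)] mat_trace_smult[OF mult_carrier_mat[OF c(3,1)]]
      by (simp only: mat_trace_mult_commute[OF c(3,1)])
    ultimately show ?thesis
      using Im_trace_hermitian_mult[OF Ei \<theta>] Im_trace_hermitian_mult[OF Ei G] by (simp add: power2_eq_square)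
  qed
  have "(\<Sum>x\<in>design_set d E. Re (mat_trace (x * \<theta>)) * Re (mat_trace (G * x))) =
      (\<Sum>i<d\<^sup>2. (real d)\<^sup>2 * Re (mat_trace (E i * G) * mat_trace (E i * \<theta>)))"
    unfolding design_set_sum(1)[OF onb d] using summand by (intro sum.cong) auto
  also have "\<dots> = (real d)\<^sup>2 * Re (mat_trace (G * \<theta>))"
    unfolding hermitian_onb_Parseval[OF onb hermitian_matsD(1)[OF G] hermitian_matsD(1)[OF \<theta>]]
    by (simp only: Re_sum sum_distrib_left)
  finally show ?thesis
    using d by (simp add: design_set_sum(2)[OF onb d])
qed

definition sample_mean :: "nat \<Rightarrow> nat \<Rightarrow> (nat \<Rightarrow> real \<times> complex mat) \<Rightarrow> complex mat" where
  "sample_mean d n \<omega> = Matrix.mat d d (\<lambda>(i, j). (\<Sum>l<n. of_real (fst (\<omega> l)) * snd (\<omega> l) $$ (i, j)) / of_nat n)"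

lemma sample_mean_carrier [simp]: "sample_mean d n \<omega> \<in> carrier_mat d d"
  by (simp add: sample_mean_def)

lemma sample_mean_restrict: "n \<le> N \<Longrightarrow> sample_mean d n (restrict \<omega> {..<N}) = sample_mean d n \<omega>"
  by (auto simp: sample_mean_def intro!: eq_matI sum.cong)

lemma measurable_sample_mean:
  assumes "n \<le> N"
  shows "measurable_mat (sample_space S N) d (sample_mean d n)"
  unfolding measurable_mat_def
proof (intro conjI ballI allI impI)
  fix i j assume ij: "i < d" "j < d"
  have "(\<lambda>\<omega>. of_real (fst (\<omega> l)) * snd (\<omega> l) $$ (i, j)) \<in> borel_measurable (sample_space S N)" if l: "l < n" for l
  proof -
    have l': "(\<lambda>\<omega>. \<omega> l) \<in> sample_space S N \<rightarrow>\<^sub>M borel \<Otimes>\<^sub>M count_space S"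
      unfolding sample_space_def obs_space_def using l assms by (intro measurable_component_singleton) auto
    have "(\<lambda>z. complex_of_real (fst z) * snd z $$ (i, j)) \<in> borel_measurable (borel \<Otimes>\<^sub>M count_space S)"
      by (intro borel_measurable_times measurable_snd_obs[of "\<lambda>x. x $$ (i, j)"]) measurable
    from measurable_compose[OF l' this] show ?thesis .
  qed
  then have "(\<lambda>\<omega>. (\<Sum>l<n. of_real (fst (\<omega> l)) * snd (\<omega> l) $$ (i, j)) / of_nat n) \<in> borel_measurable (sample_space S N)"
    by (intro borel_measurable_divide borel_measurable_sum) auto
  then show "(\<lambda>\<omega>. sample_mean d n \<omega> $$ (i, j)) \<in> borel_measurable (sample_space S N)"
    using ij by (simp add: sample_mean_def)
qed simp

text \<open>The squared norm of \<open>Y X\<close> is \<open>Y\<^sup>2\<close> times that of \<open>X\<close>. The latter is at most a multiple of \<open>d\<close> for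
  every design matrix, and \<open>Y\<^sup>2\<close> has mean at most \<open>1 + v\<close>, because by Parseval's identity the mean square of
  the signal is the squared Frobenius norm of \<open>\<theta>\<close>, which is at most one.\<close>

theorem sample_mean_deviation:
  assumes onb: "hermitian_onb d E" and d: "d > 0" and K: "0 \<le> K"
    and op: "\<And>i. i < d\<^sup>2 \<Longrightarrow> op_norm (E i) \<le> K / sqrt (real d)"
    and \<sigma>: "0 \<le> \<sigma>" "\<sigma>\<^sup>2 \<le> v" and \<theta>: "\<theta> \<in> density_mats d" and q: "q = 2 ^ Suc m" and n: "n > 0" and u: "u > 0"
  shows "measure (obs_law (design_set d E) \<sigma> \<theta>)
      {\<omega> \<in> space (obs_law (design_set d E) \<sigma> \<theta>). u < schatten_norm q (sample_mean d n \<omega> - \<theta>)}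
    \<le> 4 * real q * ((1 + v) * (root q d * K)\<^sup>2 * real d + 1) / (real n * u\<^sup>2)"
proof -
  let ?S = "design_set d E"
  let ?\<nu> = "obs_dist ?S \<sigma> \<theta>" and ?N = "schatten_norm q"
  define L where "L = (root q d * K)\<^sup>2 * real d"
  have L0: "L \<ge> 0"
    by (simp add: L_def)
  note H = hermitian_onbD(1)[OF onb] and \<theta>D = density_matsD[OF \<theta>]
  note \<theta>c = hermitian_matsD(1)[OF \<theta>D(1)]
  have q': "even q" "q > 0"
    using q by auto
  have S: "finite ?S" "?S \<noteq> {}"
    using d by (auto simp: design_set_def lessThan_empty_iff)
  have X: "x \<in> hermitian_mats d" if "x \<in> ?S" for x
    using that hermitian_mats_smult[OF H, of _ "real d"] by (auto simp: design_set_def)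
  have NX: "(?N x)\<^sup>2 \<le> L" if x: "x \<in> ?S" for x
  proof -
    obtain i where i: "i < d\<^sup>2" "x = complex_of_real (real d) \<cdot>\<^sub>m E i"
      using x by (auto simp: design_set_def)
    have "?N x = real d * ?N (E i)"
      using schatten_norm_smult[OF hermitian_matsD(1)[OF H[OF i(1)]] q', of "real d"] i by simp
    also have "\<dots> \<le> real d * (root q d * (K / sqrt (real d)))"
      using op[OF i(1)]
      by (intro mult_left_mono order.trans[OF schatten_norm_le_op_norm[OF H[OF i(1)] d q']])
        (auto simp: real_root_ge_zero)
    also have "\<dots> = root q d * K * sqrt (real d)"
    proof -
      have "real d * (root q d * (K / sqrt (real d))) = root q d * K * (real d / sqrt (real d))"
        by simp
      then show ?thesis
        by (simp only: real_div_sqrt of_nat_0_le_iff)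
    qed
    finally have "(?N x)\<^sup>2 \<le> (root q d * K * sqrt (real d))\<^sup>2"
      using schatten_norm_nonneg[OF X[OF x] q'(1)] by (rule power_mono)
    then show ?thesis
      by (simp add: L_def power_mult_distrib)
  qed
  have \<nu>: "prob_space ?\<nu>"
    by (rule prob_space_obs_dist[OF S \<sigma>(1)])
  interpret \<nu>: prob_space ?\<nu>
    by (rule \<nu>)
  define W where "W z = complex_of_real (fst z) \<cdot>\<^sub>m snd z - \<theta>" for z :: "real \<times> complex mat"
  have W: "W z \<in> hermitian_mats d" if "z \<in> space ?\<nu>" for z
  proof -
    have "snd z \<in> design_set d E"
      using that by auto
    then show ?thesis
      unfolding W_def by (intro hermitian_mats_diff[OF hermitian_mats_smult[OF X] \<theta>D(1)])
  qed
  have Wm: "measurable_mat ?\<nu> d W"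
    unfolding measurable_mat_def
  proof (intro conjI ballI allI impI)
    show "W z \<in> carrier_mat d d" if "z \<in> space ?\<nu>" for z
      by (rule hermitian_matsD(1)[OF W[OF that]])
    fix i j assume ij: "i < d" "j < d"
    have "(\<lambda>z. complex_of_real (fst z) * snd z $$ (i, j) - \<theta> $$ (i, j)) \<in> borel_measurable (borel \<Otimes>\<^sub>M count_space ?S)"
      by (intro borel_measurable_diff borel_measurable_times measurable_snd_obs[of "\<lambda>x. x $$ (i, j)"]) measurable
    then have "(\<lambda>z. complex_of_real (fst z) * snd z $$ (i, j) - \<theta> $$ (i, j)) \<in> borel_measurable ?\<nu>"
      by (simp add: obs_space_def cong: measurable_cong_sets)
    then show "(\<lambda>z. W z $$ (i, j)) \<in> borel_measurable ?\<nu>"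
    proof (rule measurable_cong[THEN iffD1, rotated])
      fix z assume "z \<in> space ?\<nu>"
      then have "snd z \<in> carrier_mat d d"
        using X hermitian_matsD(1) by auto
      then show "complex_of_real (fst z) * snd z $$ (i, j) - \<theta> $$ (i, j) = W z $$ (i, j)"
        using \<theta>c ij by (simp add: W_def)
    qed
  qed
  have N\<theta>: "?N \<theta> \<le> 1"
    using schatten_norm_le_frob_norm[OF \<theta>D(1) q'] frob_norm_density_le_1[OF \<theta>] by simp
  have NW: "(?N (W z))\<^sup>2 \<le> 2 * L * (fst z)\<^sup>2 + 2" if z: "z \<in> space ?\<nu>" for z
  proof -
    have x: "snd z \<in> ?S"
      using z by auto
    have "?N (W z) \<le> ?N (complex_of_real (fst z) \<cdot>\<^sub>m snd z) + ?N \<theta>"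
      unfolding W_def by (rule schatten_norm_triangle_diff[OF hermitian_mats_smult[OF X[OF x]] \<theta>D(1) q'])
    also have "\<dots> \<le> \<bar>fst z\<bar> * ?N (snd z) + 1"
      using N\<theta> schatten_norm_smult[OF hermitian_matsD(1)[OF X[OF x]] q'] by simp
    finally have "(?N (W z))\<^sup>2 \<le> (\<bar>fst z\<bar> * ?N (snd z) + 1)\<^sup>2"
      using schatten_norm_nonneg[OF W[OF z] q'(1)] by (rule power_mono)
    also have "\<dots> \<le> 2 * (\<bar>fst z\<bar> * ?N (snd z))\<^sup>2 + 2"
      using sum_squares_bound[of "\<bar>fst z\<bar> * ?N (snd z)" 1] by (simp add: power2_sum)
    also have "(\<bar>fst z\<bar> * ?N (snd z))\<^sup>2 \<le> L * (fst z)\<^sup>2"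
      using mult_left_mono[OF NX[OF x], of "(fst z)\<^sup>2"] by (simp add: power_mult_distrib mult.commute)
    finally show ?thesis
      by simp
  qed
  note I = integral_obs_dist[OF S \<sigma>(1), of \<theta>]
  have int: "integrable ?\<nu> (\<lambda>z. 2 * L * (fst z)\<^sup>2 + 2)"
    by (intro Bochner_Integration.integrable_add integrable_mult_right I(3) \<nu>.integrable_const)
  have intW: "integrable ?\<nu> (\<lambda>z. (?N (W z))\<^sup>2)"
  proof (rule Bochner_Integration.integrable_bound[OF int])
    show "(\<lambda>z. (?N (W z))\<^sup>2) \<in> borel_measurable ?\<nu>"
      by (intro borel_measurable_power borel_measurable_schatten_norm[OF Wm])
    show "AE z in ?\<nu>. norm ((?N (W z))\<^sup>2) \<le> norm (2 * L * (fst z)\<^sup>2 + 2)"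
      using NW L0 by (intro AE_I2) simp
  qed
  have Y2: "(\<integral>z. (fst z)\<^sup>2 \<partial>?\<nu>) \<le> 1 + v"
  proof -
    have "(\<Sum>x\<in>?S. (Re (mat_trace (x * \<theta>)))\<^sup>2) / card ?S = Re (mat_trace (\<theta> * \<theta>))"
    proof -
      have "(\<Sum>x\<in>?S. (Re (mat_trace (x * \<theta>)))\<^sup>2) = (\<Sum>x\<in>?S. Re (mat_trace (x * \<theta>)) * Re (mat_trace (\<theta> * x)))"
        using mat_trace_mult_commute[OF hermitian_matsD(1)[OF X] \<theta>c]
        by (intro sum.cong) (auto simp: power2_eq_square)
      then show ?thesis
        using design_set_average[OF onb d \<theta>D(1) \<theta>D(1)] by simp
    qed
    also have "\<dots> = (frob_norm \<theta>)\<^sup>2"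
      using schatten_norm_pow[OF \<theta>D(1), of 2] trace_pow_2[OF \<theta>c] by (simp add: frob_norm_eq_schatten_norm[OF \<theta>D(1)])
    also have "\<dots> \<le> 1\<^sup>2"
      using frob_norm_density_le_1[OF \<theta>] schatten_norm_nonneg[OF \<theta>D(1), of 2]
      by (intro power_mono) (auto simp: frob_norm_eq_schatten_norm[OF \<theta>D(1)])
    finally show ?thesis
      using I(4) \<sigma>(2) by simp
  qed
  have B: "(\<integral>z. (?N (W z))\<^sup>2 \<partial>?\<nu>) \<le> 2 * ((1 + v) * L + 1)"
  proof -
    have "(\<integral>z. (?N (W z))\<^sup>2 \<partial>?\<nu>) \<le> (\<integral>z. 2 * L * (fst z)\<^sup>2 + 2 \<partial>?\<nu>)"
      by (intro integral_mono intW int NW)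
    also have "\<dots> = 2 * L * (\<integral>z. (fst z)\<^sup>2 \<partial>?\<nu>) + 2"
      using Bochner_Integration.integral_add[OF integrable_mult_right[OF I(3), of "2 * L"] \<nu>.integrable_const[of 2]]
        \<nu>.prob_space by simp
    also have "\<dots> \<le> 2 * L * (1 + v) + 2"
      using Y2 L0 by (intro add_right_mono mult_left_mono) auto
    finally show ?thesis
      by (simp add: algebra_simps)
  qed
  have lin: "Re (mat_trace (G * W z)) = fst z * Re (mat_trace (G * snd z)) - Re (mat_trace (G * \<theta>))"
    if G: "G \<in> hermitian_mats d" and z: "z \<in> space ?\<nu>" for G z
  proof -
    note c = hermitian_matsD(1)[OF G]
    have x: "snd z \<in> carrier_mat d d"
      using z X hermitian_matsD(1) by auto
    have "G * W z = complex_of_real (fst z) \<cdot>\<^sub>m (G * snd z) - G * \<theta>"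
      unfolding W_def mult_minus_distrib_mat[OF c smult_carrier_mat[OF x] \<theta>c] mult_smult_distrib[OF c x] ..
    then show ?thesis
      using mat_trace_diff[OF smult_carrier_mat[OF mult_carrier_mat[OF c x]] mult_carrier_mat[OF c \<theta>c], of "complex_of_real (fst z)"]
        mat_trace_smult[OF mult_carrier_mat[OF c x], of "complex_of_real (fst z)"] by simp
  qed
  have lin_int: "integrable ?\<nu> (\<lambda>z. fst z * Re (mat_trace (G * snd z)) - Re (mat_trace (G * \<theta>)))" for G
    by (intro Bochner_Integration.integrable_diff I(1)[of "\<lambda>x. Re (mat_trace (G * x))"] \<nu>.integrable_const)
  have intl: "integrable ?\<nu> (\<lambda>z. Re (mat_trace (G * W z)))" if G: "G \<in> hermitian_mats d" for G
    using lin_int[of G] lin[OF G] by (subst Bochner_Integration.integrable_cong[OF refl]) auto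
  have centred: "(\<integral>z. Re (mat_trace (G * W z)) \<partial>?\<nu>) = 0" if G: "G \<in> hermitian_mats d" for G
  proof -
    have "(\<integral>z. Re (mat_trace (G * W z)) \<partial>?\<nu>) = (\<integral>z. fst z * Re (mat_trace (G * snd z)) - Re (mat_trace (G * \<theta>)) \<partial>?\<nu>)"
      using lin[OF G] by (intro Bochner_Integration.integral_cong) auto
    also have "\<dots> = (\<integral>z. fst z * Re (mat_trace (G * snd z)) \<partial>?\<nu>) - Re (mat_trace (G * \<theta>))"
      using Bochner_Integration.integral_diff[OF I(1)[of "\<lambda>x. Re (mat_trace (G * x))"] \<nu>.integrable_const] \<nu>.prob_space by simp
    also have "\<dots> = 0"
      using I(2)[of "\<lambda>x. Re (mat_trace (G * x))"] design_set_average[OF onb d \<theta>D(1) G] by simp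
    finally show ?thesis .
  qed
  let ?P = "PiM {..<n} (\<lambda>_. ?\<nu>)"
  let ?T = "\<lambda>\<omega>. mat_sum d (\<lambda>l. W (\<omega> l)) n"
  note T2 = schatten_norm_type_2[OF \<nu> Wm W q intW intl centred, of n]
  have P: "prob_space ?P"
    by (intro prob_space_PiM \<nu>)
  have setsP: "sets ?P = sets (sample_space ?S n)"
    unfolding sample_space_def by (intro sets_PiM_cong) auto
  have T: "?N (?T \<omega>) = real n * ?N (sample_mean d n \<omega> - \<theta>)" "sample_mean d n \<omega> - \<theta> \<in> hermitian_mats d"
    if \<omega>: "\<omega> \<in> space ?P" for \<omega>
  proof -
    have x: "snd (\<omega> l) \<in> carrier_mat d d" and Wl: "W (\<omega> l) \<in> hermitian_mats d" if "l < n" for l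
      using \<omega> that X W hermitian_matsD(1) by (auto simp: space_PiM PiE_iff mem_Times_iff)
    have "(1 / of_nat n) * ?T \<omega> $$ (i, j) = (sample_mean d n \<omega> - \<theta>) $$ (i, j)" if ij: "i < d" "j < d" for i j
    proof -
      have "?T \<omega> $$ (i, j) = (\<Sum>l<n. of_real (fst (\<omega> l)) * snd (\<omega> l) $$ (i, j) - \<theta> $$ (i, j))"
      proof -
        have "W (\<omega> l) $$ (i, j) = of_real (fst (\<omega> l)) * snd (\<omega> l) $$ (i, j) - \<theta> $$ (i, j)" if "l < n" for l
          using carrier_matD[OF x[OF that]] carrier_matD[OF \<theta>c] ij by (simp add: W_def)
        then show ?thesis
          using ij by (simp add: mat_sum_def)
      qed
      then show ?thesis
        using ij \<theta>c n by (simp add: sample_mean_def sum_subtractf diff_divide_distrib)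
    qed
    then have eq: "sample_mean d n \<omega> - \<theta> = complex_of_real (1 / real n) \<cdot>\<^sub>m ?T \<omega>"
      using \<theta>c carrier_matD[OF mat_sum_carrier[of d "\<lambda>l. W (\<omega> l)" n]] by (intro eq_matI) auto
    show "?N (?T \<omega>) = real n * ?N (sample_mean d n \<omega> - \<theta>)"
      unfolding eq schatten_norm_smult[OF mat_sum_carrier q'] using n by simp
    show "sample_mean d n \<omega> - \<theta> \<in> hermitian_mats d"
      unfolding eq using Wl by (intro hermitian_mats_smult hermitian_mat_sum) auto
  qed
  define A where "A = {\<omega> \<in> space ?P. u < ?N (sample_mean d n \<omega> - \<theta>)}"
  have meas: "(\<lambda>\<omega>. ?N (sample_mean d n \<omega> - \<theta>)) \<in> borel_measurable (sample_space ?S n)"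
    by (intro borel_measurable_schatten_norm[of _ d] measurable_mat_diff_const measurable_sample_mean \<theta>c) simp
  then have meas': "(\<lambda>\<omega>. ?N (sample_mean d n \<omega> - \<theta>)) \<in> borel_measurable ?P"
    by (simp add: setsP cong: measurable_cong_sets)
  have A: "A \<in> sets ?P"
    unfolding A_def using meas' by measurable
  have R: "(\<lambda>\<omega>. restrict \<omega> {..<n}) \<in> PiM UNIV (\<lambda>_. ?\<nu>) \<rightarrow>\<^sub>M ?P"
    by (intro measurable_restrict_subset) simp
  interpret pp: product_prob_space "\<lambda>_. ?\<nu>" "UNIV :: nat set"
    by (rule product_prob_spaceI) (rule \<nu>)
  have "{\<omega> \<in> space (obs_law ?S \<sigma> \<theta>). u < ?N (sample_mean d n \<omega> - \<theta>)} =
      (\<lambda>\<omega>. restrict \<omega> {..<n}) -` A \<inter> space (PiM UNIV (\<lambda>_. ?\<nu>))"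
    unfolding A_def obs_law_eq_PiM[OF S \<sigma>(1)] using measurable_space[OF R]
    by (auto simp: sample_mean_restrict)
  then have "measure (obs_law ?S \<sigma> \<theta>) {\<omega> \<in> space (obs_law ?S \<sigma> \<theta>). u < ?N (sample_mean d n \<omega> - \<theta>)} =
      measure (distr (PiM UNIV (\<lambda>_. ?\<nu>)) ?P (\<lambda>\<omega>. restrict \<omega> {..<n})) A"
    using measure_distr[OF R A] by (simp add: obs_law_eq_PiM[OF S \<sigma>(1)])
  also have "\<dots> = measure ?P A"
    by (subst pp.distr_PiM_restrict_finite) auto
  also have "\<dots> \<le> measure ?P {\<omega> \<in> space ?P. (?N (?T \<omega>))\<^sup>2 \<ge> (real n * u)\<^sup>2}"
  proof (rule finite_measure.finite_measure_mono[OF prob_space.finite_measure[OF P]])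
    show "A \<subseteq> {\<omega> \<in> space ?P. (?N (?T \<omega>))\<^sup>2 \<ge> (real n * u)\<^sup>2}"
    proof
      fix \<omega> assume "\<omega> \<in> A"
      then have \<omega>: "\<omega> \<in> space ?P" "u < ?N (sample_mean d n \<omega> - \<theta>)"
        by (auto simp: A_def)
      have "real n * u \<le> ?N (?T \<omega>)"
        unfolding T(1)[OF \<omega>(1)] using \<omega>(2) by (intro mult_left_mono) auto
      then show "\<omega> \<in> {\<omega> \<in> space ?P. (?N (?T \<omega>))\<^sup>2 \<ge> (real n * u)\<^sup>2}"
        using \<omega>(1) u by (auto intro!: power_mono)
    qed
    show "{\<omega> \<in> space ?P. (?N (?T \<omega>))\<^sup>2 \<ge> (real n * u)\<^sup>2} \<in> sets ?P"
      using borel_measurable_integrable[OF T2(1)] by measurable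
  qed
  also have "\<dots> \<le> (\<integral>\<omega>. (?N (?T \<omega>))\<^sup>2 \<partial>?P) / (real n * u)\<^sup>2"
    using n u by (intro integral_Markov_inequality_measure[OF T2(1) sets.top]) auto
  also have "\<dots> \<le> (2 * real q * real n * (2 * ((1 + v) * L + 1))) / (real n * u)\<^sup>2"
    using T2(2) B by (intro divide_right_mono order.trans[OF T2(2)] mult_left_mono) auto
  also have "\<dots> = 4 * real q * ((1 + v) * (root q d * K)\<^sup>2 * real d + 1) / (real n * u\<^sup>2)"
    using n u by (simp add: L_def power2_eq_square field_simps)
  finally show ?thesis .
qed

section \<open>The adaptive procedure\<close>

lemma density_mats_nonempty:
  assumes "d > 0"
  shows "density_mats d \<noteq> {}"
proof -
  define \<rho> where "\<rho> = Matrix.mat d d (\<lambda>(i, j). if i = 0 \<and> j = 0 then 1 else 0 :: complex)"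
  have \<rho>: "\<rho> \<in> carrier_mat d d"
    by (simp add: \<rho>_def)
  have "\<rho> \<in> hermitian_mats d"
    by (rule hermitian_matsI[OF \<rho>]) (auto simp: \<rho>_def)
  moreover have "mat_trace \<rho> = (\<Sum>i<d. if i = 0 then 1 else 0)"
    unfolding mat_trace_carrier[OF \<rho>] by (intro sum.cong) (auto simp: \<rho>_def)
  then have "mat_trace \<rho> = 1"
    using assms by simp
  moreover have "0 \<le> Re ((\<rho> *\<^sub>v x) \<bullet>c x)" if x: "x \<in> carrier_vec d" for x
  proof -
    have \<rho>x: "(\<rho> *\<^sub>v x) $ i = (if i = 0 then x $ 0 else 0)" if i: "i < d" for i
    proof -
      have "(\<rho> *\<^sub>v x) $ i = (\<Sum>j<d. \<rho> $$ (i, j) * x $ j)"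
        using i x \<rho> by (simp add: scalar_prod_def lessThan_atLeast0)
      also have "\<dots> = (\<Sum>j<d. if j = 0 then (if i = 0 then x $ 0 else 0) else 0)"
        using i by (intro sum.cong) (auto simp: \<rho>_def)
      finally show ?thesis
        using assms by simp
    qed
    have "(\<rho> *\<^sub>v x) \<bullet>c x = (\<Sum>i<d. (\<rho> *\<^sub>v x) $ i * cnj (x $ i))"
      using x by (simp add: scalar_prod_def lessThan_atLeast0)
    also have "\<dots> = (\<Sum>i<d. if i = 0 then x $ 0 * cnj (x $ 0) else 0)"
      using \<rho>x by (intro sum.cong) auto
    finally have "(\<rho> *\<^sub>v x) \<bullet>c x = x $ 0 * cnj (x $ 0)"
      using assms by simp
    then show ?thesis
      by simp
  qed
  ultimately show ?thesis
    unfolding density_mats_def by blast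
qed

text \<open>Passes from the entrywise approximation that the product topology gives to the Frobenius norm.\<close>

lemma frob_norm_le_of_entries:
  assumes A: "A \<in> carrier_mat d d" and le: "\<And>i j. i < d \<Longrightarrow> j < d \<Longrightarrow> cmod (A $$ (i, j)) \<le> e" and e: "0 \<le> e"
  shows "frob_norm A \<le> real d * e"
proof -
  have "(\<Sum>i<d. \<Sum>j<d. (cmod (A $$ (i, j)))\<^sup>2) \<le> (\<Sum>i<d. \<Sum>j<d. e\<^sup>2)"
    using le by (intro sum_mono power_mono) auto
  also have "\<dots> = (real d * e)\<^sup>2"
    by (simp add: power2_eq_square)
  finally have "sqrt (\<Sum>i<d. \<Sum>j<d. (cmod (A $$ (i, j)))\<^sup>2) \<le> sqrt ((real d * e)\<^sup>2)"
    by (rule real_sqrt_le_mono)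
  then show ?thesis
    using A e by (simp add: frob_norm_def)
qed

text \<open>The candidates are taken from a countable family, which keeps the procedure measurable. Matrices
  embed into the second countable space of complex sequences, where every set has a countable dense
  subset.\<close>

lemma density_mats_dense_sequence:
  assumes d: "d > 0"
  shows "\<exists>c :: nat \<Rightarrow> complex mat. (\<forall>i. c i \<in> density_mats d) \<and>
    (\<forall>\<theta>\<in>density_mats d. \<forall>e>0. \<exists>i. frob_norm (c i - \<theta>) < e)"
proof -
  \<comment> \<open>The entry \<open>(a, b)\<close> is found at the index \<open>a * d + b\<close>.\<close>
  define emb :: "complex mat \<Rightarrow> nat \<Rightarrow> complex" where "emb A k = A $$ (k div d, k mod d)" for A k
  obtain T where T: "countable T" "T \<subseteq> emb ` density_mats d" "emb ` density_mats d \<subseteq> closure T"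
    using separable[of "emb ` density_mats d"] by blast
  have Tne: "T \<noteq> {}"
    using T(3) density_mats_nonempty[OF d] by auto
  have "\<forall>t\<in>T. \<exists>A. A \<in> density_mats d \<and> emb A = t"
    using T(2) by blast
  then obtain r where r: "\<And>t. t \<in> T \<Longrightarrow> r t \<in> density_mats d" "\<And>t. t \<in> T \<Longrightarrow> emb (r t) = t"
    by metis
  define c where "c i = r (from_nat_into T i)" for i
  have cT: "from_nat_into T i \<in> T" for i
    using Tne by (rule from_nat_into)
  show ?thesis
  proof (intro exI[of _ c] conjI allI ballI impI)
    show "c i \<in> density_mats d" for i
      unfolding c_def by (rule r(1)[OF cT])
    fix \<theta> and e :: real assume \<theta>: "\<theta> \<in> density_mats d" and e: "e > 0"
    define V where "V = (\<Inter>k<d * d. {f :: nat \<Rightarrow> complex. dist (f k) (emb \<theta> k) < e / (2 * real d)})"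
    have "open V"
      unfolding V_def
      by (intro open_INT ballI open_Collect_less continuous_on_dist continuous_on_product_coordinates continuous_on_const) auto
    moreover have "emb \<theta> \<in> V"
      using e d by (simp add: V_def)
    moreover have "emb \<theta> \<in> closure T"
      using T(3) \<theta> by blast
    ultimately obtain t where t: "t \<in> T" "t \<in> V"
      using open_Int_closure_eq_empty[of V T] by blast
    obtain i where i: "from_nat_into T i = t"
      using from_nat_into_surj[OF T(1) t(1)] by blast
    have "cmod ((c i - \<theta>) $$ (a, b)) \<le> e / (2 * real d)" if ab: "a < d" "b < d" for a b
    proof -
      have k: "a * d + b < d * d"
      proof -
        have "a * d + b < a * d + d"
          using ab by simp
        also have "\<dots> \<le> d * d"
          using ab mult_le_mono1[of "Suc a" d d] by simp
        finally show ?thesis .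
      qed
      have emb: "emb A (a * d + b) = A $$ (a, b)" for A
        using ab by (simp add: emb_def)
      have "dist (t (a * d + b)) (emb \<theta> (a * d + b)) < e / (2 * real d)"
        using t(2) k by (simp add: V_def)
      then have "cmod (r t $$ (a, b) - \<theta> $$ (a, b)) < e / (2 * real d)"
        using r(2)[OF t(1)] by (metis dist_norm emb)
      then show ?thesis
        using ab hermitian_matsD(1)[OF density_matsD(1)[OF \<theta>]] by (simp add: c_def i)
    qed
    then have "frob_norm (c i - \<theta>) \<le> real d * (e / (2 * real d))"
      using e hermitian_matsD(1)[OF density_matsD(1)[OF \<theta>]]
      by (intro frob_norm_le_of_entries minus_carrier_mat) auto
    then show "\<exists>i. frob_norm (c i - \<theta>) < e"
      using e d by (intro exI[of _ i]) simp
  qed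
qed

text \<open>A candidate is a member of the dense sequence \<open>c\<close> that is compatible with the data, where
  \<open>u\<close> is the accuracy of the sample mean. The norm is a Schatten norm rather than the operator norm, so
  that its deviation is the one that \<open>sample_mean_deviation\<close> controls.\<close>

definition candidate :: "nat \<Rightarrow> nat \<Rightarrow> (nat \<Rightarrow> complex mat) \<Rightarrow> real \<Rightarrow> nat \<Rightarrow> (nat \<Rightarrow> real \<times> complex mat) \<Rightarrow> nat \<Rightarrow> bool" where
  "candidate d q c u n \<omega> i \<longleftrightarrow> schatten_norm q (sample_mean d n \<omega> - c i) \<le> 2 * u"

definition precise :: "nat \<Rightarrow> nat \<Rightarrow> (nat \<Rightarrow> complex mat) \<Rightarrow> real \<Rightarrow> real \<Rightarrow> nat \<Rightarrow> (nat \<Rightarrow> real \<times> complex mat) \<Rightarrow> bool" where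
  "precise d q c \<epsilon> u n \<omega> \<longleftrightarrow>
     (\<forall>i j. candidate d q c u n \<omega> i \<longrightarrow> candidate d q c u n \<omega> j \<longrightarrow> frob_norm (c i - c j) \<le> \<epsilon> / 2)"

definition first_candidate :: "nat \<Rightarrow> nat \<Rightarrow> (nat \<Rightarrow> complex mat) \<Rightarrow> real \<Rightarrow> nat \<Rightarrow> (nat \<Rightarrow> real \<times> complex mat) \<Rightarrow> nat" where
  "first_candidate d q c u n \<omega> = (LEAST i. candidate d q c u n \<omega> i)"

lemma hermitian_sample_mean:
  assumes "\<And>l. l < n \<Longrightarrow> snd (\<omega> l) \<in> hermitian_mats d"
  shows "sample_mean d n \<omega> \<in> hermitian_mats d"
proof (rule hermitian_matsI[OF sample_mean_carrier])
  fix i j assume ij: "i < d" "j < d"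
  have "(\<Sum>l<n. of_real (fst (\<omega> l)) * snd (\<omega> l) $$ (i, j)) = (\<Sum>l<n. cnj (of_real (fst (\<omega> l)) * snd (\<omega> l) $$ (j, i)))"
  proof (intro sum.cong refl)
    fix l assume "l \<in> {..<n}"
    then have "snd (\<omega> l) $$ (i, j) = cnj (snd (\<omega> l) $$ (j, i))"
      by (intro hermitian_matsD(3)[OF assms] ij) simp
    then show "of_real (fst (\<omega> l)) * snd (\<omega> l) $$ (i, j) = cnj (of_real (fst (\<omega> l)) * snd (\<omega> l) $$ (j, i))"
      by simp
  qed
  then show "sample_mean d n \<omega> $$ (i, j) = cnj (sample_mean d n \<omega> $$ (j, i))"
    using ij by (simp add: sample_mean_def)
qed

lemma density_diff_split:
  assumes "A \<in> carrier_mat d d" "B \<in> carrier_mat d d" "C \<in> carrier_mat d d"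
  shows "(A :: complex mat) - C = (A - B) + (B - C)" "A - C = (B - C) - (B - A)"
  using assms by (auto intro!: eq_matI)

context
  fixes d q :: nat and c :: "nat \<Rightarrow> complex mat" and u \<epsilon> :: real and n :: nat
    and \<omega> :: "nat \<Rightarrow> real \<times> complex mat" and \<theta> :: "complex mat"
  assumes q: "even q" "q > 0" and u: "u > 0"
    and c: "\<And>i. c i \<in> density_mats d"
    and \<theta>: "\<theta> \<in> density_mats d" and mean: "sample_mean d n \<omega> \<in> hermitian_mats d"
    and good: "schatten_norm q (sample_mean d n \<omega> - \<theta>) \<le> u"
begin

text \<open>A candidate is at distance at most \<open>3 u\<close> from \<open>\<theta>\<close>, hence at Frobenius distance at most \<open>\<epsilon> / 4\<close> by
  \<open>density_low_rank_frob_norm_le\<close>; the constant is \<open>288 = 16 * 2 * 9\<close>, from \<open>2 k (3 u)\<^sup>2 \<le> (\<epsilon> / 4)\<^sup>2\<close>.\<close>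

lemma precise_if_low_rank:
  assumes k: "\<theta> \<in> rank_le_mats d k" and e: "288 * real k * u\<^sup>2 \<le> \<epsilon>\<^sup>2" "\<epsilon> > 0"
  shows "precise d q c \<epsilon> u n \<omega>"
  unfolding precise_def
proof (intro allI impI)
  fix i j assume cand: "candidate d q c u n \<omega> i" "candidate d q c u n \<omega> j"
  note \<theta>H = density_matsD(1)[OF \<theta>] and cH = density_matsD(1)[OF c]
  have near: "frob_norm (c l - \<theta>) \<le> \<epsilon> / 4" if l: "candidate d q c u n \<omega> l" for l
  proof -
    have "schatten_norm q (c l - \<theta>) \<le> schatten_norm q (sample_mean d n \<omega> - \<theta>) + schatten_norm q (sample_mean d n \<omega> - c l)"
      unfolding density_diff_split(2)[OF hermitian_matsD(1)[OF cH] hermitian_matsD(1)[OF mean] hermitian_matsD(1)[OF \<theta>H]]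
      by (rule schatten_norm_triangle_diff[OF hermitian_mats_diff[OF mean \<theta>H] hermitian_mats_diff[OF mean cH] q])
    also have "\<dots> \<le> 3 * u"
      using good l by (simp add: candidate_def)
    finally have "(frob_norm (c l - \<theta>))\<^sup>2 \<le> 2 * real k * (3 * u)\<^sup>2"
      using density_low_rank_frob_norm_le[of \<theta> d k "c l" q "3 * u"] k \<theta> c q by simp
    also have "\<dots> \<le> (\<epsilon> / 4)\<^sup>2"
      using e(1) by (simp add: power_mult_distrib power_divide)
    finally show ?thesis
      using e(2) by (rule_tac power2_le_imp_le) auto
  qed
  have "frob_norm (c i - c j) = schatten_norm 2 ((c i - \<theta>) - (c j - \<theta>))"
  proof -
    have "c i - c j = (c i - \<theta>) - (c j - \<theta>)"
      using hermitian_matsD(1)[OF cH] hermitian_matsD(1)[OF \<theta>H]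
      by (intro eq_matI) (auto simp: carrier_matD[OF hermitian_matsD(1)[OF cH]])
    then show ?thesis
      using frob_norm_eq_schatten_norm[OF hermitian_mats_diff[OF cH cH], of i j] by simp
  qed
  also have "\<dots> \<le> schatten_norm 2 (c i - \<theta>) + schatten_norm 2 (c j - \<theta>)"
    by (rule schatten_norm_triangle_diff[OF hermitian_mats_diff[OF cH \<theta>H] hermitian_mats_diff[OF cH \<theta>H]]) auto
  also have "\<dots> \<le> \<epsilon> / 4 + \<epsilon> / 4"
    using near[OF cand(1)] near[OF cand(2)] frob_norm_eq_schatten_norm[OF hermitian_mats_diff[OF cH \<theta>H]]
    by (intro add_mono) auto
  finally show "frob_norm (c i - c j) \<le> \<epsilon> / 2"
    by simp
qed

text \<open>The matrix \<open>\<theta>\<close> need not belong to the sequence \<open>c\<close>, but a member close to it does, and that member is a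
  candidate because candidates are allowed the distance \<open>2 u\<close> instead of \<open>u\<close>.\<close>

lemma first_candidate_accurate:
  assumes dense: "\<And>e. e > 0 \<Longrightarrow> \<exists>i. frob_norm (c i - \<theta>) < e" and e: "\<epsilon> > 0"
    and stop: "precise d q c \<epsilon> u n \<omega>"
  shows "frob_norm (c (first_candidate d q c u n \<omega>) - \<theta>) \<le> \<epsilon>"
proof -
  note \<theta>H = density_matsD(1)[OF \<theta>] and cH = density_matsD(1)[OF c]
  obtain i where i: "frob_norm (c i - \<theta>) < min u (\<epsilon> / 2)"
    using dense[of "min u (\<epsilon> / 2)"] u e by auto
  have "schatten_norm q (sample_mean d n \<omega> - c i) =
      schatten_norm q ((sample_mean d n \<omega> - \<theta>) - (c i - \<theta>))"
  proof -
    have "sample_mean d n \<omega> - c i = (sample_mean d n \<omega> - \<theta>) - (c i - \<theta>)"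
      using carrier_matD[OF hermitian_matsD(1)[OF cH]] carrier_matD[OF hermitian_matsD(1)[OF \<theta>H]]
        carrier_matD[OF hermitian_matsD(1)[OF mean]] by (intro eq_matI) auto
    then show ?thesis
      by simp
  qed
  also have "\<dots> \<le> schatten_norm q (sample_mean d n \<omega> - \<theta>) + schatten_norm q (c i - \<theta>)"
    by (rule schatten_norm_triangle_diff[OF hermitian_mats_diff[OF mean \<theta>H] hermitian_mats_diff[OF cH \<theta>H] q])
  also have "\<dots> \<le> u + u"
    using good i schatten_norm_le_frob_norm[OF hermitian_mats_diff[OF cH \<theta>H] q, of i] by simp
  finally have ci: "candidate d q c u n \<omega> i"
    by (simp add: candidate_def)
  let ?f = "first_candidate d q c u n \<omega>"
  have cf: "candidate d q c u n \<omega> ?f"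
    unfolding first_candidate_def using ci by (rule LeastI)
  have "frob_norm (c ?f - \<theta>) \<le> frob_norm (c ?f - c i) + frob_norm (c i - \<theta>)"
    unfolding density_diff_split(1)[OF hermitian_matsD(1)[OF cH[of ?f]] hermitian_matsD(1)[OF cH[of i]] hermitian_matsD(1)[OF \<theta>H]]
    by (rule frob_norm_triangle[OF hermitian_mats_diff[OF cH cH] hermitian_mats_diff[OF cH \<theta>H]])
  also have "\<dots> \<le> \<epsilon> / 2 + \<epsilon> / 2"
    using stop cf ci i unfolding precise_def by (intro add_mono) auto
  finally show ?thesis
    by simp
qed

end

lemma candidate_restrict: "n \<le> N \<Longrightarrow> candidate d q c u n (restrict \<omega> {..<N}) = candidate d q c u n \<omega>"
  by (simp add: candidate_def sample_mean_restrict fun_eq_iff)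

lemma precise_restrict: "n \<le> N \<Longrightarrow> precise d q c \<epsilon> u n (restrict \<omega> {..<N}) = precise d q c \<epsilon> u n \<omega>"
  by (simp add: precise_def candidate_restrict)

lemma first_candidate_restrict:
  "n \<le> N \<Longrightarrow> first_candidate d q c u n (restrict \<omega> {..<N}) = first_candidate d q c u n \<omega>"
  by (simp add: first_candidate_def candidate_restrict)

lemma measurable_candidate:
  assumes c: "\<And>i. c i \<in> carrier_mat d d" and n: "n \<le> N"
  shows "Measurable.pred (sample_space S N) (\<lambda>\<omega>. candidate d q c u n \<omega> i)"
proof -
  have "(\<lambda>\<omega>. schatten_norm q (sample_mean d n \<omega> - c i)) \<in> borel_measurable (sample_space S N)"
    by (intro borel_measurable_schatten_norm[of _ d] measurable_mat_diff_const measurable_sample_mean n c)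
  then show ?thesis
    unfolding candidate_def by measurable
qed

lemma measurable_precise:
  assumes "\<And>i. c i \<in> carrier_mat d d" "n \<le> N"
  shows "Measurable.pred (sample_space S N) (\<lambda>\<omega>. precise d q c \<epsilon> u n \<omega>)"
  unfolding precise_def
  by (intro pred_intros_countable pred_intros_logic measurable_candidate assms) auto

text \<open>Candidates are numbered by natural numbers, so the choice of one is measurable without a selection
  theorem.\<close>

lemma measurable_first_candidate:
  assumes "\<And>i. c i \<in> carrier_mat d d" "n \<le> N"
  shows "first_candidate d q c u n \<in> sample_space S N \<rightarrow>\<^sub>M count_space UNIV"
proof -
  have "(\<lambda>\<omega>. LEAST i. candidate d q c u n \<omega> i) \<in> sample_space S N \<rightarrow>\<^sub>M count_space UNIV"
    by (intro measurable_Least measurable_candidate assms)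
  then show ?thesis
    by (simp add: first_candidate_def[abs_def])
qed

lemma measurable_restrict_filtration:
  assumes "n \<le> N"
  shows "(\<lambda>\<omega>. restrict \<omega> {..<n}) \<in> obs_filtration S N \<rightarrow>\<^sub>M sample_space S n"
proof -
  have "(\<lambda>\<omega>. restrict \<omega> {..<N}) \<in> obs_filtration S N \<rightarrow>\<^sub>M sample_space S N"
    unfolding obs_filtration_def
    by (rule measurable_vimage_algebra1) (auto simp: sample_space_def seq_space_def space_PiM PiE_iff)
  moreover have "(\<lambda>\<omega>. restrict \<omega> {..<n}) \<in> sample_space S N \<rightarrow>\<^sub>M sample_space S n"
    unfolding sample_space_def using assms by (intro measurable_restrict_subset) auto
  ultimately have "(\<lambda>\<omega>. restrict (restrict \<omega> {..<N}) {..<n}) \<in> obs_filtration S N \<rightarrow>\<^sub>M sample_space S n"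
    by (rule measurable_compose)
  then show ?thesis
    using assms by (simp add: restrict_restrict Int_absorb1)
qed

lemma measurable_restrict_seq_space:
  "(\<lambda>\<omega>. restrict \<omega> {..<n}) \<in> seq_space S \<rightarrow>\<^sub>M sample_space S n"
  unfolding sample_space_def seq_space_def by (intro measurable_restrict_subset) simp

text \<open>Deals with the cases in which no observation is allowed or needed.\<close>

lemma constant_procedure:
  assumes \<rho>: "\<rho> \<in> carrier_mat d d"
  shows "sequential_procedure d S (\<lambda>_. 0) (\<lambda>_ _. \<rho>)" "returned_matrix (\<lambda>_. 0) (\<lambda>_ _. \<rho>) \<omega> = \<rho>"
  using \<rho> by (auto simp: sequential_procedure_def returned_matrix_def stopping_time_def)

text \<open>Rounding up to a power of two costs at most a factor two.\<close>

lemma ex_least_power_of_two: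
  assumes "x \<le> (2::real) ^ J" "1 \<le> x"
  shows "\<exists>j\<le>J. x \<le> 2 ^ j \<and> 2 ^ j \<le> 2 * x"
proof -
  define j where "j = (LEAST j. x \<le> 2 ^ j)"
  have j: "x \<le> 2 ^ j"
    unfolding j_def by (rule LeastI[of "\<lambda>j. x \<le> 2 ^ j", OF assms(1)])
  have jJ: "j \<le> J"
    unfolding j_def by (rule Least_le[of "\<lambda>j. x \<le> 2 ^ j", OF assms(1)])
  have "(2::real) ^ j \<le> 2 * x"
  proof (cases j)
    case (Suc i)
    then have "\<not> x \<le> 2 ^ i"
      using not_less_Least[of i "\<lambda>j. x \<le> 2 ^ j"] by (simp add: j_def)
    then show ?thesis
      using Suc by simp
  qed (use assms(2) in simp)
  with j jJ show ?thesis
    by blast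
qed

text \<open>Sample sizes are doubled until the candidates agree up to \<open>\<epsilon> / 2\<close>. The accuracy of the sample
  mean at size \<open>n\<close> is taken as \<open>u n\<close>, chosen so that all sizes have the same failure
  probability and that size \<open>n\<^sub>0 2\<^sup>j\<close> is enough for rank \<open>2\<^sup>j\<close>. On the event that no size
  fails, the rule therefore stops as soon as \<open>2\<^sup>j\<close> reaches the rank of \<open>\<theta>\<close>. It always stops at \<open>j = J\<close>,
  since \<open>2\<^sup>J \<ge> d\<close> bounds every rank; this leaves \<open>J + 1\<close> sizes for the union bound. In the bound on the
  failure probability, \<open>1152 = 4 * 288\<close> combines \<open>sample_mean_deviation\<close> with \<open>precise_if_low_rank\<close>.\<close>

theorem adaptive_procedure:
  assumes onb: "hermitian_onb d E" and d: "d > 0" and K: "0 \<le> K"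
    and op: "\<And>i. i < d\<^sup>2 \<Longrightarrow> op_norm (E i) \<le> K / sqrt (real d)"
    and q: "q = 2 ^ Suc m" and n0: "n0 > 0" and \<epsilon>: "\<epsilon> > 0" and b: "\<And>k. 2 * real k * real n0 \<le> b k" and J: "real d \<le> 2 ^ J"
    and fail: "(real J + 1) * (1152 * real q * ((1 + v) * (root q d * K)\<^sup>2 * real d + 1) / (real n0 * \<epsilon>\<^sup>2)) < \<delta>"
  shows "\<exists>N est. sequential_procedure d (design_set d E) N est \<and>
      (\<forall>\<sigma>::real\<ge>0. \<sigma>\<^sup>2 \<le> v \<longrightarrow>
        (\<forall>k\<in>{1..d}. \<forall>\<theta> \<in> rank_le_mats d k \<inter> density_mats d.
          measure (obs_law (design_set d E) \<sigma> \<theta>)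
            {\<omega> \<in> space (obs_law (design_set d E) \<sigma> \<theta>).
               frob_norm (returned_matrix N est \<omega> - \<theta>) \<le> \<epsilon> \<and> real (N \<omega>) \<le> b k}
          > 1 - \<delta>))"
proof -
  let ?S = "design_set d E"
  have q': "even q" "q > 0"
    using q by auto
  obtain c :: "nat \<Rightarrow> complex mat" where c: "\<And>i. c i \<in> density_mats d"
    and dense: "\<And>\<theta> e. \<theta> \<in> density_mats d \<Longrightarrow> e > 0 \<Longrightarrow> \<exists>i. frob_norm (c i - \<theta>) < e"
  proof -
    from density_mats_dense_sequence[OF d] obtain c :: "nat \<Rightarrow> complex mat"
      where "\<forall>i. c i \<in> density_mats d" "\<forall>\<theta>\<in>density_mats d. \<forall>e>0. \<exists>i. frob_norm (c i - \<theta>) < e"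
      by (elim exE conjE)
    then show thesis
      by (intro that[of c]) simp_all
  qed
  have cc: "c i \<in> carrier_mat d d" for i
    by (rule hermitian_matsD(1)[OF density_matsD(1)[OF c]])
  \<comment> \<open>Then \<open>n (u n)\<^sup>2\<close> does not depend on \<open>n\<close>, and \<open>288 * 2 ^ j * (u n)\<^sup>2 = \<epsilon>\<^sup>2\<close> at \<open>n = n0 * 2 ^ j\<close>.\<close>
  define u where "u n = \<epsilon> * sqrt (real n0 / (288 * real n))" for n
  define sz where "sz j = n0 * 2 ^ j" for j :: nat
  have sz: "sz j > 0" for j
    using n0 by (simp add: sz_def)
  have sz_mono: "sz i \<le> sz j" if "i \<le> j" for i j
    using that by (simp add: sz_def)
  have u: "u (sz j) > 0" "(u (sz j))\<^sup>2 = \<epsilon>\<^sup>2 / (288 * 2 ^ j)" for j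
    using n0 \<epsilon> by (auto simp: u_def sz_def power_mult_distrib)
  define fin where "fin j \<omega> \<longleftrightarrow> j \<ge> J \<or> precise d q c \<epsilon> (u (sz j)) (sz j) \<omega>" for j \<omega>
  define jst where "jst \<omega> = (LEAST j. fin j \<omega>)" for \<omega>
  define N where "N \<omega> = sz (jst \<omega>)" for \<omega>
  define est where "est n \<omega> = c (first_candidate d q c (u n) n \<omega>)" for n \<omega>
  have jst: "fin (jst \<omega>) \<omega>" "jst \<omega> \<le> J" "fin j \<omega> \<Longrightarrow> jst \<omega> \<le> j" for \<omega> j
  proof -
    have J: "fin J \<omega>"
      by (simp add: fin_def)
    show "fin (jst \<omega>) \<omega>"
      unfolding jst_def by (rule LeastI[of "\<lambda>j. fin j \<omega>", OF J])
    show "jst \<omega> \<le> J"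
      unfolding jst_def by (rule Least_le[of "\<lambda>j. fin j \<omega>", OF J])
    show "jst \<omega> \<le> j" if "fin j \<omega>"
      unfolding jst_def using that by (rule Least_le)
  qed
  have ret: "returned_matrix N est \<omega> = c (first_candidate d q c (u (N \<omega>)) (N \<omega>) \<omega>)" for \<omega>
    by (simp add: returned_matrix_def est_def first_candidate_restrict)
  have fin_meas: "Measurable.pred M (fin j)"
    if "(\<lambda>\<omega>. restrict \<omega> {..<sz j}) \<in> M \<rightarrow>\<^sub>M sample_space ?S (sz j)" for M j
  proof -
    have "Measurable.pred M (\<lambda>\<omega>. precise d q c \<epsilon> (u (sz j)) (sz j) (restrict \<omega> {..<sz j}))"
      by (rule measurable_compose[OF that measurable_precise]) (auto intro: cc)
    then show ?thesis
      unfolding fin_def[abs_def] by (simp add: precise_restrict)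
  qed
  have proc: "sequential_procedure d ?S N est"
    unfolding sequential_procedure_def
  proof (intro conjI allI ballI impI)
    show "stopping_time (obs_filtration ?S) N"
      unfolding stopping_time_def
    proof
      fix t
      \<comment> \<open>The sizes up to \<open>t\<close> are finitely many, and each of them uses the first \<open>t\<close> observations only.\<close>
      have iff: "N \<omega> \<le> t \<longleftrightarrow> (\<exists>j\<in>{j. j \<le> J \<and> sz j \<le> t}. fin j \<omega>)" for \<omega>
      proof
        assume "N \<omega> \<le> t"
        then show "\<exists>j\<in>{j. j \<le> J \<and> sz j \<le> t}. fin j \<omega>"
          using jst(1,2)[of \<omega>] unfolding N_def by (intro bexI[of _ "jst \<omega>"] CollectI conjI)
      next
        assume "\<exists>j\<in>{j. j \<le> J \<and> sz j \<le> t}. fin j \<omega>"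
        then obtain j where "sz j \<le> t" "fin j \<omega>"
          by blast
        then show "N \<omega> \<le> t"
          using sz_mono[OF jst(3)[OF \<open>fin j \<omega>\<close>]] unfolding N_def by linarith
      qed
      have "Measurable.pred (obs_filtration ?S t) (\<lambda>\<omega>. \<exists>j\<in>{j. j \<le> J \<and> sz j \<le> t}. fin j \<omega>)"
        by (intro pred_intros_finite fin_meas measurable_restrict_filtration) auto
      then show "Measurable.pred (obs_filtration ?S t) (\<lambda>\<omega>. N \<omega> \<le> t)"
        unfolding iff .
    qed
    fix n
    show "est n \<omega> \<in> carrier_mat d d" for \<omega>
      by (simp add: est_def cc)
    fix i j
    have "(\<lambda>\<omega>. c (first_candidate d q c (u n) n \<omega>) $$ (i, j)) \<in> borel_measurable (sample_space ?S n)"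
      by (rule measurable_compose[OF measurable_first_candidate[OF cc order.refl], where g = "\<lambda>l. c l $$ (i, j)"]) simp
    then show "(\<lambda>\<omega>. est n \<omega> $$ (i, j)) \<in> borel_measurable (sample_space ?S n)"
      by (simp add: est_def)
  qed
  have main: "measure (obs_law ?S \<sigma> \<theta>) {\<omega> \<in> space (obs_law ?S \<sigma> \<theta>).
      frob_norm (returned_matrix N est \<omega> - \<theta>) \<le> \<epsilon> \<and> real (N \<omega>) \<le> b k} > 1 - \<delta>"
    if \<sigma>: "0 \<le> \<sigma>" "\<sigma>\<^sup>2 \<le> v" and k: "k \<in> {1..d}" and \<theta>: "\<theta> \<in> rank_le_mats d k \<inter> density_mats d" for \<sigma> k \<theta>
  proof -
    let ?P = "obs_law ?S \<sigma> \<theta>"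
    have S: "finite ?S" "?S \<noteq> {}"
      using d by (auto simp: design_set_def lessThan_empty_iff)
    interpret P: prob_space ?P
      by (rule prob_space_obs_law[OF S \<sigma>(1)])
    have setsP: "sets ?P = sets (seq_space ?S)" and spaceP: "space ?P = space (seq_space ?S)"
      by (simp_all add: obs_law_def)
    have \<theta>d: "\<theta> \<in> density_mats d"
      using \<theta> by simp
    note \<theta>H = density_matsD(1)[OF \<theta>d]
    have mean: "sample_mean d n \<omega> \<in> hermitian_mats d" if "\<omega> \<in> space ?P" for n \<omega>
    proof (rule hermitian_sample_mean)
      fix l
      have "snd (\<omega> l) \<in> ?S"
        using that by (auto simp: spaceP seq_space_def space_PiM space_obs_space PiE_iff mem_Times_iff)
      then show "snd (\<omega> l) \<in> hermitian_mats d"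
        using hermitian_mats_smult[OF hermitian_onbD(1)[OF onb], of _ "real d"] by (auto simp: design_set_def)
    qed
    have R: "(\<lambda>\<omega>. restrict \<omega> {..<n}) \<in> ?P \<rightarrow>\<^sub>M sample_space ?S n" for n
      using measurable_restrict_seq_space[of n ?S] by (simp add: setsP cong: measurable_cong_sets)
    define bad where "bad j = {\<omega> \<in> space ?P. u (sz j) < schatten_norm q (sample_mean d (sz j) \<omega> - \<theta>)}" for j
    have bad: "bad j \<in> sets ?P" for j
    proof -
      have "(\<lambda>\<omega>. schatten_norm q (sample_mean d (sz j) \<omega> - \<theta>)) \<in> borel_measurable (sample_space ?S (sz j))"
        by (intro borel_measurable_schatten_norm[of _ d] measurable_mat_diff_const measurable_sample_mean
            hermitian_matsD(1)[OF \<theta>H]) simp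
      from measurable_compose[OF R this]
      have "(\<lambda>\<omega>. schatten_norm q (sample_mean d (sz j) \<omega> - \<theta>)) \<in> borel_measurable ?P"
        by (simp add: sample_mean_restrict)
      then show ?thesis
        unfolding bad_def by measurable
    qed
    let ?p = "1152 * real q * ((1 + v) * (root q d * K)\<^sup>2 * real d + 1) / (real n0 * \<epsilon>\<^sup>2)"
    have p: "measure ?P (bad j) \<le> ?p" for j
    proof -
      have "measure ?P (bad j) \<le>
          4 * real q * ((1 + v) * (root q d * K)\<^sup>2 * real d + 1) / (real (sz j) * (u (sz j))\<^sup>2)"
        unfolding bad_def by (rule sample_mean_deviation[OF onb d K op \<sigma> \<theta>d q sz u(1)])
      also have "real (sz j) * (u (sz j))\<^sup>2 = real n0 * \<epsilon>\<^sup>2 / 288"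
        unfolding u(2) by (simp add: sz_def)
      finally show ?thesis
        by simp
    qed
    define G where "G = space ?P - (\<Union>j\<in>{..J}. bad j)"
    have "measure ?P (\<Union>j\<in>{..J}. bad j) \<le> (\<Sum>j\<in>{..J}. measure ?P (bad j))"
      by (rule P.finite_measure_subadditive_finite) (use bad in auto)
    also have "\<dots> \<le> (\<Sum>j\<in>{..J}. ?p)"
      by (rule sum_mono) (rule p)
    also have "\<dots> = (real J + 1) * ?p"
      by simp
    also have "\<dots> < \<delta>"
      by (rule fail)
    finally have "measure ?P G > 1 - \<delta>"
      unfolding G_def using P.prob_compl[of "\<Union>j\<in>{..J}. bad j"] bad by auto
    moreover have "measure ?P G \<le> measure ?P {\<omega> \<in> space ?P.
        frob_norm (returned_matrix N est \<omega> - \<theta>) \<le> \<epsilon> \<and> real (N \<omega>) \<le> b k}"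
    proof (rule P.finite_measure_mono)
      show "G \<subseteq> {\<omega> \<in> space ?P. frob_norm (returned_matrix N est \<omega> - \<theta>) \<le> \<epsilon> \<and> real (N \<omega>) \<le> b k}"
      proof
        fix \<omega> assume "\<omega> \<in> G"
        then have \<omega>: "\<omega> \<in> space ?P" and good: "\<And>j. j \<le> J \<Longrightarrow> schatten_norm q (sample_mean d (sz j) \<omega> - \<theta>) \<le> u (sz j)"
          by (auto simp: G_def bad_def not_less)
        have prec: "precise d q c \<epsilon> (u (sz j)) (sz j) \<omega>" if j: "j \<le> J" "real k \<le> 2 ^ j" for j
        proof (rule precise_if_low_rank[OF q' u(1) c \<theta>d mean[OF \<omega>] good[OF j(1)]])
          show "\<theta> \<in> rank_le_mats d k"
            using \<theta> by simp
          have "real k / 2 ^ j * \<epsilon>\<^sup>2 \<le> 1 * \<epsilon>\<^sup>2"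
            using j(2) by (intro mult_right_mono) auto
          then show "288 * real k * (u (sz j))\<^sup>2 \<le> \<epsilon>\<^sup>2"
            by (simp add: u(2))
        qed (rule \<epsilon>)
        have kJ: "real k \<le> 2 ^ J" "1 \<le> real k"
          using k J by auto
        obtain j where j: "j \<le> J" "real k \<le> 2 ^ j" "2 ^ j \<le> 2 * real k"
          using ex_least_power_of_two[OF kJ] by blast
        have "jst \<omega> \<le> j"
          using prec[OF j(1,2)] by (intro jst(3)) (simp add: fin_def)
        then have "real (N \<omega>) \<le> real (sz j)"
          by (simp add: N_def sz_mono)
        also have "\<dots> = real n0 * 2 ^ j"
          by (simp add: sz_def)
        also have "\<dots> \<le> real n0 * (2 * real k)"
          using j(3) by (intro mult_left_mono) auto
        also have "\<dots> \<le> b k"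
          using b[of k] by (simp add: mult_ac)
        finally have 1: "real (N \<omega>) \<le> b k" .
        \<comment> \<open>If the rule stops only because \<open>j = J\<close>, the rank bound gives precision nevertheless.\<close>
        have "precise d q c \<epsilon> (u (N \<omega>)) (N \<omega>) \<omega>"
        proof (cases "jst \<omega> \<ge> J")
          case True
          then have "jst \<omega> = J"
            using jst(2)[of \<omega>] by simp
          then show ?thesis
            using prec[OF order.refl kJ(1)] by (simp add: N_def)
        next
          case False
          then show ?thesis
            using jst(1)[of \<omega>] by (simp add: N_def fin_def)
        qed
        then have stop: "precise d q c \<epsilon> (u (sz (jst \<omega>))) (sz (jst \<omega>)) \<omega>"
          by (simp only: N_def)
        have "frob_norm (c (first_candidate d q c (u (sz (jst \<omega>))) (sz (jst \<omega>)) \<omega>) - \<theta>) \<le> \<epsilon>"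
        proof (rule first_candidate_accurate[OF q'])
          show "0 < u (sz (jst \<omega>))"
            by (rule u(1))
          show "c i \<in> density_mats d" for i
            by (rule c)
          show "\<theta> \<in> density_mats d"
            by (rule \<theta>d)
          show "sample_mean d (sz (jst \<omega>)) \<omega> \<in> hermitian_mats d"
            by (rule mean[OF \<omega>])
          show "schatten_norm q (sample_mean d (sz (jst \<omega>)) \<omega> - \<theta>) \<le> u (sz (jst \<omega>))"
            by (rule good[OF jst(2)])
          show "\<exists>i. frob_norm (c i - \<theta>) < e" if "e > 0" for e
            by (rule dense[OF \<theta>d that])
        qed (rule \<epsilon> stop)+
        then have "frob_norm (c (first_candidate d q c (u (N \<omega>)) (N \<omega>) \<omega>) - \<theta>) \<le> \<epsilon>"
          by (simp only: N_def)
        with 1 \<omega> show "\<omega> \<in> {\<omega> \<in> space ?P. frob_norm (returned_matrix N est \<omega> - \<theta>) \<le> \<epsilon> \<and> real (N \<omega>) \<le> b k}"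
          by (simp add: ret)
      qed
      have "jst \<in> ?P \<rightarrow>\<^sub>M count_space UNIV"
        unfolding jst_def[abs_def] by (intro measurable_Least fin_meas R)
      then have Nm: "N \<in> ?P \<rightarrow>\<^sub>M count_space UNIV"
        unfolding N_def[abs_def] by (rule measurable_compose) simp
      have "first_candidate d q c (u n) n \<in> ?P \<rightarrow>\<^sub>M count_space UNIV" for n
        using measurable_compose[OF R measurable_first_candidate[OF cc order.refl]]
        by (simp add: first_candidate_restrict)
      from measurable_compose_countable[OF this Nm]
      have "(\<lambda>\<omega>. (first_candidate d q c (u (N \<omega>)) (N \<omega>) \<omega>, N \<omega>)) \<in> ?P \<rightarrow>\<^sub>M count_space UNIV \<Otimes>\<^sub>M count_space UNIV"
        using Nm by (rule measurable_Pair)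
      then have pm: "(\<lambda>\<omega>. (first_candidate d q c (u (N \<omega>)) (N \<omega>) \<omega>, N \<omega>)) \<in> ?P \<rightarrow>\<^sub>M count_space UNIV"
        by (simp add: pair_measure_countable)
      have "Measurable.pred ?P (\<lambda>\<omega>. (\<lambda>(l, n). frob_norm (c l - \<theta>) \<le> \<epsilon> \<and> real n \<le> b k)
          (first_candidate d q c (u (N \<omega>)) (N \<omega>) \<omega>, N \<omega>))"
        by (rule measurable_compose[OF pm]) simp
      then show "{\<omega> \<in> space ?P. frob_norm (returned_matrix N est \<omega> - \<theta>) \<le> \<epsilon> \<and> real (N \<omega>) \<le> b k} \<in> sets ?P"
        by (simp add: ret pred_def)
    qed
    ultimately show ?thesis
      by linarith
  qed
  show ?thesis
  proof (intro exI conjI allI impI ballI)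
    show "sequential_procedure d ?S N est"
      by (rule proc)
  qed (rule main)
qed

section \<open>Choice of the exponent and the sample size\<close>

text \<open>The reason for the choice \<open>q \<ge> ln d\<close>: the Schatten norm then exceeds the operator norm by a bounded
  factor only.\<close>

lemma root_le_exp_1:
  assumes "x > 0" "ln x \<le> real q" "q > 0"
  shows "root q x \<le> exp 1"
proof -
  have "x = exp (ln x)"
    using assms by simp
  also have "\<dots> \<le> exp (real q)"
    using assms(2) by simp
  also have "\<dots> = exp 1 ^ q"
    by (simp add: exp_of_nat_mult[symmetric])
  finally have "root q x \<le> root q (exp 1 ^ q)"
    using assms(3) by simp
  then show ?thesis
    using assms(3) by (simp add: real_root_power_cancel)
qed

text \<open>It remains to choose \<open>q\<close> and the first sample size in \<open>adaptive_procedure\<close>. For \<open>d = 1\<close> the bound on the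
  number of observations is zero because \<open>ln 1 = 0\<close>, and there is only one density matrix; for \<open>\<epsilon> \<ge> 2\<close> any
  density matrix will do, as the Frobenius norm of a density matrix is at most one. In both cases no
  observations are made. Otherwise \<open>q\<close> is a power of two between \<open>ln d\<close> and \<open>3 ln d\<close>, and the first sample
  size is a multiple of \<open>d (ln d)\<^sup>2 / \<epsilon>\<^sup>2\<close>.\<close>

theorem theorem1:
  shows "\<exists>\<gamma>::real>0. \<forall>K::real>0. \<forall>v::real\<ge>0. \<forall>\<delta>::real>0. \<exists>C::real>0. \<forall>\<epsilon>::real>0. \<forall>d::nat\<ge>1. \<forall>E.
    hermitian_onb d E \<and> (\<forall>i<d\<^sup>2. op_norm (E i) \<le> K / sqrt (real d)) \<longrightarrow>
    (\<exists>N est. sequential_procedure d (design_set d E) N est \<and>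
      (\<forall>\<sigma>::real\<ge>0. \<sigma>\<^sup>2 \<le> v \<longrightarrow>
        (\<forall>k\<in>{1..d}. \<forall>\<theta> \<in> rank_le_mats d k \<inter> density_mats d.
          measure (obs_law (design_set d E) \<sigma> \<theta>)
            {\<omega> \<in> space (obs_law (design_set d E) \<sigma> \<theta>).
               frob_norm (returned_matrix N est \<omega> - \<theta>) \<le> \<epsilon> \<and>
               real (N \<omega>) \<le> C * (real k * real d * (ln (real d)) powr \<gamma> / \<epsilon>\<^sup>2)}
          > 1 - \<delta>)))"
proof (rule exI[of _ 2], intro conjI allI impI)
  show "(0::real) < 2"
    by simp
  fix K v \<delta> :: real assume K: "K > 0" and v: "v \<ge> 0" and \<delta>: "\<delta> > 0"
  define C1 where "C1 = (1 + v) * (exp 1 * K)\<^sup>2 + 1"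
  \<comment> \<open>The constant is \<open>2 * 1152 * 15\<close>, with \<open>15\<close> from \<open>q \<le> 3 ln d\<close> and \<open>J + 1 \<le> 5 ln d\<close>; the factor two makes
    the failure probability strictly smaller than \<open>\<delta>\<close>.\<close>
  define A where "A = 34560 * C1 / \<delta>"
  have C1: "C1 > 0"
    using v by (simp add: C1_def add_nonneg_pos)
  then have A: "A > 0"
    using \<delta> by (simp add: A_def)
  show "\<exists>C>0. \<forall>\<epsilon>>0. \<forall>d\<ge>1. \<forall>E. hermitian_onb d E \<and> (\<forall>i<d\<^sup>2. op_norm (E i) \<le> K / sqrt (real d)) \<longrightarrow>
    (\<exists>N est. sequential_procedure d (design_set d E) N est \<and>
      (\<forall>\<sigma>\<ge>0. \<sigma>\<^sup>2 \<le> v \<longrightarrow>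
        (\<forall>k\<in>{1..d}. \<forall>\<theta> \<in> rank_le_mats d k \<inter> density_mats d.
          measure (obs_law (design_set d E) \<sigma> \<theta>)
            {\<omega> \<in> space (obs_law (design_set d E) \<sigma> \<theta>).
               frob_norm (returned_matrix N est \<omega> - \<theta>) \<le> \<epsilon> \<and>
               real (N \<omega>) \<le> C * (real k * real d * (ln (real d)) powr 2 / \<epsilon>\<^sup>2)}
          > 1 - \<delta>)))"
  \<comment> \<open>The \<open>5\<close> absorbs the rounding of the first sample size, the \<open>2\<close> the rounding of the rank to a power of two.\<close>
  proof (intro exI[of _ "2 * (A + 5)"] conjI allI impI)
    show "0 < 2 * (A + 5)"
      using A by simp
    fix \<epsilon> :: real and d :: nat and E
    assume \<epsilon>: "\<epsilon> > 0" and d1: "d \<ge> 1" and E: "hermitian_onb d E \<and> (\<forall>i<d\<^sup>2. op_norm (E i) \<le> K / sqrt (real d))"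
    have d: "d > 0"
      using d1 by simp
    let ?S = "design_set d E"
    let ?L = "ln (real d)"
    show "\<exists>N est. sequential_procedure d ?S N est \<and>
      (\<forall>\<sigma>\<ge>0. \<sigma>\<^sup>2 \<le> v \<longrightarrow>
        (\<forall>k\<in>{1..d}. \<forall>\<theta> \<in> rank_le_mats d k \<inter> density_mats d.
          measure (obs_law ?S \<sigma> \<theta>)
            {\<omega> \<in> space (obs_law ?S \<sigma> \<theta>). frob_norm (returned_matrix N est \<omega> - \<theta>) \<le> \<epsilon> \<and>
               real (N \<omega>) \<le> 2 * (A + 5) * (real k * real d * ?L powr 2 / \<epsilon>\<^sup>2)} > 1 - \<delta>))"
    proof (cases "d = 1 \<or> \<epsilon> \<ge> 2")
      case True
      obtain \<rho> where \<rho>: "\<rho> \<in> density_mats d"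
        using density_mats_nonempty[OF d] by blast
      note \<rho>H = density_matsD(1)[OF \<rho>]
      have close: "frob_norm (\<rho> - \<theta>) \<le> \<epsilon>" if \<theta>: "\<theta> \<in> density_mats d" for \<theta>
      proof (cases "d = 1")
        case True
        note \<theta>c = hermitian_matsD(1)[OF density_matsD(1)[OF \<theta>]]
        have "\<rho> $$ (0, 0) = \<theta> $$ (0, 0)"
          using density_matsD(2)[OF \<rho>] density_matsD(2)[OF \<theta>] True
          by (simp add: mat_trace_carrier[OF \<theta>c] mat_trace_carrier[OF hermitian_matsD(1)[OF \<rho>H]])
        then have "frob_norm (\<rho> - \<theta>) \<le> real d * 0"
          using True \<theta>c by (intro frob_norm_le_of_entries minus_carrier_mat) auto
        then show ?thesis
          using \<epsilon> by simp
      next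
        case False
        have "frob_norm (\<rho> - \<theta>) \<le> frob_norm \<rho> + frob_norm \<theta>"
          using schatten_norm_triangle_diff[OF \<rho>H density_matsD(1)[OF \<theta>], of 2] \<rho>H density_matsD(1)[OF \<theta>]
            hermitian_mats_diff[OF \<rho>H density_matsD(1)[OF \<theta>]]
          by (simp add: frob_norm_eq_schatten_norm)
        then show ?thesis
          using frob_norm_density_le_1[OF \<rho>] frob_norm_density_le_1[OF \<theta>] True False by linarith
      qed
      have "measure (obs_law ?S \<sigma> \<theta>) {\<omega> \<in> space (obs_law ?S \<sigma> \<theta>).
          frob_norm (returned_matrix (\<lambda>_. 0) (\<lambda>_ _. \<rho>) \<omega> - \<theta>) \<le> \<epsilon> \<and>
          real 0 \<le> 2 * (A + 5) * (real k * real d * ?L powr 2 / \<epsilon>\<^sup>2)} > 1 - \<delta>"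
        if "\<sigma> \<ge> 0" "\<theta> \<in> density_mats d" for \<sigma> k \<theta>
      proof -
        have "prob_space (obs_law ?S \<sigma> \<theta>)"
          using that(1) d by (intro prob_space_obs_law) (auto simp: design_set_def lessThan_empty_iff)
        moreover have "0 \<le> 2 * (A + 5) * (real k * real d * ?L powr 2 / \<epsilon>\<^sup>2)"
          using A by simp
        ultimately show ?thesis
          using close[OF that(2)] \<delta> prob_space.prob_space[of "obs_law ?S \<sigma> \<theta>"]
          by (simp add: returned_matrix_def)
      qed
      then show ?thesis
        using constant_procedure(1)[OF hermitian_matsD(1)[OF \<rho>H], of ?S]
        by (intro exI[of _ "\<lambda>_. 0"] exI[of _ "\<lambda>_ _. \<rho>"]) blast
    next
      case False
      then have d2: "d \<ge> 2" and \<epsilon>2: "\<epsilon> < 2"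
        using d1 by auto
      have L: "?L \<ge> 2 / 3"
      proof -
        have "ln 2 \<le> ?L"
          using d2 by simp
        then show ?thesis
          using ln2_ge_two_thirds by linarith
      qed
      have Lq: "?L powr 2 = ?L\<^sup>2"
        using L by (simp add: powr_numeral)
      obtain m where m: "?L / 2 \<le> 2 ^ m" "real (2 ^ Suc m) \<le> 3 * ?L"
      proof -
        obtain J' where J': "max 1 (?L / 2) \<le> 2 ^ J'"
          using real_arch_pow[of 2 "max 1 (?L / 2)"] by (auto intro: less_imp_le)
        from ex_least_power_of_two[OF this] obtain m where m: "max 1 (?L / 2) \<le> 2 ^ m" "2 ^ m \<le> 2 * max 1 (?L / 2)"
          by auto
        show ?thesis
        proof (cases "?L / 2 \<le> 1")
          case True
          then show ?thesis
            using that[of 0] L by simp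
        next
          case False
          then show ?thesis
            using m that[of m] by auto
        qed
      qed
      define q where "q = (2::nat) ^ Suc m"
      have q: "real q \<ge> ?L" "real q \<le> 3 * ?L" "q > 0"
        using m by (auto simp: q_def)
      obtain J where J: "real d \<le> 2 ^ J" "2 ^ J \<le> 2 * real d"
      proof -
        obtain J' where "real d \<le> 2 ^ J'"
          using real_arch_pow[of 2 "real d"] by (auto intro: less_imp_le)
        then show ?thesis
          using ex_least_power_of_two[of "real d" J'] d1 that by auto
      qed
      have J5: "real J + 1 \<le> 5 * ?L"
      proof -
        have "ln ((2::real) ^ J) \<le> ln (2 * real d)"
          using J(2) d by (subst ln_le_cancel_iff) auto
        then have le: "real J * ln 2 - ln 2 \<le> ?L"
          using d by (simp add: ln_mult ln_realpow)
        have "real J \<le> 3 / 2 * ?L + 1"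
        proof (cases "J \<ge> 1")
          case True
          have "(real J - 1) * (2 / 3) \<le> (real J - 1) * ln 2"
            using True ln2_ge_two_thirds by (intro mult_left_mono) auto
          also have "\<dots> \<le> ?L"
            using le by (simp only: left_diff_distrib mult_1_left)
          finally show ?thesis
            by simp
        qed (use L in simp)
        then show ?thesis
          using L by linarith
      qed
      define n0 where "n0 = nat \<lceil>A * real d * ?L\<^sup>2 / \<epsilon>\<^sup>2\<rceil>"
      have pos: "A * real d * ?L\<^sup>2 / \<epsilon>\<^sup>2 > 0"
        using A d2 L \<epsilon> by (intro divide_pos_pos mult_pos_pos zero_less_power) auto
      have n0_ge: "A * real d * ?L\<^sup>2 / \<epsilon>\<^sup>2 \<le> real n0"
        using pos by (simp add: n0_def)
      have n0: "n0 > 0"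
      proof -
        have "0 < real n0"
          using pos n0_ge by (rule less_le_trans)
        then show ?thesis
          by simp
      qed
      have n0_le: "real n0 \<le> (A + 5) * (real d * ?L\<^sup>2 / \<epsilon>\<^sup>2)"
      proof -
        have "real n0 \<le> A * real d * ?L\<^sup>2 / \<epsilon>\<^sup>2 + 1"
          unfolding n0_def using pos ceiling_correct[of "A * real d * ?L\<^sup>2 / \<epsilon>\<^sup>2"] by simp
        \<comment> \<open>Since \<open>\<epsilon> < 2\<close> and \<open>d \<ge> 2\<close>, rounding the sample size up to an integer costs a constant factor only.\<close>
        moreover have "1 \<le> 5 * (real d * ?L\<^sup>2 / \<epsilon>\<^sup>2)"
        proof -
          have "\<epsilon>\<^sup>2 \<le> 2\<^sup>2"
            using \<epsilon> \<epsilon>2 by (intro power_mono) auto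
          moreover have "(2 / 3)\<^sup>2 \<le> ?L\<^sup>2"
            using L by (intro power_mono) auto
          then have "2 * (2 / 3)\<^sup>2 \<le> real d * ?L\<^sup>2"
            using d2 by (intro mult_mono) auto
          ultimately have "\<epsilon>\<^sup>2 \<le> 5 * (real d * ?L\<^sup>2)"
            by (simp add: power2_eq_square)
          then show ?thesis
            using \<epsilon> by (simp add: field_simps)
        qed
        moreover have "A * real d * ?L\<^sup>2 / \<epsilon>\<^sup>2 = A * (real d * ?L\<^sup>2 / \<epsilon>\<^sup>2)"
          by simp
        ultimately show ?thesis
          unfolding distrib_right by linarith
      qed
      have fail: "(real J + 1) * (1152 * real q * ((1 + v) * (root q d * K)\<^sup>2 * real d + 1) / (real n0 * \<epsilon>\<^sup>2)) < \<delta>"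
      proof -
        have "root q d \<le> exp 1"
          using d q by (intro root_le_exp_1) auto
        then have "(root q d * K)\<^sup>2 \<le> (exp 1 * K)\<^sup>2"
          using K by (intro power_mono mult_right_mono) (auto simp: real_root_ge_zero)
        then have "(1 + v) * (root q d * K)\<^sup>2 * real d + 1 \<le> (1 + v) * (exp 1 * K)\<^sup>2 * real d + real d"
          using v d1 by (intro add_mono mult_right_mono mult_left_mono) auto
        then have C: "(1 + v) * (root q d * K)\<^sup>2 * real d + 1 \<le> C1 * real d"
          by (simp add: C1_def algebra_simps)
        have n0e: "A * real d * ?L\<^sup>2 \<le> real n0 * \<epsilon>\<^sup>2"
          using n0_ge \<epsilon> by (simp add: field_simps)
        have "(real J + 1) * (1152 * real q * ((1 + v) * (root q d * K)\<^sup>2 * real d + 1)) \<le>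
            (5 * ?L) * (1152 * (3 * ?L) * (C1 * real d))"
          using J5 q C L v by (intro mult_mono) auto
        also have "\<dots> = \<delta> / 2 * (A * real d * ?L\<^sup>2)"
          using \<delta> by (simp add: A_def power2_eq_square)
        also have "\<dots> \<le> \<delta> / 2 * (real n0 * \<epsilon>\<^sup>2)"
          using n0e \<delta> by (intro mult_left_mono) auto
        finally have "(real J + 1) * (1152 * real q * ((1 + v) * (root q d * K)\<^sup>2 * real d + 1)) / (real n0 * \<epsilon>\<^sup>2) \<le> \<delta> / 2"
          using n0 \<epsilon> by (subst pos_divide_le_eq) auto
        then show ?thesis
          using \<delta> by simp
      qed
      show ?thesis
      proof (rule adaptive_procedure[OF _ d less_imp_le[OF K] _ q_def n0 \<epsilon> _ J(1) fail])
        fix k :: nat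
        have "2 * real k * real n0 \<le> 2 * real k * ((A + 5) * (real d * ?L\<^sup>2 / \<epsilon>\<^sup>2))"
          using n0_le by (intro mult_left_mono) auto
        also have "\<dots> = 2 * (A + 5) * (real k * real d * ?L powr 2 / \<epsilon>\<^sup>2)"
          unfolding Lq by simp
        finally show "2 * real k * real n0 \<le> 2 * (A + 5) * (real k * real d * ?L powr 2 / \<epsilon>\<^sup>2)" .
      qed (use E in auto)
    qed
  qed
qed

end
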